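(* In $\mathbb H^1$ the only stable $H$-minimal entire graphs with empty characteristic locus are the vertical planes. That is, if $\mathcal S\subset\mathbb H^1$ is a stable $H$-minimal entire graph with $\Sigma(\mathcal S)=\varnothing$, then there exist $a,b,\gamma\in\mathbb R$, $(a,b)\ne(0,0)$, such that $\mathcal S=\{(x,y,t)\in\mathbb H^1\mid ax+by=\gamma\}$.
   Context: $\mathbb H^1$ is $\mathbb R^3$ with the group law $(x,y,t)\circ(x',y',t')=(x+x',y+y',t+t'+\tfrac12(xy'-x'y))$. Left-invariant vector fields: $X_1=\partial_x-\tfrac y2\partial_t$, $X_2=\partial_y+\tfrac x2\partial_t$, $T=\partial_t$. The characteristic locus of a $C^2$ surface $\mathcal S$ is $\Sigma(\mathcal S)=\{g\in\mathcal S\mid T_g\mathcal S=\mathrm{span}\{X_1(g),X_2(g)\}\}$. If $\Sigma(\mathcal S)=\varnothing$, for a local $C^2$ defining function $\phi$ put $W=\sqrt{(X_1\phi)^2+(X_2\phi)^2}$; the $H$-mean curvature is $\mathcal H=X_1(X_1\phi/W)+X_2(X_2\phi/W)$ restricted to $\mathcal S$, and $\mathcal S$ is $H$-minimal if $\mathcal H\equiv0$. The $H$-perimeter measure on $\mathcal S$ is $d\sigma_H=\frac{W}{|\nabla_e\phi|}\,d\mathcal H^2$, with $\nabla_e$ the Euclidean gradient and $\mathcal H^2$ the Euclidean surface measure, and $P_H(\mathcal S)=\sigma_H(\mathcal S)$. For $\mathcal X=aX_1+bX_2+kT$ with $a,b,k\in C^2_0(\mathcal S)$ (compactly supported), let $\mathcal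 S^\lambda=\mathcal S+\lambda\mathcal X$, i.e. each $g\in\mathcal S$ is moved to $g+\lambda\mathcal X(g)$; the second variation is $\mathcal V^H_{II}(\mathcal S;\mathcal X)=\frac{d^2}{d\lambda^2}P_H(\mathcal S^\lambda)|_{\lambda=0}$ (only the perimeter of a compact portion containing the support of $\mathcal X$ matters). An $H$-minimal $\mathcal S$ with empty characteristic locus is stable if $\mathcal V^H_{II}(\mathcal S;\mathcal X)\ge0$ for every such $\mathcal X$. Entire graph: a $C^2$ surface $\mathcal S\subset\mathbb H^1$ for which there is a plane $P=\{ax+by+ct=\gamma\}$, $(a,b,c)\ne0$, such that for every $g_0\in P$ the straight line $\{g_0+s(a,b,c)\mid s\in\mathbb R\}$ intersects $\mathcal S$ in exactly one point. *)

theory Defs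
  imports "HOL-Analysis.Analysis"
begin

section \<open>The Heisenberg frame\<close>

text \<open>
  Points of the first Heisenberg group are triples of reals \<open>(x, y, t)\<close>; the norm of this product
  type is the Euclidean one. The group law
  \<open>(x, y, t) \<circ> (x', y', t') = (x + x', y + y', t + t' + (x * y' - x' * y) / 2)\<close>
  enters only through its left-invariant vector fields.
\<close>

type_synonym heis = "real \<times> real \<times> real"

fun X1 :: "heis \<Rightarrow> heis" where "X1 (x, y, t) = (1, 0, - y / 2)"
fun X2 :: "heis \<Rightarrow> heis" where "X2 (x, y, t) = (0, 1, x / 2)"
fun TT :: "heis \<Rightarrow> heis" where "TT (x, y, t) = (0, 0, 1)"

text \<open>A vector field acting on functions as a first-order differential operator.\<close>

definition vf_deriv :: "(heis \<Rightarrow> heis) \<Rightarrow> (heis \<Rightarrow> real) \<Rightarrow> heis \<Rightarrow> real" where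
  "vf_deriv V \<phi> g = frechet_derivative \<phi> (at g) (V g)"

definition euclid_grad :: "(heis \<Rightarrow> real) \<Rightarrow> heis \<Rightarrow> heis" where
  "euclid_grad \<phi> g =
     (frechet_derivative \<phi> (at g) (1, 0, 0),
      frechet_derivative \<phi> (at g) (0, 1, 0),
      frechet_derivative \<phi> (at g) (0, 0, 1))"


section \<open>Surfaces of class C2\<close>

text \<open>To be used with open \<open>U\<close> only. In finite dimension, continuity of every directional derivative
  of a differentiable function is continuity of its differential.\<close>

definition C1_on :: "heis set \<Rightarrow> (heis \<Rightarrow> real) \<Rightarrow> bool" where
  "C1_on U f \<longleftrightarrow>
     (\<forall>g\<in>U. f differentiable (at g)) \<and>
     (\<forall>v. continuous_on U (\<lambda>g. frechet_derivative f (at g) v))"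

definition C2_on :: "heis set \<Rightarrow> (heis \<Rightarrow> real) \<Rightarrow> bool" where
  "C2_on U f \<longleftrightarrow>
     (\<forall>g\<in>U. f differentiable (at g)) \<and>
     (\<forall>v. C1_on U (\<lambda>g. frechet_derivative f (at g) v))"

definition defining_function :: "heis set \<Rightarrow> heis set \<Rightarrow> (heis \<Rightarrow> real) \<Rightarrow> bool" where
  "defining_function S U \<phi> \<longleftrightarrow>
     open U \<and> C2_on U \<phi> \<and> S \<inter> U = {g \<in> U. \<phi> g = 0} \<and> (\<forall>g\<in>S \<inter> U. euclid_grad \<phi> g \<noteq> 0)"

definition C2_surface :: "heis set \<Rightarrow> bool" where
  "C2_surface S \<longleftrightarrow> (\<forall>g\<in>S. \<exists>U \<phi>. g \<in> U \<and> defining_function S U \<phi>)"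

text \<open>Tangent vectors are the velocities of curves lying in the surface.\<close>

definition tangent_space :: "heis set \<Rightarrow> heis \<Rightarrow> heis set" where
  "tangent_space S g =
     {v. \<exists>c \<epsilon>. \<epsilon> > 0 \<and> (\<forall>s. \<bar>s\<bar> < \<epsilon> \<longrightarrow> c s \<in> S) \<and> c 0 = g \<and> (c has_vector_derivative v) (at (0::real))}"

definition char_locus :: "heis set \<Rightarrow> heis set" where
  "char_locus S = {g \<in> S. tangent_space S g = span {X1 g, X2 g}}"

definition entire_graph :: "heis set \<Rightarrow> bool" where
  "entire_graph S \<longleftrightarrow> C2_surface S \<and>
     (\<exists>a b c \<gamma>. (a, b, c) \<noteq> (0, 0, 0) \<and>
        (\<forall>g0 \<in> {(x, y, t). a * x + b * y + c * t = \<gamma>}.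
           \<exists>!g. g \<in> S \<inter> {g0 + s *\<^sub>R (a, b, c) |s::real. True}))"


section \<open>H-mean curvature\<close>

definition heis_W :: "(heis \<Rightarrow> real) \<Rightarrow> heis \<Rightarrow> real" where
  "heis_W \<phi> g = sqrt ((vf_deriv X1 \<phi> g)\<^sup>2 + (vf_deriv X2 \<phi> g)\<^sup>2)"

definition H_mean_curvature :: "(heis \<Rightarrow> real) \<Rightarrow> heis \<Rightarrow> real" where
  "H_mean_curvature \<phi> g =
     vf_deriv X1 (\<lambda>h. vf_deriv X1 \<phi> h / heis_W \<phi> h) g +
     vf_deriv X2 (\<lambda>h. vf_deriv X2 \<phi> h / heis_W \<phi> h) g"

text \<open>Up to sign, the H-mean curvature at a point of the surface does not depend on the defining
  function; the following is meant for surfaces without characteristic points.\<close>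

definition H_minimal :: "heis set \<Rightarrow> bool" where
  "H_minimal S \<longleftrightarrow>
     (\<forall>U \<phi>. defining_function S U \<phi> \<longrightarrow> (\<forall>g\<in>S \<inter> U. H_mean_curvature \<phi> g = 0))"


section \<open>Two-dimensional Hausdorff measure\<close>

text \<open>The constant \<open>pi / 4\<close> (the area of a planar disc of diameter 1) normalizes the measure so that
  it is surface area on surfaces. Covering sets are required to be bounded because \<^const>\<open>diameter\<close>
  is unspecified on unbounded sets.\<close>

definition hausdorff2_pre :: "real \<Rightarrow> 'a::metric_space set \<Rightarrow> ennreal" where
  "hausdorff2_pre \<delta> A =
     Inf {(\<Sum>n. ennreal (pi / 4 * (diameter (E n))\<^sup>2)) |E :: nat \<Rightarrow> 'a set.
            A \<subseteq> (\<Union>n. E n) \<and> (\<forall>n. bounded (E n) \<and> diameter (E n) \<le> \<delta>)}"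

definition hausdorff2_outer :: "'a::metric_space set \<Rightarrow> ennreal" where
  "hausdorff2_outer A = (SUP \<delta>\<in>{0<..}. hausdorff2_pre \<delta> A)"

text \<open>The lemma \<open>emeasure_hausdorff2\<close> at the end of this theory shows that this is indeed a measure.\<close>

definition hausdorff2 :: "'a::metric_space measure" where
  "hausdorff2 = measure_of UNIV (sets borel) hausdorff2_outer"


section \<open>H-perimeter and its second variation\<close>

text \<open>The density \<open>heis_W / |grad \<phi>|\<close> at a point of a surface is the same for all defining functions.\<close>

definition H_perimeter_density :: "heis set \<Rightarrow> heis \<Rightarrow> real" where
  "H_perimeter_density S g =
     (THE r. \<exists>U \<phi>. g \<in> U \<and> defining_function S U \<phi> \<and> r = heis_W \<phi> g / norm (euclid_grad \<phi> g))"

text \<open>The H-perimeter measure \<open>\<sigma>\<^sub>H\<close> of the surface \<open>S\<close>, evaluated at a portion \<open>A\<close> of \<open>S\<close>.\<close>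

definition H_perimeter :: "heis set \<Rightarrow> heis set \<Rightarrow> ennreal" where
  "H_perimeter S A = (\<integral>\<^sup>+ g\<in>A. ennreal (H_perimeter_density S g) \<partial>hausdorff2)"

definition C2_on_surface :: "heis set \<Rightarrow> (heis \<Rightarrow> real) \<Rightarrow> bool" where
  "C2_on_surface S u \<longleftrightarrow>
     (\<forall>g\<in>S. \<exists>U w. open U \<and> g \<in> U \<and> C2_on U w \<and> (\<forall>h\<in>S \<inter> U. u h = w h))"

definition variation_field ::
  "(heis \<Rightarrow> real) \<Rightarrow> (heis \<Rightarrow> real) \<Rightarrow> (heis \<Rightarrow> real) \<Rightarrow> heis \<Rightarrow> heis" where
  "variation_field a b k g = a g *\<^sub>R X1 g + b g *\<^sub>R X2 g + k g *\<^sub>R TT g"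

definition deform :: "(heis \<Rightarrow> heis) \<Rightarrow> real \<Rightarrow> heis \<Rightarrow> heis" where
  "deform X l g = g + l *\<^sub>R X g"

text \<open>Only the perimeter of the deformation of a compact portion \<open>K\<close> of \<open>S\<close> is differentiated. The
  result does not depend on \<open>K\<close> as long as \<open>K\<close> contains the support of \<open>X\<close>.\<close>

definition second_variation :: "heis set \<Rightarrow> heis set \<Rightarrow> (heis \<Rightarrow> heis) \<Rightarrow> real" where
  "second_variation S K X =
     deriv (deriv (\<lambda>l. enn2real (H_perimeter (deform X l ` S) (deform X l ` K)))) 0"

text \<open>For an H-minimal surface with empty characteristic locus. A function on \<open>S\<close> has compact
  support iff it vanishes outside some compact \<open>K \<subseteq> S\<close>.\<close>

definition H_stable :: "heis set \<Rightarrow> bool" where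
  "H_stable S \<longleftrightarrow>
     (\<forall>a b k K. C2_on_surface S a \<and> C2_on_surface S b \<and> C2_on_surface S k \<and>
        compact K \<and> K \<subseteq> S \<and> (\<forall>g\<in>S - K. a g = 0 \<and> b g = 0 \<and> k g = 0) \<longrightarrow>
        second_variation S K (variation_field a b k) \<ge> 0)"


section \<open>The Hausdorff measure is a measure\<close>

lemma hausdorff2_pre_le:
  assumes "A \<subseteq> (\<Union>n. E n)" "\<And>n. bounded (E n)" "\<And>n. diameter (E n) \<le> \<delta>"
  shows "hausdorff2_pre \<delta> A \<le> (\<Sum>n. ennreal (pi / 4 * (diameter (E n))\<^sup>2))"
  unfolding hausdorff2_pre_def by (rule Inf_lower) (use assms in blast)

lemma hausdorff2_pre_mono: "A \<subseteq> B \<Longrightarrow> hausdorff2_pre \<delta> A \<le> hausdorff2_pre \<delta> B"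
  unfolding hausdorff2_pre_def by (rule Inf_superset_mono) blast

lemma hausdorff2_pre_antimono: "\<delta> \<le> \<delta>' \<Longrightarrow> hausdorff2_pre \<delta>' A \<le> hausdorff2_pre \<delta> A"
  unfolding hausdorff2_pre_def by (rule Inf_superset_mono) (use order_trans in blast)

lemma hausdorff2_outer_mono: "A \<subseteq> B \<Longrightarrow> hausdorff2_outer A \<le> hausdorff2_outer B"
  unfolding hausdorff2_outer_def by (intro SUP_mono) (use hausdorff2_pre_mono in blast)

lemma hausdorff2_outer_empty: "hausdorff2_outer {} = 0"
proof -
  have "hausdorff2_pre \<delta> ({}::'a set) = 0" if "\<delta> \<in> {0<..}" for \<delta>
    using hausdorff2_pre_le[of "{}" "\<lambda>_. {}" \<delta>] that by simp
  then show ?thesis unfolding hausdorff2_outer_def by simp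
qed

lemma hausdorff2_pre_subadditive:
  "hausdorff2_pre \<delta> (\<Union>n. A n) \<le> (\<Sum>n. hausdorff2_pre \<delta> (A n))"
proof (cases "(\<Sum>n. hausdorff2_pre \<delta> (A n)) < top")
  case True
  show ?thesis
  proof (rule ennreal_le_epsilon)
    fix e :: real assume e: "0 < e"
    define d where "d n = ennreal (e * (1/2) ^ Suc n)" for n
    have "\<exists>E. A n \<subseteq> (\<Union>m. E m) \<and> (\<forall>m. bounded (E m) \<and> diameter (E m) \<le> \<delta>) \<and>
        (\<Sum>m. ennreal (pi / 4 * (diameter (E m))\<^sup>2)) \<le> hausdorff2_pre \<delta> (A n) + d n" for n
    proof -
      have "hausdorff2_pre \<delta> (A n) < top"
        using True ennreal_suminf_lessD by blast
      moreover have "0 < d n" using e by (simp add: d_def)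
      ultimately have "hausdorff2_pre \<delta> (A n) < hausdorff2_pre \<delta> (A n) + d n"
        by (metis add.right_neutral ennreal_add_left_cancel_less order_less_le
            infinity_ennreal_def)
      then show ?thesis
        unfolding hausdorff2_pre_def[of \<delta> "A n"] Inf_less_iff by (force intro: less_imp_le)
    qed
    then obtain E where E: "\<And>n. A n \<subseteq> (\<Union>m. E n m)" "\<And>n m. bounded (E n m)"
        "\<And>n m. diameter (E n m) \<le> \<delta>"
        "\<And>n. (\<Sum>m. ennreal (pi / 4 * (diameter (E n m))\<^sup>2)) \<le> hausdorff2_pre \<delta> (A n) + d n"
      by metis
    let ?f = "\<lambda>p. ennreal (pi / 4 * (diameter (case_prod E p))\<^sup>2)"
    have "(\<Union>n. A n) \<subseteq> (\<Union>i. case_prod E (prod_decode i))"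
    proof
      fix x assume "x \<in> (\<Union>n. A n)"
      then obtain n m where "x \<in> E n m" using E(1) by blast
      then have "x \<in> case_prod E (prod_decode (prod_encode (n, m)))" by simp
      then show "x \<in> (\<Union>i. case_prod E (prod_decode i))" by (rule UN_I[OF UNIV_I])
    qed
    then have "hausdorff2_pre \<delta> (\<Union>n. A n) \<le> (\<Sum>i. ?f (prod_decode i))"
      by (rule hausdorff2_pre_le) (auto simp: E split: prod.split)
    also have "\<dots> = (\<Sum>n. \<Sum>m. ennreal (pi / 4 * (diameter (E n m))\<^sup>2))"
      by (rule suminf_ennreal_2dimen) simp
    also have "\<dots> \<le> (\<Sum>n. hausdorff2_pre \<delta> (A n) + d n)"
      by (intro suminf_le E summableI)
    also have "\<dots> = (\<Sum>n. hausdorff2_pre \<delta> (A n)) + (\<Sum>n. d n)"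
      by (intro suminf_add[symmetric] summableI)
    also have "(\<Sum>n. d n) = ennreal e"
      unfolding d_def
      by (rule suminf_ennreal_eq) (use e sums_mult[OF power_half_series, of e] in auto)
    finally show "hausdorff2_pre \<delta> (\<Union>n. A n) \<le> (\<Sum>n. hausdorff2_pre \<delta> (A n)) + ennreal e" .
  qed
next
  case False
  then have "(\<Sum>n. hausdorff2_pre \<delta> (A n)) = top" using top.not_eq_extremum by blast
  then show ?thesis by (metis top_greatest)
qed

lemma hausdorff2_outer_subadditive:
  "hausdorff2_outer (\<Union>n. A n) \<le> (\<Sum>n. hausdorff2_outer (A n))"
proof -
  have "hausdorff2_pre \<delta> (\<Union>n. A n) \<le> (\<Sum>n. hausdorff2_outer (A n))" if "\<delta> \<in> {0<..}" for \<delta>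
  proof -
    have "(\<Sum>n. hausdorff2_pre \<delta> (A n)) \<le> (\<Sum>n. hausdorff2_outer (A n))"
      unfolding hausdorff2_outer_def using that by (intro suminf_le SUP_upper summableI)
    then show ?thesis using hausdorff2_pre_subadditive order_trans by blast
  qed
  then show ?thesis
    unfolding hausdorff2_outer_def[of "\<Union>n. A n"] by (rule SUP_least)
qed

lemma hausdorff2_outer_subadditive2:
  "hausdorff2_outer (A \<union> B) \<le> hausdorff2_outer A + hausdorff2_outer B"
proof -
  let ?A = "\<lambda>n::nat. if n = 0 then A else if n = 1 then B else {}"
  have "A \<union> B = (\<Union>n. ?A n)"
    by (auto split: if_splits)
  then have "hausdorff2_outer (A \<union> B) \<le> (\<Sum>n. hausdorff2_outer (?A n))"
    using hausdorff2_outer_subadditive[of ?A] by simp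
  also have "\<dots> = (\<Sum>n\<in>{0,1}. hausdorff2_outer (?A n))"
    by (rule suminf_finite) (auto simp: hausdorff2_outer_empty)
  finally show ?thesis by simp
qed

lemma hausdorff2_outer_separated:
  assumes "d > 0" and sep: "\<And>x y. x \<in> A \<Longrightarrow> y \<in> B \<Longrightarrow> d \<le> dist x y"
  shows "hausdorff2_outer A + hausdorff2_outer B \<le> hausdorff2_outer (A \<union> B)"
proof -
  have pre: "hausdorff2_pre \<delta> A + hausdorff2_pre \<delta> B \<le> hausdorff2_pre \<delta> (A \<union> B)" if "\<delta> < d" for \<delta>
    unfolding hausdorff2_pre_def[of \<delta> "A \<union> B"]
  proof (rule Inf_greatest, clarify)
    fix E :: "nat \<Rightarrow> 'a set"
    assume E: "A \<union> B \<subseteq> (\<Union>n. E n)" "\<forall>n. bounded (E n) \<and> diameter (E n) \<le> \<delta>"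
    define F where "F n = (if E n \<inter> A = {} then {} else E n)" for n
    define G where "G n = (if E n \<inter> B = {} then {} else E n)" for n
    have "0 \<le> \<delta>" using E(2) diameter_ge_0 order_trans by blast
    have FG: "E n \<inter> A = {} \<or> E n \<inter> B = {}" for n
    proof (rule ccontr)
      assume "\<not> ?thesis"
      then obtain x y where "x \<in> E n" "x \<in> A" "y \<in> E n" "y \<in> B" by blast
      then have "d \<le> diameter (E n)"
        using sep[of x y] diameter_bounded_bound[of "E n" x y] E(2) by auto
      then show False using E(2) \<open>\<delta> < d\<close> by (meson not_le order_trans)
    qed
    have "hausdorff2_pre \<delta> A \<le> (\<Sum>n. ennreal (pi / 4 * (diameter (F n))\<^sup>2))"
    proof (rule hausdorff2_pre_le)
      show "A \<subseteq> (\<Union>n. F n)" using E(1) unfolding F_def by fastforce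
    qed (use E(2) \<open>0 \<le> \<delta>\<close> in \<open>auto simp: F_def\<close>)
    moreover have "hausdorff2_pre \<delta> B \<le> (\<Sum>n. ennreal (pi / 4 * (diameter (G n))\<^sup>2))"
    proof (rule hausdorff2_pre_le)
      show "B \<subseteq> (\<Union>n. G n)" using E(1) unfolding G_def by fastforce
    qed (use E(2) \<open>0 \<le> \<delta>\<close> in \<open>auto simp: G_def\<close>)
    ultimately have "hausdorff2_pre \<delta> A + hausdorff2_pre \<delta> B \<le>
        (\<Sum>n. ennreal (pi / 4 * (diameter (F n))\<^sup>2)) + (\<Sum>n. ennreal (pi / 4 * (diameter (G n))\<^sup>2))"
      by (rule add_mono)
    also have "\<dots> = (\<Sum>n. ennreal (pi / 4 * (diameter (F n))\<^sup>2) + ennreal (pi / 4 * (diameter (G n))\<^sup>2))"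
      by (intro suminf_add summableI)
    also have "\<dots> \<le> (\<Sum>n. ennreal (pi / 4 * (diameter (E n))\<^sup>2))"
      by (intro suminf_le summableI) (use FG in \<open>auto simp: F_def G_def\<close>)
    finally show "hausdorff2_pre \<delta> A + hausdorff2_pre \<delta> B \<le> \<dots>" .
  qed
  have "hausdorff2_outer A + hausdorff2_outer B =
      (SUP \<delta>\<in>{0<..}. hausdorff2_pre \<delta> A + hausdorff2_pre \<delta> B)"
    unfolding hausdorff2_outer_def
  proof (rule SUP_add_directed_ennreal[symmetric])
    fix i j :: real assume "i \<in> {0<..}" "j \<in> {0<..}"
    then show "\<exists>k\<in>{0<..}. hausdorff2_pre i A + hausdorff2_pre j B
        \<le> hausdorff2_pre k A + hausdorff2_pre k B"
      by (intro bexI[of _ "min i j"] add_mono hausdorff2_pre_antimono) auto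
  qed
  also have "\<dots> \<le> hausdorff2_outer (A \<union> B)"
  proof (rule SUP_least)
    fix \<delta> :: real assume "\<delta> \<in> {0<..}"
    define e where "e = min \<delta> (d / 2)"
    have e: "0 < e" "e < d" "e \<le> \<delta>" using \<open>\<delta> \<in> {0<..}\<close> \<open>d > 0\<close> by (auto simp: e_def)
    have "hausdorff2_pre \<delta> A + hausdorff2_pre \<delta> B \<le> hausdorff2_pre e A + hausdorff2_pre e B"
      using e by (intro add_mono hausdorff2_pre_antimono)
    also have "\<dots> \<le> hausdorff2_pre e (A \<union> B)" using e by (intro pre)
    also have "\<dots> \<le> hausdorff2_outer (A \<union> B)"
      unfolding hausdorff2_outer_def using e by (intro SUP_upper) auto
    finally show "hausdorff2_pre \<delta> A + hausdorff2_pre \<delta> B \<le> hausdorff2_outer (A \<union> B)" .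
  qed
  finally show ?thesis .
qed

lemma infdist_separated:
  assumes "infdist x C \<le> r" "s \<le> infdist y C"
  shows "s - r \<le> dist x y"
  using infdist_triangle[of y C x] assms by (simp add: dist_commute)

text \<open>Alternate shells around a set are separated from each other.\<close>

lemma hausdorff2_outer_shells:
  fixes a :: "nat \<Rightarrow> real" and C X :: "'a::metric_space set"
  assumes a: "\<And>n. a (Suc n) < a n"
  defines "R \<equiv> \<lambda>k. {x \<in> X. a (Suc k) \<le> infdist x C \<and> infdist x C < a k}"
  shows "(\<Sum>k<n. hausdorff2_outer (R (2 * k + i))) \<le> hausdorff2_outer X"
proof -
  have anti: "a m \<le> a k" if "k \<le> m" for k m
    using that a by (meson less_imp_le lift_Suc_antimono_le)
  have "(\<Sum>k<n. hausdorff2_outer (R (2 * k + i))) \<le> hausdorff2_outer (\<Union>k<n. R (2 * k + i))"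
  proof (induction n)
    case (Suc n)
    have "(\<Sum>k<Suc n. hausdorff2_outer (R (2 * k + i))) \<le>
        hausdorff2_outer (\<Union>k<n. R (2 * k + i)) + hausdorff2_outer (R (2 * n + i))"
      using Suc by (simp add: add_right_mono)
    also have "\<dots> \<le> hausdorff2_outer ((\<Union>k<n. R (2 * k + i)) \<union> R (2 * n + i))"
    proof (cases n)
      case 0
      then show ?thesis by (simp add: hausdorff2_outer_empty)
    next
      case (Suc m)
      show ?thesis
      proof (rule hausdorff2_outer_separated)
        show "0 < a (2 * n + i - 1) - a (2 * n + i)"
          using a[of "2 * n + i - 1"] Suc by simp
      next
        fix x y assume "x \<in> (\<Union>k<n. R (2 * k + i))" "y \<in> R (2 * n + i)"
        then obtain k where "k < n" "a (Suc (2 * k + i)) \<le> infdist x C" "infdist y C \<le> a (2 * n + i)"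
          by (auto simp: R_def)
        moreover have "a (2 * n + i - 1) \<le> a (Suc (2 * k + i))"
          using \<open>k < n\<close> by (intro anti) auto
        ultimately show "a (2 * n + i - 1) - a (2 * n + i) \<le> dist x y"
          using infdist_separated[of y C "a (2 * n + i)" "a (2 * n + i - 1)" x]
          by (simp add: dist_commute)
      qed
    qed
    also have "(\<Union>k<n. R (2 * k + i)) \<union> R (2 * n + i) = (\<Union>k<Suc n. R (2 * k + i))"
      by (auto simp: lessThan_Suc)
    finally show ?case .
  qed (simp add: hausdorff2_outer_empty)
  also have "\<dots> \<le> hausdorff2_outer X"
    by (rule hausdorff2_outer_mono) (auto simp: R_def)
  finally show ?thesis .
qed

lemma hausdorff2_outer_closed_split:
  assumes C: "closed C"
  shows "hausdorff2_outer (X \<inter> C) + hausdorff2_outer (X - C) \<le> hausdorff2_outer X"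
proof (cases "C = {} \<or> hausdorff2_outer X = top")
  case True
  then show ?thesis by (auto simp: hausdorff2_outer_empty)
next
  case False
  then have ne: "C \<noteq> {}" and fin: "hausdorff2_outer X < top" by (auto simp: top.not_eq_extremum)
  define a where "a n = 1 / real (Suc n)" for n
  define R where "R k = {x \<in> X. a (Suc k) \<le> infdist x C \<and> infdist x C < a k}" for k
  define f where "f k = enn2real (hausdorff2_outer (R k))" for k
  have dec: "a (Suc n) < a n" for n by (simp add: a_def field_simps)
  have Rfin: "hausdorff2_outer (R k) < top" for k
    using hausdorff2_outer_mono[of "R k" X] fin by (auto simp: R_def intro: le_less_trans)
  have f: "hausdorff2_outer (R k) = ennreal (f k)" "0 \<le> f k" for k
    using Rfin by (auto simp: f_def)
  define B where "B = enn2real (hausdorff2_outer X)"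
  have sumf: "(\<Sum>k<n. f (2 * k + i)) \<le> B" for n i
  proof -
    have "ennreal (\<Sum>k<n. f (2 * k + i)) = (\<Sum>k<n. hausdorff2_outer (R (2 * k + i)))"
      by (simp add: f sum_ennreal)
    also have "\<dots> \<le> hausdorff2_outer X"
      unfolding R_def by (rule hausdorff2_outer_shells) (rule dec)
    also have "\<dots> = ennreal B" using fin by (simp add: B_def)
    finally show ?thesis by (simp add: B_def ennreal_le_iff)
  qed
  have bound: "(\<Sum>k<n. f k) \<le> 2 * B" for n
  proof -
    have "(\<Sum>k<n. f k) \<le> (\<Sum>k<2 * n. f k)"
      by (rule sum_mono2) (auto simp: f)
    also have "\<dots> = (\<Sum>k<n. f (2 * k + 0)) + (\<Sum>k<n. f (2 * k + 1))"
      by (induction n) auto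
    also have "\<dots> \<le> B + B" by (intro add_mono sumf)
    finally show ?thesis by simp
  qed
  have summ: "summable f"
    using f(2) bound by (rule summableI_nonneg_bounded)
  define S where "S n = {x \<in> X. a n \<le> infdist x C}" for n
  have cover: "X - C \<subseteq> S n \<union> (\<Union>k. R (k + n))" for n
  proof
    fix x assume x: "x \<in> X - C"
    have pos: "0 < infdist x C"
      using x C ne by (metis DiffD2 in_closed_iff_infdist_zero infdist_nonneg order_less_le)
    then obtain m0 where "a m0 < infdist x C"
      unfolding a_def using nat_approx_posE by blast
    define m where "m = (LEAST m. a m \<le> infdist x C)"
    have m: "a m \<le> infdist x C"
      unfolding m_def by (rule LeastI[of _ m0]) (use \<open>a m0 < _\<close> in simp)
    show "x \<in> S n \<union> (\<Union>k. R (k + n))"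
    proof (cases "m \<le> n")
      case True
      then have "a n \<le> a m" using dec by (meson less_imp_le lift_Suc_antimono_le)
      then show ?thesis using m x by (auto simp: S_def)
    next
      case False
      then obtain k where k: "m = Suc (k + n)"
        by (metis add.commute less_imp_Suc_add not_le)
      have "\<not> a (k + n) \<le> infdist x C"
        using not_less_Least[of "k + n" "\<lambda>m. a m \<le> infdist x C"] k by (simp add: m_def)
      then have "x \<in> R (k + n)" using m k x by (auto simp: R_def)
      then show ?thesis by blast
    qed
  qed
  show ?thesis
  proof (rule ennreal_le_epsilon)
    fix e :: real assume "0 < e"
    obtain n where n: "norm (\<Sum>k. f (k + n)) < e"
      using suminf_exist_split[OF \<open>0 < e\<close> summ] by blast
    have "hausdorff2_outer (X - C) \<le> hausdorff2_outer (S n \<union> (\<Union>k. R (k + n)))"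
      by (rule hausdorff2_outer_mono[OF cover])
    also have "\<dots> \<le> hausdorff2_outer (S n) + hausdorff2_outer (\<Union>k. R (k + n))"
      by (rule hausdorff2_outer_subadditive2)
    also have "hausdorff2_outer (\<Union>k. R (k + n)) \<le> (\<Sum>k. hausdorff2_outer (R (k + n)))"
      by (rule hausdorff2_outer_subadditive)
    also have "(\<Sum>k. hausdorff2_outer (R (k + n))) = ennreal (\<Sum>k. f (k + n))"
      unfolding f(1) using summ by (intro suminf_ennreal2) (auto simp: f summable_iff_shift)
    also have "\<dots> \<le> ennreal e" using n by (intro ennreal_leI) simp
    finally have 1: "hausdorff2_outer (X - C) \<le> hausdorff2_outer (S n) + ennreal e"
      by (simp add: add_left_mono)
    have "hausdorff2_outer (X \<inter> C) + hausdorff2_outer (S n) \<le> hausdorff2_outer (X \<inter> C \<union> S n)"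
    proof (rule hausdorff2_outer_separated)
      show "0 < a n" by (simp add: a_def)
      fix x y assume "x \<in> X \<inter> C" "y \<in> S n"
      then show "a n \<le> dist x y"
        using infdist_separated[of x C 0 "a n" y] by (simp add: S_def)
    qed
    also have "\<dots> \<le> hausdorff2_outer X"
      by (rule hausdorff2_outer_mono) (auto simp: S_def)
    finally have 2: "hausdorff2_outer (X \<inter> C) + hausdorff2_outer (S n) \<le> hausdorff2_outer X" .
    have "hausdorff2_outer (X \<inter> C) + hausdorff2_outer (X - C) \<le>
        hausdorff2_outer (X \<inter> C) + hausdorff2_outer (S n) + ennreal e"
      using add_left_mono[OF 1, of "hausdorff2_outer (X \<inter> C)"] by (simp add: add.assoc)
    also have "\<dots> \<le> hausdorff2_outer X + ennreal e" using 2 by (rule add_right_mono)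
    finally show "hausdorff2_outer (X \<inter> C) + hausdorff2_outer (X - C) \<le> hausdorff2_outer X + ennreal e" .
  qed
qed

lemma measure_space_hausdorff2: "measure_space UNIV (sets borel) (hausdorff2_outer :: 'a::metric_space set \<Rightarrow> ennreal)"
proof -
  let ?\<mu> = "hausdorff2_outer :: 'a set \<Rightarrow> ennreal"
  let ?L = "lambda_system UNIV (Pow UNIV) ?\<mu>"
  interpret P: sigma_algebra "UNIV :: 'a set" "Pow UNIV" by (rule sigma_algebra_Pow)
  have "outer_measure_space (Pow UNIV) ?\<mu>"
    by (auto simp: outer_measure_space_def positive_def increasing_def countably_subadditive_def
        hausdorff2_outer_empty intro: hausdorff2_outer_mono hausdorff2_outer_subadditive)
  then have L: "measure_space UNIV ?L ?\<mu>" by (rule P.caratheodory_lemma)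
  then interpret L: sigma_algebra "UNIV :: 'a set" ?L by (simp add: measure_space_def)
  have "C \<in> ?L" if "closed C" for C :: "'a set"
  proof -
    have "?\<mu> (X \<inter> C) + ?\<mu> (X - C) = ?\<mu> X" for X
    proof (rule antisym)
      have "?\<mu> ((X \<inter> C) \<union> (X - C)) \<le> ?\<mu> (X \<inter> C) + ?\<mu> (X - C)"
        by (rule hausdorff2_outer_subadditive2)
      then show "?\<mu> X \<le> ?\<mu> (X \<inter> C) + ?\<mu> (X - C)" by (simp add: Int_Diff_Un)
    qed (rule hausdorff2_outer_closed_split[OF that])
    then show ?thesis unfolding P.lambda_system_eq by simp
  qed
  then have "sigma_sets UNIV (Collect closed) \<subseteq> ?L"
    by (intro L.sigma_sets_subset) blast
  then have "sets (borel :: 'a measure) \<subseteq> ?L"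
    unfolding borel_eq_closed by simp
  then have "(\<Sum>i. ?\<mu> (A i)) = ?\<mu> (\<Union> (range A))"
    if "range A \<subseteq> sets borel" "disjoint_family A" "\<Union> (range A) \<in> sets borel" for A :: "nat \<Rightarrow> 'a set"
    using L that unfolding measure_space_def countably_additive_def
    by (metis (no_types, lifting) subset_trans subsetD)
  then have "countably_additive (sets borel) ?\<mu>"
    unfolding countably_additive_def by blast
  then show ?thesis
    using sets.sigma_algebra_axioms[of "borel :: 'a measure"]
    by (simp add: measure_space_def positive_def hausdorff2_outer_empty)
qed

lemma sets_hausdorff2 [simp, measurable_cong]: "sets (hausdorff2 :: 'a::metric_space measure) = sets borel"
  unfolding hausdorff2_def
  using sets.sigma_sets_eq[of "borel :: 'a measure"] by simp

lemma emeasure_hausdorff2: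
  fixes A :: "'a::metric_space set"
  assumes "A \<in> sets borel"
  shows "emeasure hausdorff2 A = hausdorff2_outer A"
  unfolding hausdorff2_def using assms measure_space_hausdorff2
  by (intro emeasure_measure_of_sigma) (auto simp: measure_space_def)

end

theory Submission
  imports Defs
begin

text \<open>
  Along the lines of its direction an entire graph is crossed by the sign change of any defining
  function, so it is closed. In the left-translated and rotated coordinates \<open>(x, y, \<tau>)\<close>,
  \<open>\<tau> = t + x y / 2\<close>, a surface without characteristic points is locally an intrinsic graph
  \<open>x = f(y, \<tau>)\<close>, and H-minimality is the equation \<open>B\<^sub>y + f B\<^sub>\<tau> = 0\<close> for \<open>B = f\<^sub>y + f f\<^sub>\<tau>\<close>. Its
  characteristics are horizontal straight lines, so the surface is ruled by complete lines.
  Take such a line as the \<open>y\<close>-axis and put \<open>m = f\<^sub>\<tau>(0, 0)\<close>, \<open>n = B\<^sub>\<tau>(0, 0)\<close>. Following the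
  neighbouring lines gives \<open>f\<^sub>\<tau>(y, 0) D(y) = D'(y)\<close> and \<open>B\<^sub>\<tau>(y, 0) D(y) = n\<close> with
  \<open>D(y) = 1 + m y + n y\<^sup>2 / 2\<close>. Hence \<open>D\<close> has no zero, and if \<open>m \<noteq> 0\<close> then \<open>m\<^sup>2 < 2 n\<close>.

  The perimeter of the intrinsic graph of \<open>f + l a\<close> is the integral of \<open>sqrt (1 + B\<^sup>2)\<close>. For a
  variation concentrated along the line its second derivative is, to leading order, a positive
  multiple of \<open>\<integral> u'\<^sup>2 / D - n u\<^sup>2 / D\<^sup>2 dy\<close>, which is negative for a slow cutoff \<open>u\<close> of the constant 1.
  So stability forces \<open>m = 0\<close>: the surface is everywhere tangent to \<open>T\<close>, contains the vertical
  plane through each of its lines, and equals it since it is a graph. Only the fact that the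
  Hausdorff measure of the plane is a positive multiple of Lebesgue measure is used; the value of
  the factor is irrelevant.
\<close>

section \<open>Hausdorff and Lebesgue measure in the plane\<close>

text \<open>The perimeter is defined by Hausdorff measure and a density chosen by
  \<open>THE\<close>, so the second variation has to be read off from the perimeter of every
  deformed surface. Three exact facts make this possible. Moving points along straight lines of
  direction \<open>E1\<close> turns an intrinsic graph into another one for finite \<open>l\<close>,
  not only to first order. In the area formula the Jacobian and the density share the length of the
  Euclidean normal, which cancels. And \<open>B\<close> is quadratic in \<open>f\<close>, so that
  for \<open>f + l a\<close> it is a polynomial in \<open>l\<close>, and one can differentiate under
  the integral sign.

  The concentration along the line needs no error terms either: with \<tau> = \<epsilon> D v the
  domain is a fixed rectangle, the quotients of \<open>f\<close> and \<open>B\<close> by \<tau>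
  extend continuously to the line, and the passage to \<epsilon> = 0 is the continuity of a
  parameter integral. Closedness of the graph is what makes the ruling lines complete; only complete
  lines exclude zeros of \<open>D\<close> on the whole axis and leave room for a cutoff as slow as
  desired.\<close>

lemma hausdorff2_pre_lipschitz_image:
  assumes L: "0 < L" and lip: "\<And>x y. x \<in> A \<Longrightarrow> y \<in> A \<Longrightarrow> dist (f x) (f y) \<le> L * dist x y"
  shows "hausdorff2_pre (L * \<delta>) (f ` A) \<le> ennreal (L\<^sup>2) * hausdorff2_pre \<delta> A"
proof -
  let ?c = "ennreal (L\<^sup>2)" and ?c' = "ennreal (1 / L\<^sup>2)"
  have cc: "?c * ?c' = 1" "?c' * ?c = 1"
    using L by (simp_all add: ennreal_mult'[symmetric] flip: ennreal_1)
  \<comment> \<open>Dividing by \<open>L\<^sup>2\<close> first leaves a bare infimum on the right,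
    so that a single covering can be considered.\<close>
  have "?c' * hausdorff2_pre (L * \<delta>) (f ` A) \<le> hausdorff2_pre \<delta> A"
    unfolding hausdorff2_pre_def[of \<delta> A]
  proof (rule Inf_greatest, clarify)
    fix E :: "nat \<Rightarrow> 'a set"
    assume E: "A \<subseteq> (\<Union>n. E n)" "\<forall>n. bounded (E n) \<and> diameter (E n) \<le> \<delta>"
    \<comment> \<open>The pieces are cut down to \<open>A\<close> because \<open>f\<close> is
      Lipschitz on \<open>A\<close> only.\<close>
    define G where "G n = f ` (E n \<inter> A)" for n
    have d0: "0 \<le> L * diameter (E n)" for n
      using L E(2) diameter_ge_0[of "E n"] by (auto intro!: mult_nonneg_nonneg)
    have dG: "dist x y \<le> L * diameter (E n)" if "x \<in> G n" "y \<in> G n" for x y n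
    proof -
      obtain x' y' where xy: "x = f x'" "y = f y'" "x' \<in> E n" "y' \<in> E n" "x' \<in> A" "y' \<in> A"
        using \<open>x \<in> G n\<close> \<open>y \<in> G n\<close> by (auto simp: G_def)
      have "dist x y \<le> L * dist x' y'" using lip xy by auto
      also have "\<dots> \<le> L * diameter (E n)"
        using E(2) xy L by (intro mult_left_mono diameter_bounded_bound) auto
      finally show ?thesis .
    qed
    have bG: "bounded (G n)" for n
      unfolding bounded_two_points using dG by blast
    have diam: "diameter (G n) \<le> L * diameter (E n)" for n
      unfolding diameter_def[of "G n"] using d0[of n] dG by (auto intro!: cSUP_least)
    have "hausdorff2_pre (L * \<delta>) (f ` A) \<le> (\<Sum>n. ennreal (pi / 4 * (diameter (G n))\<^sup>2))"
    proof (rule hausdorff2_pre_le)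
      show "f ` A \<subseteq> (\<Union>n. G n)" using E(1) by (fastforce simp: G_def)
      show "diameter (G n) \<le> L * \<delta>" for n
        using diam[of n] E(2) L by (meson mult_left_mono order_trans less_imp_le)
    qed (rule bG)
    also have "\<dots> \<le> (\<Sum>n. ?c * ennreal (pi / 4 * (diameter (E n))\<^sup>2))"
    proof (intro suminf_le summableI)
      fix n
      have "(diameter (G n))\<^sup>2 \<le> (L * diameter (E n))\<^sup>2"
        using diam[of n] bG diameter_ge_0 by (intro power_mono) auto
      then show "ennreal (pi / 4 * (diameter (G n))\<^sup>2) \<le> ?c * ennreal (pi / 4 * (diameter (E n))\<^sup>2)"
        by (subst ennreal_mult'[symmetric]) (auto simp: power_mult_distrib intro!: ennreal_leI)
    qed
    also have "\<dots> = ?c * (\<Sum>n. ennreal (pi / 4 * (diameter (E n))\<^sup>2))"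
      by (rule ennreal_suminf_cmult)
    finally have "?c' * hausdorff2_pre (L * \<delta>) (f ` A) \<le>
        ?c' * (?c * (\<Sum>n. ennreal (pi / 4 * (diameter (E n))\<^sup>2)))"
      by (rule mult_left_mono) simp
    then show "?c' * hausdorff2_pre (L * \<delta>) (f ` A) \<le> (\<Sum>n. ennreal (pi / 4 * (diameter (E n))\<^sup>2))"
      by (simp add: mult.assoc[symmetric] cc)
  qed
  then have "?c * (?c' * hausdorff2_pre (L * \<delta>) (f ` A)) \<le> ?c * hausdorff2_pre \<delta> A"
    by (rule mult_left_mono) simp
  then show ?thesis by (simp add: mult.assoc[symmetric] cc)
qed

lemma hausdorff2_outer_lipschitz_image:
  assumes L: "0 < L" and lip: "\<And>x y. x \<in> A \<Longrightarrow> y \<in> A \<Longrightarrow> dist (f x) (f y) \<le> L * dist x y"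
  shows "hausdorff2_outer (f ` A) \<le> ennreal (L\<^sup>2) * hausdorff2_outer A"
  unfolding hausdorff2_outer_def[of "f ` A"]
proof (rule SUP_least)
  fix \<delta> :: real assume d: "\<delta> \<in> {0<..}"
  have "hausdorff2_pre \<delta> (f ` A) = hausdorff2_pre (L * (\<delta> / L)) (f ` A)" using L by simp
  also have "\<dots> \<le> ennreal (L\<^sup>2) * hausdorff2_pre (\<delta> / L) A"
    by (rule hausdorff2_pre_lipschitz_image[OF L lip])
  also have "\<dots> \<le> ennreal (L\<^sup>2) * hausdorff2_outer A"
    unfolding hausdorff2_outer_def using d L by (intro mult_left_mono SUP_upper) auto
  finally show "hausdorff2_pre \<delta> (f ` A) \<le> ennreal (L\<^sup>2) * hausdorff2_outer A" .
qed

section \<open>Translation invariant measures are multiples of Lebesgue measure\<close>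

lemma lborel_reflect:
  fixes A :: "'a::euclidean_space set"
  assumes [measurable]: "A \<in> sets borel"
  shows "(\<integral>\<^sup>+y. indicator A (x - y) \<partial>lborel) = emeasure lborel A"
proof -
  have eq: "(lborel :: 'a measure) = distr lborel borel (\<lambda>y. x - y)"
    using lborel_affine[of "-1" x] by (simp add: density_1 one_ennreal_def[symmetric])
  have "emeasure lborel A = (\<integral>\<^sup>+y. indicator A y \<partial>distr lborel borel (\<lambda>y. x - y))"
    by (subst nn_integral_indicator) (simp_all flip: eq)
  also have "\<dots> = (\<integral>\<^sup>+y. indicator A (x - y) \<partial>lborel)"
    by (rule nn_integral_distr) measurable
  finally show ?thesis by simp
qed

text \<open>Uniqueness of Haar measure by Fubini: the double integral of
  \<open>indicator A x * indicator Q (y + x)\<close> is evaluated in both orders. Invariance of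
  \<open>lborel\<close> makes the inner integral over \<open>y\<close> equal to the measure of
  \<open>Q\<close>; invariance of \<mu> moves the shift from \<open>Q\<close> to \<open>A\<close>,
  and the integral over \<open>y\<close> then produces the Lebesgue measure of
  \<open>A\<close>.\<close>

lemma translation_invariant_eq_lborel:
  fixes \<mu> :: "'a::euclidean_space measure"
  assumes sets[measurable_cong]: "sets \<mu> = sets borel" and sf: "sigma_finite_measure \<mu>"
    and inv: "\<And>c. distr \<mu> borel ((+) c) = \<mu>"
    and Q[measurable]: "Q \<in> sets borel" and Q1: "emeasure lborel Q = 1"
    and A[measurable]: "A \<in> sets borel"
  shows "emeasure \<mu> A = emeasure \<mu> Q * emeasure lborel A"
proof -
  interpret \<mu>: sigma_finite_measure \<mu> by (rule sf)
  interpret P: pair_sigma_finite \<mu> "lborel :: 'a measure" ..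
  let ?f = "\<lambda>x y::'a. indicator A x * indicator Q (y + x) :: ennreal"
  have "emeasure \<mu> A = (\<integral>\<^sup>+x. indicator A x * emeasure lborel Q \<partial>\<mu>)"
    by (simp add: Q1 sets)
  also have "\<dots> = (\<integral>\<^sup>+x. (\<integral>\<^sup>+y. ?f x y \<partial>lborel) \<partial>\<mu>)"
  proof (rule nn_integral_cong)
    fix x :: 'a
    have "emeasure lborel Q = (\<integral>\<^sup>+y. indicator Q y \<partial>distr lborel borel ((+) x))"
      by (subst nn_integral_indicator) (simp_all add: lborel_distr_plus)
    also have "\<dots> = (\<integral>\<^sup>+y. indicator Q (x + y) \<partial>lborel)"
      by (rule nn_integral_distr) measurable
    also have "\<dots> = (\<integral>\<^sup>+y. indicator Q (y + x) \<partial>lborel)"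
      by (simp add: add.commute)
    finally show "indicator A x * emeasure lborel Q = (\<integral>\<^sup>+y. ?f x y \<partial>lborel)"
      by (simp add: nn_integral_cmult)
  qed
  also have "\<dots> = (\<integral>\<^sup>+y. (\<integral>\<^sup>+x. ?f x y \<partial>\<mu>) \<partial>lborel)"
    by (rule P.Fubini'[symmetric]) measurable
  also have "\<dots> = (\<integral>\<^sup>+y. (\<integral>\<^sup>+x. indicator A (x - y) * indicator Q x \<partial>\<mu>) \<partial>lborel)"
  proof (rule nn_integral_cong)
    fix y :: 'a
    have "(\<integral>\<^sup>+x. ?f x y \<partial>\<mu>) = (\<integral>\<^sup>+x. ?f x y \<partial>distr \<mu> borel ((+) (- y)))"
      by (simp add: inv)
    also have "\<dots> = (\<integral>\<^sup>+x. indicator A (x - y) * indicator Q x \<partial>\<mu>)"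
      by (subst nn_integral_distr) (auto simp: sets)
    finally show "(\<integral>\<^sup>+x. ?f x y \<partial>\<mu>) = (\<integral>\<^sup>+x. indicator A (x - y) * indicator Q x \<partial>\<mu>)" .
  qed
  also have "\<dots> = (\<integral>\<^sup>+x. (\<integral>\<^sup>+y. indicator A (x - y) * indicator Q x \<partial>lborel) \<partial>\<mu>)"
    by (rule P.Fubini') measurable
  also have "\<dots> = (\<integral>\<^sup>+x. emeasure lborel A * indicator Q x \<partial>\<mu>)"
    by (intro nn_integral_cong) (simp add: nn_integral_multc lborel_reflect)
  also have "\<dots> = emeasure \<mu> Q * emeasure lborel A"
    by (subst nn_integral_cmult_indicator) (simp_all add: sets mult.commute)
  finally show ?thesis .
qed

lemma hausdorff2_outer_translation:
  fixes c :: "'a::real_normed_vector"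
  shows "hausdorff2_outer ((+) c ` A) = hausdorff2_outer A"
proof (rule antisym)
  show "hausdorff2_outer ((+) c ` A) \<le> hausdorff2_outer A"
    using hausdorff2_outer_lipschitz_image[of 1 A "(+) c"] by simp
  have "hausdorff2_outer ((+) (- c) ` (+) c ` A) \<le> ennreal (1\<^sup>2) * hausdorff2_outer ((+) c ` A)"
    by (rule hausdorff2_outer_lipschitz_image) (auto simp: dist_norm)
  then show "hausdorff2_outer A \<le> hausdorff2_outer ((+) c ` A)"
    by (simp add: image_image)
qed

lemma distr_hausdorff2_translation:
  fixes c :: "'a::{real_normed_vector, second_countable_topology}"
  shows "distr hausdorff2 borel ((+) c) = (hausdorff2 :: 'a measure)"
proof (rule measure_eqI)
  fix A :: "'a set" assume "A \<in> sets (distr hausdorff2 borel ((+) c))"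
  then have A[measurable]: "A \<in> sets borel" by simp
  have sp: "space (hausdorff2 :: 'a measure) = UNIV"
    using sets_eq_imp_space_eq[OF sets_hausdorff2] by simp
  have "emeasure (distr hausdorff2 borel ((+) c)) A = emeasure hausdorff2 ((+) c -` A)"
    by (subst emeasure_distr) (auto simp: sp)
  also have "(+) c -` A = (+) (- c) ` A"
    by (auto simp: image_iff) (metis add.commute add_minus_cancel diff_add_cancel uminus_add_conv_diff)
  also have "emeasure hausdorff2 ((+) (- c) ` A) = emeasure hausdorff2 A"
  proof -
    have "(+) (- c) ` A = (+) c -` A \<inter> space borel"
      by (auto simp: image_iff) (metis add.commute add_minus_cancel diff_add_cancel uminus_add_conv_diff)
    also have "\<dots> \<in> sets borel" by measurable
    finally show ?thesis by (metis A emeasure_hausdorff2 hausdorff2_outer_translation)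
  qed
  finally show "emeasure (distr hausdorff2 borel ((+) c)) A = emeasure hausdorff2 A" .
qed simp

text \<open>A set of diameter \<open>d\<close> lies in the square of side \<open>2 d\<close> centred
  at any of its points, of area \<open>4 d\<^sup>2\<close>; the crude constant is 4 divided by
  \<open>pi / 4\<close>. The bound serves to show that the conversion factor between the two
  measures is positive.\<close>

lemma emeasure_lborel_le_hausdorff2_outer:
  fixes A :: "(real \<times> real) set"
  assumes A: "A \<in> sets borel"
  shows "emeasure lborel A \<le> ennreal (16 / pi) * hausdorff2_outer A"
proof -
  have "ennreal (pi / 16) * emeasure lborel A \<le> hausdorff2_pre 1 A"
    unfolding hausdorff2_pre_def
  proof (rule Inf_greatest, clarify)
    fix E :: "nat \<Rightarrow> (real \<times> real) set"
    assume E: "A \<subseteq> (\<Union>n. E n)" "\<forall>n. bounded (E n) \<and> diameter (E n) \<le> 1"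
    define d where "d n = diameter (E n)" for n
    have d0: "0 \<le> d n" for n using E(2) diameter_ge_0 by (auto simp: d_def)
    \<comment> \<open>For empty \<open>E n\<close> the point is arbitrary and \<open>G n\<close>
      degenerates to it, which does no harm.\<close>
    define p where "p n = (SOME p. p \<in> E n)" for n
    define G where "G n = cbox (p n - (d n, d n)) (p n + (d n, d n))" for n
    have EG: "E n \<subseteq> G n" for n
    proof
      fix x assume x: "x \<in> E n"
      then have "p n \<in> E n" unfolding p_def by (rule someI)
      then have "dist x (p n) \<le> d n"
        using x E(2) by (auto simp: d_def intro: diameter_bounded_bound)
      moreover have "dist (fst x) (fst (p n)) \<le> dist x (p n)" "dist (snd x) (snd (p n)) \<le> dist x (p n)"
        by (rule dist_fst_le, rule dist_snd_le)
      ultimately show "x \<in> G n"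
        by (cases x; cases "p n") (auto simp: G_def dist_real_def cbox_Pair_eq)
    qed
    have mG: "emeasure lborel (G n) = ennreal (4 * (d n)\<^sup>2)" for n
      using d0[of n] by (cases "p n")
        (simp add: G_def emeasure_lborel_cbox_eq Basis_prod_def inner_Pair
          prod.union_disjoint power2_eq_square)
    have "emeasure lborel A \<le> emeasure lborel (\<Union>n. G n)"
    proof (rule emeasure_mono)
      show "A \<subseteq> (\<Union>n. G n)" using E(1) EG by blast
    qed (auto simp: G_def)
    also have "\<dots> \<le> (\<Sum>n. emeasure lborel (G n))"
      by (rule emeasure_subadditive_countably) (auto simp: G_def)
    finally have "ennreal (pi / 16) * emeasure lborel A \<le> ennreal (pi / 16) * (\<Sum>n. emeasure lborel (G n))"
      by (rule mult_left_mono) simp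
    also have "\<dots> = (\<Sum>n. ennreal (pi / 16) * emeasure lborel (G n))"
      by simp
    also have "\<dots> = (\<Sum>n. ennreal (pi / 4 * (diameter (E n))\<^sup>2))"
      by (simp add: mG d_def ennreal_mult'[symmetric])
    finally show "ennreal (pi / 16) * emeasure lborel A \<le> (\<Sum>n. ennreal (pi / 4 * (diameter (E n))\<^sup>2))" .
  qed
  also have "\<dots> \<le> hausdorff2_outer A"
    unfolding hausdorff2_outer_def by (rule SUP_upper) simp
  finally have "ennreal (16 / pi) * (ennreal (pi / 16) * emeasure lborel A) \<le> ennreal (16 / pi) * hausdorff2_outer A"
    by (rule mult_left_mono) simp
  then show ?thesis
    by (simp add: mult.assoc[symmetric] ennreal_mult'[symmetric])
qed

text \<open>A grid of \<open>N * N\<close> closed cells of diameter at most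
  \<open>sqrt 2 / N\<close> costs \<open>pi / 4 * 2\<close>, whatever \<open>N\<close> is. What
  matters later is that the bound is finite.\<close>

lemma hausdorff2_outer_unit_square:
  "hausdorff2_outer (cbox (0, 0) (1, 1) :: (real \<times> real) set) \<le> ennreal (pi / 2)"
  unfolding hausdorff2_outer_def
proof (rule SUP_least)
  fix \<delta> :: real assume "\<delta> \<in> {0<..}"
  then obtain N where N: "2 / \<delta> < real N" "0 < \<delta>" using reals_Archimedean2 by auto
  have Npos: "0 < real N" using N by (meson divide_pos_pos less_trans zero_less_numeral)
  define cell where "cell i j = cbox (real i / N, real j / N) (real (Suc i) / N, real (Suc j) / N)" for i j
  define E where "E n = (if n < N * N then cell (n div N) (n mod N) else {})" for n
  have diam: "diameter (cell i j) \<le> sqrt 2 / N" for i j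
  proof -
    have "dist x y \<le> sqrt 2 / N" if "x \<in> cell i j" "y \<in> cell i j" for x y
    proof -
      obtain x1 x2 y1 y2 where xy: "x = (x1, x2)" "y = (y1, y2)" by (metis surj_pair)
      have "\<bar>x1 - y1\<bar> \<le> 1 / N" "\<bar>x2 - y2\<bar> \<le> 1 / N"
        using that by (auto simp: xy cell_def abs_le_iff add_divide_distrib)
      then have "(x1 - y1)\<^sup>2 \<le> (1 / N)\<^sup>2" "(x2 - y2)\<^sup>2 \<le> (1 / N)\<^sup>2"
        by (metis abs_ge_zero power2_abs power_mono)+
      then have "dist x y \<le> sqrt (2 * (1 / N)\<^sup>2)"
        by (auto simp: xy dist_Pair_Pair dist_real_def intro!: real_sqrt_le_mono)
      also have "\<dots> = sqrt 2 / N" using Npos by (simp add: real_sqrt_mult)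
      finally show ?thesis .
    qed
    then show ?thesis using Npos unfolding diameter_def by (auto intro!: cSUP_least)
  qed
  have le\<delta>: "sqrt 2 / N \<le> \<delta>"
  proof -
    have "sqrt 2 \<le> 2" by (rule real_le_lsqrt) auto
    then have "sqrt 2 / N \<le> 2 / N" using Npos by (simp add: divide_right_mono)
    also have "\<dots> \<le> \<delta>" using N Npos by (simp add: field_simps)
    finally show ?thesis .
  qed
  have "hausdorff2_pre \<delta> (cbox (0, 0) (1, 1) :: (real \<times> real) set) \<le> (\<Sum>n. ennreal (pi / 4 * (diameter (E n))\<^sup>2))"
  proof (rule hausdorff2_pre_le)
    show "cbox (0, 0) (1, 1) \<subseteq> (\<Union>n. E n)"
    proof
      fix p :: "real \<times> real" assume p: "p \<in> cbox (0, 0) (1, 1)"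
      have ex: "\<exists>i<N. real i / N \<le> x \<and> x \<le> real (Suc i) / N" if "0 \<le> x" "x \<le> 1" for x :: real
      \<comment> \<open>The right edge must go to the last cell, since the floor would give the
        index \<open>N\<close>.\<close>
      proof (cases "x = 1")
        case True
        then show ?thesis using Npos by (intro exI[of _ "N - 1"]) auto
      next
        case False
        have "0 \<le> x * N" "x * N < N" using that False Npos by auto
        then have "nat \<lfloor>x * N\<rfloor> < N" "real (nat \<lfloor>x * N\<rfloor>) \<le> x * N" "x * N \<le> real (Suc (nat \<lfloor>x * N\<rfloor>))"
          using Npos by linarith+
        then show ?thesis using Npos
          by (intro exI[of _ "nat \<lfloor>x * N\<rfloor>"]) (simp add: field_simps)
      qed
      obtain x y where xy: "p = (x, y)" "0 \<le> x" "x \<le> 1" "0 \<le> y" "y \<le> 1" using p by (cases p) auto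
      obtain i j where i: "i < N" "real i / N \<le> x" "x \<le> real (Suc i) / N"
        and j: "j < N" "real j / N \<le> y" "y \<le> real (Suc j) / N" using ex xy by meson
      have "i * N + j < N * N"
      proof -
        have "i * N + j < i * N + N" using j by simp
        also have "\<dots> = Suc i * N" by simp
        also have "\<dots> \<le> N * N" using i by (intro mult_le_mono1) simp
        finally show ?thesis .
      qed
      moreover have "(i * N + j) div N = i" "(i * N + j) mod N = j" using j by auto
      ultimately have "p \<in> E (i * N + j)" using i j by (auto simp: E_def cell_def xy)
      then show "p \<in> (\<Union>n. E n)" by blast
    qed
    show "diameter (E n) \<le> \<delta>" for n
      using diam le\<delta> N by (auto simp: E_def intro: order_trans)
  qed (auto simp: E_def cell_def)
  also have "\<dots> = (\<Sum>n<N*N. ennreal (pi / 4 * (diameter (E n))\<^sup>2))"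
    by (rule suminf_finite) (auto simp: E_def)
  also have "\<dots> \<le> (\<Sum>n<N*N. ennreal (pi / 4 * (2 / (real N)\<^sup>2)))"
  proof (intro sum_mono ennreal_leI mult_left_mono)
    fix n
    have "0 \<le> diameter (E n)" by (rule diameter_ge_0) (auto simp: E_def cell_def)
    then have "(diameter (E n))\<^sup>2 \<le> (sqrt 2 / N)\<^sup>2"
      using diam Npos by (intro power_mono) (auto simp: E_def)
    then show "(diameter (E n))\<^sup>2 \<le> 2 / (real N)\<^sup>2" by (simp add: power_divide)
  qed simp
  also have "\<dots> = ennreal (pi / 2)"
    using Npos by (simp add: ennreal_of_nat_eq_real_of_nat ennreal_mult'[symmetric] power2_eq_square)
  finally show "hausdorff2_pre \<delta> (cbox (0, 0) (1, 1) :: (real \<times> real) set) \<le> ennreal (pi / 2)" .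
qed

definition hausdorff2_unit :: real where
  "hausdorff2_unit = enn2real (hausdorff2_outer (cbox (0, 0) (1, 1) :: (real \<times> real) set))"

lemma emeasure_lborel_unit_square: "emeasure lborel (cbox (0, 0) (1, 1) :: (real \<times> real) set) = 1"
  by (simp add: emeasure_lborel_cbox_eq Basis_prod_def inner_Pair prod.union_disjoint)

lemma hausdorff2_outer_unit_square_eq:
  "hausdorff2_outer (cbox (0, 0) (1, 1) :: (real \<times> real) set) = ennreal hausdorff2_unit"
  unfolding hausdorff2_unit_def using hausdorff2_outer_unit_square
  by (metis ennreal_enn2real ennreal_less_top order_le_less_trans)

lemma hausdorff2_unit_pos: "0 < hausdorff2_unit"
proof -
  have "1 \<le> ennreal (16 / pi) * ennreal hausdorff2_unit"
    using emeasure_lborel_le_hausdorff2_outer[of "cbox (0, 0) (1, 1)"]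
    by (simp add: emeasure_lborel_unit_square hausdorff2_outer_unit_square_eq)
  then have "ennreal hausdorff2_unit \<noteq> 0"
    by (metis mult_zero_right not_one_le_zero)
  then show ?thesis by (simp add: ennreal_eq_0_iff not_le)
qed

text \<open>Dilates of the unit square exhaust the plane, and they inherit finite measure from it
  because dilations are Lipschitz.\<close>

lemma sigma_finite_hausdorff2: "sigma_finite_measure (hausdorff2 :: (real \<times> real) measure)"
proof
  define B where "B k = (\<lambda>p. (- real k, - real k) + (2 * real k) *\<^sub>R p) ` (cbox (0, 0) (1, 1) :: (real \<times> real) set)" for k
  have B: "B k = cbox (- real k, - real k) (real k, real k)" if "0 < k" for k
  proof -
    have "(x, y) \<in> B k" if "- real k \<le> x" "x \<le> real k" "- real k \<le> y" "y \<le> real k" for x y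
      using \<open>0 < k\<close> that unfolding B_def
      by (intro image_eqI[of _ _ "((x + k) / (2 * k), (y + k) / (2 * k))"]) (auto simp: field_simps)
    moreover have "B k \<subseteq> cbox (- real k, - real k) (real k, real k)"
    proof -
      have "0 \<le> 2 * real k * x" "2 * real k * x \<le> 2 * real k" if "0 \<le> x" "x \<le> 1" for x
        using that by (auto simp: mult_left_le)
      then show ?thesis unfolding B_def by fastforce
    qed
    ultimately show ?thesis by auto
  qed
  have sp: "space (hausdorff2 :: (real \<times> real) measure) = UNIV"
    using sets_eq_imp_space_eq[OF sets_hausdorff2] by simp
  have fin: "hausdorff2_outer (B k) < \<infinity>" if "0 < k" for k
  proof -
    have "hausdorff2_outer (B k) \<le> ennreal ((2 * real k)\<^sup>2) * ennreal hausdorff2_unit"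
      unfolding B_def hausdorff2_outer_unit_square_eq[symmetric] using that
      by (intro hausdorff2_outer_lipschitz_image) (auto simp: dist_norm scaleR_diff_right[symmetric])
    also have "\<dots> < \<infinity>" by (simp add: ennreal_mult_less_top)
    finally show ?thesis .
  qed
  show "\<exists>A. countable A \<and> A \<subseteq> sets (hausdorff2 :: (real \<times> real) measure) \<and>
      \<Union> A = space (hausdorff2 :: (real \<times> real) measure) \<and> (\<forall>a\<in>A. emeasure hausdorff2 a \<noteq> \<infinity>)"
  proof (intro exI conjI)
    show "countable (range (\<lambda>k. B (Suc k)))" by simp
    show "range (\<lambda>k. B (Suc k)) \<subseteq> sets hausdorff2"
      by (auto simp: B simp del: of_nat_Suc)
    have "p \<in> \<Union> (range (\<lambda>k. B (Suc k)))" for p :: "real \<times> real"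
    proof -
      obtain k where k: "\<bar>fst p\<bar> + \<bar>snd p\<bar> < real k" using reals_Archimedean2 by blast
      then have "p \<in> B (Suc k)" by (cases p) (auto simp: B)
      then show ?thesis by blast
    qed
    then show "\<Union> (range (\<lambda>k. B (Suc k))) = space hausdorff2" by (auto simp: sp)
    show "\<forall>a\<in>range (\<lambda>k. B (Suc k)). emeasure hausdorff2 a \<noteq> \<infinity>"
    proof clarify
      fix k assume "emeasure hausdorff2 (B (Suc k)) = \<infinity>"
      moreover have "emeasure hausdorff2 (B (Suc k)) = hausdorff2_outer (B (Suc k))"
        by (rule emeasure_hausdorff2) (simp add: B)
      ultimately show False using fin[of "Suc k"] by simp
    qed
  qed
qed

lemma hausdorff2_eq_lborel:
  fixes A :: "(real \<times> real) set"
  assumes A: "A \<in> sets borel"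
  shows "hausdorff2_outer A = ennreal hausdorff2_unit * emeasure lborel A"
proof -
  have "emeasure hausdorff2 A = emeasure hausdorff2 (cbox (0, 0) (1, 1) :: (real \<times> real) set) * emeasure lborel A"
    by (rule translation_invariant_eq_lborel)
      (use A in \<open>simp_all add: sigma_finite_hausdorff2 distr_hausdorff2_translation emeasure_lborel_unit_square\<close>)
  then show ?thesis
    using A by (simp add: emeasure_hausdorff2 hausdorff2_outer_unit_square_eq)
qed

text \<open>Fubini: on each horizontal line the shear by \<open>a\<close> is a translation and
  \<open>l\<close> a scaling; the outer variable is scaled by \<open>b\<close>.\<close>

lemma emeasure_lborel_triangular_image:
  fixes A :: "(real \<times> real) set"
  assumes A[measurable]: "A \<in> sets borel" and l: "0 < l" "0 < b"
  shows "(\<lambda>(u, v). (l * u + a * v, b * v)) ` A \<in> sets borel"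
    and "emeasure lborel ((\<lambda>(u, v). (l * u + a * v, b * v)) ` A) = ennreal (l * b) * emeasure lborel A"
proof -
  let ?L = "\<lambda>(u, v). (l * u + a * v, b * v)"
  let ?I = "\<lambda>(x, y). ((x - a * y / b) / l, y / b)"
  have im: "?L ` A = ?I -` A"
  proof (intro set_eqI iffI)
    fix p assume "p \<in> ?I -` A"
    then show "p \<in> ?L ` A"
      by (cases p) (use l in \<open>auto intro!: image_eqI[of _ _ "?I p"]\<close>)
  qed (use l in auto)
  have I[measurable]: "?I \<in> borel_measurable borel"
    unfolding case_prod_beta
    by (intro borel_measurable_continuous_onI continuous_intros) (use l in auto)
  show meas: "?L ` A \<in> sets borel"
    unfolding im using measurable_sets[OF I A] by simp
  have [measurable]: "(\<lambda>p. indicator A p :: ennreal) \<in> borel_measurable (borel \<Otimes>\<^sub>M borel)"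
    by (simp add: borel_prod)
  have "emeasure lborel (?L ` A) = (\<integral>\<^sup>+p. indicator A (?I p) \<partial>(lborel \<Otimes>\<^sub>M lborel))"
    by (simp add: im lborel_prod nn_integral_indicator[symmetric] meas[unfolded im] del: nn_integral_indicator)
       (simp add: indicator_def)
  also have "\<dots> = (\<integral>\<^sup>+y. (\<integral>\<^sup>+x. indicator A (?I (x, y)) \<partial>lborel) \<partial>lborel)"
    by (rule lborel_pair.nn_integral_snd[symmetric]) (simp add: borel_prod lborel_prod)
  also have "\<dots> = (\<integral>\<^sup>+y. ennreal l * (\<integral>\<^sup>+x. indicator A (x, y / b) \<partial>lborel) \<partial>lborel)"
  proof (rule nn_integral_cong)
    fix y
    have "(\<lambda>x. ((x - a * y / b) / l, y / b)) \<in> borel_measurable borel"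
      by (intro borel_measurable_continuous_onI continuous_intros) (use l in auto)
    then have "(\<integral>\<^sup>+x. indicator A ((x - a * y / b) / l, y / b) \<partial>lborel) =
        ennreal \<bar>l\<bar> * (\<integral>\<^sup>+x. indicator A ((a * y / b + l * x - a * y / b) / l, y / b) \<partial>lborel)"
      using l by (intro nn_integral_real_affine) auto
    then show "(\<integral>\<^sup>+x. indicator A (?I (x, y)) \<partial>lborel) = ennreal l * (\<integral>\<^sup>+x. indicator A (x, y / b) \<partial>lborel)"
      using l by simp
  qed
  also have "\<dots> = ennreal \<bar>b\<bar> * (\<integral>\<^sup>+y. ennreal l * (\<integral>\<^sup>+x. indicator A (x, (0 + b * y) / b) \<partial>lborel) \<partial>lborel)"
  proof (rule nn_integral_real_affine)
    have "(\<lambda>(y, x). indicator A (x, y / b) :: ennreal) \<in> borel_measurable (borel \<Otimes>\<^sub>M borel)"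
    proof -
      have "(\<lambda>p::real \<times> real. (snd p, fst p / b)) \<in> borel_measurable borel"
        by (intro borel_measurable_continuous_onI continuous_intros) (use l in auto)
      then have "(\<lambda>p. indicator A (snd p, fst p / b) :: ennreal) \<in> borel_measurable borel"
        by measurable
      then show ?thesis by (simp add: borel_prod case_prod_beta)
    qed
    then show "(\<lambda>y. ennreal l * (\<integral>\<^sup>+x. indicator A (x, y / b) \<partial>lborel)) \<in> borel_measurable borel"
      by measurable
  qed (use l in simp)
  also have "\<dots> = ennreal b * (ennreal l * (\<integral>\<^sup>+y. (\<integral>\<^sup>+x. indicator A (x, y) \<partial>lborel) \<partial>lborel))"
    using l by (simp add: nn_integral_cmult)
  also have "(\<integral>\<^sup>+y. (\<integral>\<^sup>+x. indicator A (x, y) \<partial>lborel) \<partial>lborel) = emeasure lborel A"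
    by (subst lborel_pair.nn_integral_snd) (simp_all add: borel_prod lborel_prod)
  finally show "emeasure lborel (?L ` A) = ennreal (l * b) * emeasure lborel A"
    using l by (simp add: mult.assoc[symmetric] ennreal_mult'[symmetric] mult.commute)
qed

section \<open>The area formula\<close>

text \<open>The root of the Gram determinant, hence the Jacobian of a two-dimensional
  parametrization in any inner product space.\<close>

definition parallelogram_area :: "'a::real_inner \<Rightarrow> 'a \<Rightarrow> real" where
  "parallelogram_area u v = sqrt ((norm u)\<^sup>2 * (norm v)\<^sup>2 - (u \<bullet> v)\<^sup>2)"

lemma continuous_on_parallelogram_area [continuous_intros]:
  "continuous_on A f \<Longrightarrow> continuous_on A g \<Longrightarrow> continuous_on A (\<lambda>x. parallelogram_area (f x) (g x))"
  unfolding parallelogram_area_def by (intro continuous_intros)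

text \<open>Gram-Schmidt: in an orthonormal basis adapted to \<open>p\<close> and \<open>q\<close>
  the map with these columns is upper triangular. It therefore has the same lengths as a triangular
  map of the plane, whose effect on Lebesgue measure is known.\<close>

lemma parallelogram_area_triangular:
  fixes p q :: "'a::real_inner"
  assumes "0 < parallelogram_area p q"
  obtains l a b where "0 < l" "0 < b" "l * b = parallelogram_area p q"
    "\<And>u v. norm (u *\<^sub>R p + v *\<^sub>R q) = norm (l * u + a * v, b * v)"
proof -
  have pos: "0 < (norm p)\<^sup>2 * (norm q)\<^sup>2 - (p \<bullet> q)\<^sup>2"
    using assms by (simp add: parallelogram_area_def)
  then have "p \<noteq> 0" by auto
  define l where "l = norm p"
  define a where "a = (p \<bullet> q) / l"
  define b where "b = sqrt ((norm q)\<^sup>2 - a\<^sup>2)"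
  have l: "0 < l" using \<open>p \<noteq> 0\<close> by (simp add: l_def)
  have lb: "l\<^sup>2 * ((norm q)\<^sup>2 - a\<^sup>2) = (norm p)\<^sup>2 * (norm q)\<^sup>2 - (p \<bullet> q)\<^sup>2"
    using l by (simp add: a_def l_def power_divide field_simps)
  then have "0 < l\<^sup>2 * ((norm q)\<^sup>2 - a\<^sup>2)" using pos by simp
  then have nb: "0 < (norm q)\<^sup>2 - a\<^sup>2" by (simp add: zero_less_mult_iff)
  have b: "0 < b" "b\<^sup>2 = (norm q)\<^sup>2 - a\<^sup>2" using nb by (simp_all add: b_def)
  have "l * b = sqrt (l\<^sup>2 * ((norm q)\<^sup>2 - a\<^sup>2))"
    using l by (simp add: b_def real_sqrt_mult)
  then have "l * b = parallelogram_area p q" by (simp add: parallelogram_area_def lb)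
  moreover have "norm (u *\<^sub>R p + v *\<^sub>R q) = norm (l * u + a * v, b * v)" for u v
  proof -
    have "(norm (u *\<^sub>R p + v *\<^sub>R q))\<^sup>2 = u\<^sup>2 * (norm p)\<^sup>2 + 2 * u * v * (p \<bullet> q) + v\<^sup>2 * (norm q)\<^sup>2"
      unfolding power2_norm_eq_inner
      by (simp add: inner_add_left inner_add_right inner_commute power2_eq_square algebra_simps)
    also have "\<dots> = u\<^sup>2 * l\<^sup>2 + 2 * u * v * (a * l) + v\<^sup>2 * (a\<^sup>2 + b\<^sup>2)"
      using l by (simp add: b l_def a_def)
    also have "\<dots> = (l * u + a * v)\<^sup>2 + (b * v)\<^sup>2"
      by (simp add: power2_eq_square algebra_simps)
    also have "\<dots> = (norm (l * u + a * v, b * v))\<^sup>2" by (simp add: norm_Pair)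
    finally show ?thesis by simp
  qed
  ultimately show ?thesis using that l b by blast
qed

text \<open>Compared with the triangular linear map, \<open>P\<close> changes distances by factors
  between \<open>1 - e\<close> and \<open>1 + e\<close>. So both passages between the two images of
  \<open>A\<close> are Lipschitz, and Hausdorff measure changes by at most the squares of these
  constants.\<close>

lemma hausdorff2_almost_isometric_image:
  fixes P :: "real \<times> real \<Rightarrow> 'a::euclidean_space"
  assumes A: "A \<in> sets borel" and l: "0 < l" "0 < b" and e: "0 < e" "e < 1"
    and close: "\<And>x y. x \<in> A \<Longrightarrow> y \<in> A \<Longrightarrow> \<bar>dist (P x) (P y) - norm (l * fst (x - y) + a * snd (x - y), b * snd (x - y))\<bar>
      \<le> e * norm (l * fst (x - y) + a * snd (x - y), b * snd (x - y))"
  shows "hausdorff2_outer (P ` A) \<le> ennreal ((1 + e)\<^sup>2 * (hausdorff2_unit * (l * b))) * emeasure lborel A"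
    and "ennreal ((1 - e)\<^sup>2 * (hausdorff2_unit * (l * b))) * emeasure lborel A \<le> hausdorff2_outer (P ` A)"
proof -
  define L where "L = (\<lambda>(u, v). (l * u + a * v, b * v))"
  define L' where "L' = (\<lambda>(x, y). ((x - a * y / b) / l, y / b))"
  have L'L: "L' (L p) = p" for p using l by (cases p) (simp add: L_def L'_def)
  have distL: "dist (L x) (L y) = norm (l * fst (x - y) + a * snd (x - y), b * snd (x - y))" for x y
    by (cases x; cases y) (simp add: L_def dist_norm algebra_simps)
  have up: "dist (P x) (P y) \<le> (1 + e) * dist (L x) (L y)"
    and lo: "(1 - e) * dist (L x) (L y) \<le> dist (P x) (P y)" if "x \<in> A" "y \<in> A" for x y
    using close[OF that] by (simp_all add: distL algebra_simps abs_le_iff)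
  have inj: "inj_on P A"
  proof (rule inj_onI)
    fix x y assume "x \<in> A" "y \<in> A" "P x = P y"
    then have "(1 - e) * dist (L x) (L y) \<le> 0" using lo by fastforce
    then have "L x = L y" using e by (simp add: mult_le_0_iff)
    then show "x = y" by (metis L'L)
  qed
  have HL: "hausdorff2_outer (L ` A) = ennreal (hausdorff2_unit * (l * b)) * emeasure lborel A"
    using emeasure_lborel_triangular_image[OF A l, of a] hausdorff2_unit_pos l
    by (simp add: hausdorff2_eq_lborel L_def ennreal_mult' mult.assoc)
  have "P ` A = (\<lambda>z. P (L' z)) ` (L ` A)" by (simp add: image_image L'L)
  also have "hausdorff2_outer \<dots> \<le> ennreal ((1 + e)\<^sup>2) * hausdorff2_outer (L ` A)"
    using e up by (intro hausdorff2_outer_lipschitz_image) (auto simp: L'L)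
  finally show "hausdorff2_outer (P ` A) \<le> ennreal ((1 + e)\<^sup>2 * (hausdorff2_unit * (l * b))) * emeasure lborel A"
    by (simp add: HL ennreal_mult' mult.assoc)
  have "L ` A = (\<lambda>z. L (inv_into A P z)) ` (P ` A)"
    using inj by (simp add: image_image)
  also have "hausdorff2_outer \<dots> \<le> ennreal ((1 / (1 - e))\<^sup>2) * hausdorff2_outer (P ` A)"
    using e lo inj by (intro hausdorff2_outer_lipschitz_image) (auto simp: field_simps)
  finally have "ennreal ((1 - e)\<^sup>2) * hausdorff2_outer (L ` A) \<le>
      ennreal ((1 - e)\<^sup>2) * (ennreal ((1 / (1 - e))\<^sup>2) * hausdorff2_outer (P ` A))"
    by (rule mult_left_mono) simp
  also have "\<dots> = hausdorff2_outer (P ` A)"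
    using e by (simp add: mult.assoc[symmetric] ennreal_mult'[symmetric] power_mult_distrib[symmetric])
  finally show "ennreal ((1 - e)\<^sup>2 * (hausdorff2_unit * (l * b))) * emeasure lborel A \<le> hausdorff2_outer (P ` A)"
    by (simp add: HL ennreal_mult' mult.assoc)
qed

text \<open>The mean value inequality for \<open>P\<close> minus its linearization at
  \<open>q0\<close>, on a convex set where the partial derivatives vary little. The bound holds for
  all pairs of nearby points, not just against \<open>q0\<close>; this is what almost isometry
  requires.\<close>

lemma linear_approx_near:
  fixes P :: "real \<times> real \<Rightarrow> 'a::euclidean_space"
  assumes Q: "convex Q" "q0 \<in> Q"
    and der: "\<And>q. q \<in> Q \<Longrightarrow> (P has_derivative (\<lambda>w. fst w *\<^sub>R P1 q + snd w *\<^sub>R P2 q)) (at q within Q)"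
    and cont: "continuous_on Q P1" "continuous_on Q P2" and e: "0 < e"
  obtains d where "0 < d" "\<And>x y. x \<in> Q \<Longrightarrow> y \<in> Q \<Longrightarrow> dist x q0 < d \<Longrightarrow> dist y q0 < d \<Longrightarrow>
    norm (P x - P y - (fst (x - y) *\<^sub>R P1 q0 + snd (x - y) *\<^sub>R P2 q0)) \<le> e * norm (x - y)"
proof -
  obtain d1 where d1: "0 < d1" "\<And>q. q \<in> Q \<Longrightarrow> dist q q0 < d1 \<Longrightarrow> dist (P1 q) (P1 q0) < e / 2"
    using cont(1) Q(2) e unfolding continuous_on_iff by (metis half_gt_zero)
  obtain d2 where d2: "0 < d2" "\<And>q. q \<in> Q \<Longrightarrow> dist q q0 < d2 \<Longrightarrow> dist (P2 q) (P2 q0) < e / 2"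
    using cont(2) Q(2) e unfolding continuous_on_iff by (metis half_gt_zero)
  define d where "d = min d1 d2"
  define C where "C = Q \<inter> ball q0 d"
  define F where "F q = P q - (fst q *\<^sub>R P1 q0 + snd q *\<^sub>R P2 q0)" for q
  have "convex C" unfolding C_def using Q by (intro convex_Int) auto
  have "norm (F x - F y) \<le> e * norm (x - y)" if "x \<in> C" "y \<in> C" for x y
  proof (rule differentiable_bound[OF \<open>convex C\<close>])
    fix q assume q: "q \<in> C"
    show "(F has_derivative (\<lambda>w. (fst w *\<^sub>R P1 q + snd w *\<^sub>R P2 q) - (fst w *\<^sub>R P1 q0 + snd w *\<^sub>R P2 q0))) (at q within C)"
      unfolding F_def
      by (intro derivative_intros has_derivative_subset[OF der]) (use q in \<open>auto simp: C_def\<close>)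
    show "onorm (\<lambda>w. (fst w *\<^sub>R P1 q + snd w *\<^sub>R P2 q) - (fst w *\<^sub>R P1 q0 + snd w *\<^sub>R P2 q0)) \<le> e"
    proof (rule onorm_le)
      fix w :: "real \<times> real"
      have "norm ((fst w *\<^sub>R P1 q + snd w *\<^sub>R P2 q) - (fst w *\<^sub>R P1 q0 + snd w *\<^sub>R P2 q0))
          = norm (fst w *\<^sub>R (P1 q - P1 q0) + snd w *\<^sub>R (P2 q - P2 q0))"
        by (simp add: algebra_simps)
      also have "\<dots> \<le> norm (fst w *\<^sub>R (P1 q - P1 q0)) + norm (snd w *\<^sub>R (P2 q - P2 q0))"
        by (rule norm_triangle_ineq)
      also have "\<dots> = \<bar>fst w\<bar> * dist (P1 q) (P1 q0) + \<bar>snd w\<bar> * dist (P2 q) (P2 q0)"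
        by (simp add: dist_norm)
      also have "\<dots> \<le> norm w * (e / 2) + norm w * (e / 2)"
        using d1(2)[of q] d2(2)[of q] q norm_fst_le[of "fst w" "snd w"] norm_snd_le[of "snd w" "fst w"] e
        by (intro add_mono mult_mono) (auto simp: C_def d_def dist_commute)
      finally show "norm ((fst w *\<^sub>R P1 q + snd w *\<^sub>R P2 q) - (fst w *\<^sub>R P1 q0 + snd w *\<^sub>R P2 q0)) \<le> e * norm w"
        by (simp add: mult.commute)
    qed
  qed (use that in auto)
  then show ?thesis using d1 d2
    by (intro that[of d]) (auto simp: C_def F_def d_def dist_commute algebra_simps)
qed

lemma triangular_norm_ge:
  fixes l a b :: real
  assumes l: "0 < l" "0 < b"
  obtains c :: real where "0 < c" "\<And>w. c * norm w \<le> norm (l * fst w + a * snd w, b * snd w)"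
proof -
  define L where "L = (\<lambda>w::real \<times> real. (l * fst w + a * snd w, b * snd w))"
  have lin: "linear L" by (rule linearI) (auto simp: L_def algebra_simps)
  moreover have "inj L"
    using l by (auto simp: inj_on_def L_def prod_eq_iff)
  ultimately obtain c where "c > 0" "\<And>x. c * norm x \<le> norm (L x)"
    using linear_inj_bounded_below_pos by blast
  then show ?thesis using that by (auto simp: L_def)
qed

locale parametrized_patch =
  fixes Q :: "(real \<times> real) set" and P P1 P2 :: "real \<times> real \<Rightarrow> 'a::euclidean_space"
  assumes Q: "convex Q" "compact Q"
    and der: "\<And>q. q \<in> Q \<Longrightarrow> (P has_derivative (\<lambda>w. fst w *\<^sub>R P1 q + snd w *\<^sub>R P2 q)) (at q within Q)"
    and cont1: "continuous_on Q P1" and cont2: "continuous_on Q P2"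
    and inj: "inj_on P Q"
    and immersed: "\<And>q. q \<in> Q \<Longrightarrow> 0 < parallelogram_area (P1 q) (P2 q)"
begin

definition J where "J q = parallelogram_area (P1 q) (P2 q)"

lemma J_pos: "q \<in> Q \<Longrightarrow> 0 < J q" by (simp add: J_def immersed)

lemma cont_J: "continuous_on Q J"
  unfolding J_def by (intro continuous_intros cont1 cont2)

lemma cont_P: "continuous_on Q P"
  by (rule has_derivative_continuous_on[OF der])

lemma borel_Q [measurable]: "Q \<in> sets borel"
  using Q(2) by (simp add: borel_compact)

lemma borel_image:
  assumes A: "A \<in> sets borel" "A \<subseteq> Q"
  shows "P ` A \<in> sets borel"
proof -
  have PQ: "P ` Q \<in> sets borel" using compact_continuous_image[OF cont_P Q(2)] by (rule borel_compact)
  have "continuous_on (P ` Q) (inv_into Q P)"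
    by (rule continuous_on_inv[OF cont_P Q(2)]) (simp add: inj)
  then have "inv_into Q P \<in> borel_measurable (restrict_space borel (P ` Q))"
    by (rule borel_measurable_continuous_on_restrict)
  from measurable_sets[OF this A(1)]
  have "inv_into Q P -` A \<inter> P ` Q \<in> sets (restrict_space borel (P ` Q))"
    by (simp add: space_restrict_space)
  then have "inv_into Q P -` A \<inter> P ` Q \<in> sets borel"
    using PQ by (subst (asm) sets_restrict_space_iff) auto
  also have "inv_into Q P -` A \<inter> P ` Q = P ` A"
    using A(2) inj by (auto simp: inv_into_f_f subset_iff)
  finally show ?thesis .
qed

definition area where "area A = (\<integral>\<^sup>+q\<in>A. ennreal (hausdorff2_unit * J q) \<partial>lborel)"

lemma borel_J [measurable]: "(\<lambda>q. if q \<in> Q then J q else 0) \<in> borel_measurable borel"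
  by (intro borel_measurable_continuous_on_if cont_J) auto

lemma area_eq:
  assumes "A \<subseteq> Q"
  shows "area A = (\<integral>\<^sup>+q\<in>A. ennreal (hausdorff2_unit * (if q \<in> Q then J q else 0)) \<partial>lborel)"
  unfolding area_def using assms by (intro nn_integral_cong) (auto simp: indicator_def)

lemma area_Un:
  assumes "A \<in> sets borel" "B \<in> sets borel" "A \<union> B \<subseteq> Q" "A \<inter> B = {}"
  shows "area (A \<union> B) = area A + area B"
proof -
  have [measurable]: "A \<in> sets borel" "B \<in> sets borel" using assms by auto
  have "area (A \<union> B) = (\<integral>\<^sup>+q. ennreal (hausdorff2_unit * (if q \<in> Q then J q else 0)) * indicator A q +
      ennreal (hausdorff2_unit * (if q \<in> Q then J q else 0)) * indicator B q \<partial>lborel)"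
    unfolding area_eq[OF assms(3)]
    using assms(4) by (intro nn_integral_cong) (auto simp: indicator_def)
  also have "\<dots> = area A + area B"
    using assms by (subst nn_integral_add) (simp_all add: area_eq)
  finally show ?thesis .
qed

lemma area_finite:
  assumes "A \<in> sets borel" "A \<subseteq> Q"
  shows "area A < \<infinity>"
proof -
  obtain B where B: "\<And>q. q \<in> Q \<Longrightarrow> J q \<le> B"
    using compact_continuous_image[OF cont_J Q(2)] by (metis compact_imp_bounded bounded_real abs_le_D1 imageI)
  have "area A \<le> (\<integral>\<^sup>+q. ennreal (hausdorff2_unit * B) * indicator Q q \<partial>lborel)"
    unfolding area_def using assms B hausdorff2_unit_pos
    by (intro nn_integral_mono) (auto simp: indicator_def intro!: ennreal_leI mult_left_mono)
  also have "\<dots> = ennreal (hausdorff2_unit * B) * emeasure lborel Q"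
    by (subst nn_integral_cmult_indicator) auto
  also have "\<dots> < \<infinity>"
    using emeasure_bounded_finite[OF compact_imp_bounded[OF Q(2)]]
    by (simp add: ennreal_mult_less_top)
  finally show ?thesis .
qed

lemma hausdorff2_image_Un:
  assumes "A \<in> sets borel" "B \<in> sets borel" "A \<union> B \<subseteq> Q" "A \<inter> B = {}"
  shows "hausdorff2_outer (P ` (A \<union> B)) = hausdorff2_outer (P ` A) + hausdorff2_outer (P ` B)"
proof -
  have b: "P ` A \<in> sets borel" "P ` B \<in> sets borel" using assms by (auto intro: borel_image)
  moreover have "P ` A \<inter> P ` B = {}" using inj_onD[OF inj] assms(3,4) by blast
  ultimately have "emeasure hausdorff2 (P ` A \<union> P ` B) = emeasure hausdorff2 (P ` A) + emeasure hausdorff2 (P ` B)"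
    by (subst plus_emeasure) auto
  then show ?thesis using b by (simp add: emeasure_hausdorff2 image_Un)
qed

text \<open>Near \<open>q0\<close> two comparisons are combined: \<open>P\<close> with its
  linearization, and \<open>J\<close> with \<open>J q0\<close>. The factors stand on both sides
  because the values are extended reals; in this form each inequality is additive in
  \<open>A\<close> and can be glued.\<close>

lemma local_area_bounds:
  assumes q0: "q0 \<in> Q" and e: "0 < e" "e < 1"
  shows "\<exists>d>0. \<forall>A. A \<in> sets borel \<longrightarrow> A \<subseteq> Q \<inter> ball q0 d \<longrightarrow>
    ennreal (1 - e) * hausdorff2_outer (P ` A) \<le> ennreal ((1 + e)\<^sup>2) * area A \<and>
    ennreal ((1 - e)\<^sup>2) * area A \<le> ennreal (1 + e) * hausdorff2_outer (P ` A)"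
proof -
  obtain l a b where lb: "0 < l" "0 < b" "l * b = J q0"
    and nrm: "\<And>u v. norm (u *\<^sub>R P1 q0 + v *\<^sub>R P2 q0) = norm (l * u + a * v, b * v)"
    using parallelogram_area_triangular[OF immersed[OF q0]] unfolding J_def by metis
  obtain c where c: "0 < c" "\<And>w. c * norm w \<le> norm (l * fst w + a * snd w, b * snd w)"
    using triangular_norm_ge[OF lb(1,2)] by metis
  \<comment> \<open>With tolerance \<open>e * c\<close> the error is at most \<open>e\<close> times
    the length of the linear image, as \<open>c\<close> bounds the linear map from below.\<close>
  obtain d1 where d1: "0 < d1" "\<And>x y. x \<in> Q \<Longrightarrow> y \<in> Q \<Longrightarrow> dist x q0 < d1 \<Longrightarrow> dist y q0 < d1 \<Longrightarrow>
      norm (P x - P y - (fst (x - y) *\<^sub>R P1 q0 + snd (x - y) *\<^sub>R P2 q0)) \<le> (e * c) * norm (x - y)"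
    using linear_approx_near[OF Q(1) q0 der cont1 cont2, of "e * c"] e c by auto
  obtain d2 where d2: "0 < d2" "\<And>q. q \<in> Q \<Longrightarrow> dist q q0 < d2 \<Longrightarrow> dist (J q) (J q0) < e * J q0"
    using cont_J q0 e J_pos[OF q0] unfolding continuous_on_iff by (metis mult_pos_pos)
  define d where "d = min d1 d2"
  have "0 < d" using d1 d2 by (simp add: d_def)
  moreover have "ennreal (1 - e) * hausdorff2_outer (P ` A) \<le> ennreal ((1 + e)\<^sup>2) * area A \<and>
      ennreal ((1 - e)\<^sup>2) * area A \<le> ennreal (1 + e) * hausdorff2_outer (P ` A)"
    if A: "A \<in> sets borel" "A \<subseteq> Q \<inter> ball q0 d" for A
  proof -
    have close: "\<bar>dist (P x) (P y) - norm (l * fst (x - y) + a * snd (x - y), b * snd (x - y))\<bar>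
        \<le> e * norm (l * fst (x - y) + a * snd (x - y), b * snd (x - y))" if xy: "x \<in> A" "y \<in> A" for x y
    proof -
      let ?w = "fst (x - y) *\<^sub>R P1 q0 + snd (x - y) *\<^sub>R P2 q0"
      have "\<bar>dist (P x) (P y) - norm ?w\<bar> \<le> norm (P x - P y - ?w)"
        unfolding dist_norm by (rule norm_triangle_ineq3)
      also have "\<dots> \<le> (e * c) * norm (x - y)"
        using xy A by (intro d1(2)) (auto simp: d_def dist_commute)
      also have "\<dots> \<le> e * norm (l * fst (x - y) + a * snd (x - y), b * snd (x - y))"
        using c(2)[of "x - y"] e by (simp add: mult.assoc)
      finally show ?thesis by (simp only: nrm)
    qed
    note H = hausdorff2_almost_isometric_image[OF A(1) lb(1,2) e close, unfolded lb(3)]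
    let ?m = "ennreal (hausdorff2_unit * J q0) * emeasure lborel A"
    have [measurable]: "A \<in> sets borel" by (rule A)
    have J: "(1 - e) * J q0 \<le> J q" "J q \<le> (1 + e) * J q0" if "q \<in> A" for q
    proof -
      have "q \<in> Q \<inter> ball q0 d" using A that by blast
      then have "dist (J q) (J q0) < e * J q0"
        by (intro d2(2)) (auto simp: d_def dist_commute)
      then show "(1 - e) * J q0 \<le> J q" "J q \<le> (1 + e) * J q0"
        by (auto simp: dist_real_def algebra_simps abs_less_iff)
    qed
    have J': "(1 - e) * (hausdorff2_unit * J q0) \<le> hausdorff2_unit * J q"
        "hausdorff2_unit * J q \<le> (1 + e) * (hausdorff2_unit * J q0)" if "q \<in> A" for q
      using mult_left_mono[OF J(1)[OF that], of hausdorff2_unit]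
        mult_left_mono[OF J(2)[OF that], of hausdorff2_unit] hausdorff2_unit_pos
      by (simp_all only: mult_ac less_imp_le)
    have lo: "ennreal (1 - e) * ?m \<le> area A"
    proof -
      have "ennreal (1 - e) * ?m = (\<integral>\<^sup>+q. ennreal ((1 - e) * (hausdorff2_unit * J q0)) * indicator A q \<partial>lborel)"
        using e by (subst nn_integral_cmult_indicator) (auto simp: ennreal_mult' mult.assoc)
      also have "\<dots> \<le> area A"
        unfolding area_def using J'
        by (intro nn_integral_mono) (auto simp: indicator_def intro!: ennreal_leI)
      finally show ?thesis .
    qed
    have up: "area A \<le> ennreal (1 + e) * ?m"
    proof -
      have "area A \<le> (\<integral>\<^sup>+q. ennreal ((1 + e) * (hausdorff2_unit * J q0)) * indicator A q \<partial>lborel)"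
        unfolding area_def using J'
        by (intro nn_integral_mono) (auto simp: indicator_def intro!: ennreal_leI)
      also have "\<dots> = ennreal (1 + e) * ?m"
        using e by (subst nn_integral_cmult_indicator) (auto simp: ennreal_mult' mult.assoc)
      finally show ?thesis .
    qed
    have "ennreal (1 - e) * hausdorff2_outer (P ` A) \<le> ennreal (1 - e) * (ennreal ((1 + e)\<^sup>2) * ?m)"
      using H(1) e by (intro mult_left_mono) (simp_all add: ennreal_mult' mult.assoc)
    also have "\<dots> = ennreal ((1 + e)\<^sup>2) * (ennreal (1 - e) * ?m)" by (simp add: mult_ac)
    also have "\<dots> \<le> ennreal ((1 + e)\<^sup>2) * area A" by (intro mult_left_mono lo) simp
    finally have 1: "ennreal (1 - e) * hausdorff2_outer (P ` A) \<le> ennreal ((1 + e)\<^sup>2) * area A" .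
    have "ennreal ((1 - e)\<^sup>2) * area A \<le> ennreal ((1 - e)\<^sup>2) * (ennreal (1 + e) * ?m)"
      by (intro mult_left_mono up) simp
    also have "\<dots> = ennreal (1 + e) * (ennreal ((1 - e)\<^sup>2) * ?m)" by (simp add: mult_ac)
    also have "\<dots> \<le> ennreal (1 + e) * hausdorff2_outer (P ` A)"
      using H(2) by (intro mult_left_mono) (simp_all add: ennreal_mult' mult.assoc)
    finally show ?thesis using 1 by blast
  qed
  ultimately show ?thesis by blast
qed

text \<open>Finitely many of the local balls cover \<open>Q\<close>. The induction splits off the
  part of \<open>A\<close> in one ball; both sides are additive over such a disjoint
  splitting.\<close>

lemma global_area_bounds:
  assumes A: "A \<in> sets borel" "A \<subseteq> Q" and e: "0 < e" "e < 1"
  shows "ennreal (1 - e) * hausdorff2_outer (P ` A) \<le> ennreal ((1 + e)\<^sup>2) * area A \<and>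
    ennreal ((1 - e)\<^sup>2) * area A \<le> ennreal (1 + e) * hausdorff2_outer (P ` A)"
proof -
  define good where "good A \<longleftrightarrow> ennreal (1 - e) * hausdorff2_outer (P ` A) \<le> ennreal ((1 + e)\<^sup>2) * area A \<and>
    ennreal ((1 - e)\<^sup>2) * area A \<le> ennreal (1 + e) * hausdorff2_outer (P ` A)" for A
  obtain d where d: "\<And>q. q \<in> Q \<Longrightarrow> 0 < d q"
    "\<And>q A. q \<in> Q \<Longrightarrow> A \<in> sets borel \<Longrightarrow> A \<subseteq> Q \<inter> ball q (d q) \<Longrightarrow> good A"
    using local_area_bounds[OF _ e] unfolding good_def by metis
  have "Q \<subseteq> (\<Union>q\<in>Q. ball q (d q))" using d(1) by force
  then obtain F where F: "finite F" "F \<subseteq> Q" "Q \<subseteq> (\<Union>q\<in>F. ball q (d q))"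
    by (rule compactE_image[OF Q(2), rotated]) auto
  have "good A" if "finite F" "F \<subseteq> Q" "A \<in> sets borel" "A \<subseteq> Q" "A \<subseteq> (\<Union>q\<in>F. ball q (d q))" for A F
    using that
  proof (induction F arbitrary: A rule: finite_induct)
    case empty
    then show ?case by (simp add: good_def hausdorff2_outer_empty area_def)
  next
    case (insert q F)
    let ?B = "A \<inter> ball q (d q)" and ?C = "A - ball q (d q)"
    have "good ?B" using insert.prems by (intro d(2)[of q]) auto
    moreover have "good ?C" using insert.prems by (intro insert.IH) auto
    moreover have eq: "?B \<union> ?C = A" by blast
    have "area (?B \<union> ?C) = area ?B + area ?C"
      using insert.prems by (intro area_Un) auto
    moreover have "hausdorff2_outer (P ` (?B \<union> ?C)) = hausdorff2_outer (P ` ?B) + hausdorff2_outer (P ` ?C)"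
      using insert.prems by (intro hausdorff2_image_Un) auto
    ultimately show ?case
      unfolding good_def eq by (auto simp: distrib_left intro: add_mono)
  qed
  from this[OF F(1,2) A(1,2)] A(2) F(3) show ?thesis unfolding good_def by blast
qed

lemma hausdorff2_image_eq_area:
  assumes A: "A \<in> sets borel" "A \<subseteq> Q"
  shows "hausdorff2_outer (P ` A) = area A"
proof -
  obtain m where m: "area A = ennreal m" "0 \<le> m"
    using area_finite[OF A] by (cases "area A") auto
  note B = global_area_bounds[OF A]
  \<comment> \<open>One instance of the bounds gives finiteness; from there on the limit as
    \<open>e\<close> tends to 0 is taken in the reals.\<close>
  have "ennreal (1 - 1/2) * hausdorff2_outer (P ` A) \<le> ennreal ((1 + 1/2)\<^sup>2) * ennreal m"
    using B[of "1/2"] by (simp add: m)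
  also have "\<dots> < \<infinity>" by (simp add: ennreal_mult_less_top)
  finally have "ennreal (1 - 1/2) * hausdorff2_outer (P ` A) < \<infinity>" .
  then have "hausdorff2_outer (P ` A) < \<infinity>"
    by (cases "hausdorff2_outer (P ` A)") (auto simp: ennreal_mult_top)
  then obtain h where h: "hausdorff2_outer (P ` A) = ennreal h" "0 \<le> h"
    by (cases "hausdorff2_outer (P ` A)") auto
  have ineq: "(1 - e) * h \<le> (1 + e)\<^sup>2 * m" "(1 - e)\<^sup>2 * m \<le> (1 + e) * h" if "0 < e" "e < 1" for e
    using B[OF that] that m(2) h(2)
    by (auto simp: m(1) h(1) ennreal_mult[symmetric] ennreal_le_iff simp del: ennreal_plus)
  have ev: "\<forall>\<^sub>F e in at_right (0::real). 0 < e \<and> e < 1"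
    by (auto simp: eventually_at_right_less intro!: eventually_conj eventually_at_rightI[of 0 1])
  have "(1 - 0) * h \<le> (1 + 0)\<^sup>2 * m"
  proof (rule tendsto_le)
    show "((\<lambda>e. (1 - e) * h) \<longlongrightarrow> (1 - 0) * h) (at_right 0)" by (intro tendsto_intros)
    show "((\<lambda>e. (1 + e)\<^sup>2 * m) \<longlongrightarrow> (1 + 0)\<^sup>2 * m) (at_right 0)" by (intro tendsto_intros)
    show "\<forall>\<^sub>F e in at_right 0. (1 - e) * h \<le> (1 + e)\<^sup>2 * m"
      using ev by eventually_elim (use ineq in auto)
  qed simp
  moreover have "(1 - 0)\<^sup>2 * m \<le> (1 + 0) * h"
  proof (rule tendsto_le)
    show "((\<lambda>e. (1 - e)\<^sup>2 * m) \<longlongrightarrow> (1 - 0)\<^sup>2 * m) (at_right 0)" by (intro tendsto_intros)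
    show "((\<lambda>e. (1 + e) * h) \<longlongrightarrow> (1 + 0) * h) (at_right 0)" by (intro tendsto_intros)
    show "\<forall>\<^sub>F e in at_right 0. (1 - e)\<^sup>2 * m \<le> (1 + e) * h"
      using ev by eventually_elim (use ineq in auto)
  qed simp
  ultimately show ?thesis by (simp add: m h)
qed

text \<open>The equality for all Borel sets says that \<open>P\<close> pushes the measure with
  density \<open>hausdorff2_unit * J\<close> forward to the Hausdorff measure restricted to the
  image of \<open>Q\<close>. As \<open>h\<close> is known on the image only, it is replaced by the
  Borel function \<open>h'\<close>, and \<open>J\<close>, \<open>P\<close>, \<open>k\<close> are
  extended by zero.\<close>

theorem area_formula:
  assumes k: "continuous_on Q k" "\<And>q. q \<in> Q \<Longrightarrow> 0 \<le> k q" and h: "\<And>q. q \<in> Q \<Longrightarrow> h (P q) = k q"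
  shows "(\<integral>\<^sup>+g\<in>P ` Q. ennreal (h g) \<partial>hausdorff2) = (\<integral>\<^sup>+q\<in>Q. ennreal (hausdorff2_unit * (k q * J q)) \<partial>lborel)"
proof -
  define N where "N = density lborel (\<lambda>q. ennreal (hausdorff2_unit * (if q \<in> Q then J q else 0)))"
  define P' where "P' q = (if q \<in> Q then P q else 0)" for q
  define h' where "h' g = (if g \<in> P ` Q then k (inv_into Q P g) else 0)" for g
  have PQ[measurable]: "P ` Q \<in> sets borel" by (rule borel_image) auto
  have [measurable]: "P' \<in> borel_measurable borel"
    unfolding P'_def by (intro borel_measurable_continuous_on_if cont_P) auto
  have "continuous_on (P ` Q) (\<lambda>g. k (inv_into Q P g))"
    by (rule continuous_on_compose2[OF k(1) continuous_on_inv[OF cont_P Q(2)]])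
      (auto simp: inj inv_into_into)
  then have [measurable]: "h' \<in> borel_measurable borel"
    unfolding h'_def by (intro borel_measurable_continuous_on_if) auto
  have k'[measurable]: "(\<lambda>q. if q \<in> Q then k q else 0) \<in> borel_measurable borel"
    by (intro borel_measurable_continuous_on_if k) auto
  have hk: "h' (P q) = k q" if "q \<in> Q" for q using that inj by (simp add: h'_def)
  have eq: "distr N borel P' = density hausdorff2 (indicator (P ` Q))"
  proof (rule measure_eqI)
    fix B assume "B \<in> sets (distr N borel P')"
    then have B[measurable]: "B \<in> sets borel" by simp
    have [measurable]: "Q \<inter> P' -` B \<in> sets borel"
      using measurable_sets[of P' borel borel B] by auto
    have "emeasure (distr N borel P') B = emeasure N (P' -` B)"
      by (subst emeasure_distr) (auto simp: N_def)
    also have "\<dots> = (\<integral>\<^sup>+q\<in>P' -` B. ennreal (hausdorff2_unit * (if q \<in> Q then J q else 0)) \<partial>lborel)"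
      unfolding N_def using measurable_sets[of P' borel borel B] by (subst emeasure_density) auto
    also have "\<dots> = area (Q \<inter> P' -` B)"
      unfolding area_def by (intro nn_integral_cong) (auto simp: indicator_def)
    also have "\<dots> = hausdorff2_outer (P ` (Q \<inter> P' -` B))"
      by (rule hausdorff2_image_eq_area[symmetric]) auto
    also have "P ` (Q \<inter> P' -` B) = P ` Q \<inter> B" by (auto simp: P'_def)
    also have "hausdorff2_outer (P ` Q \<inter> B) = emeasure hausdorff2 (P ` Q \<inter> B)"
      by (rule emeasure_hausdorff2[symmetric]) measurable
    also have "\<dots> = (\<integral>\<^sup>+g. indicator (P ` Q \<inter> B) g \<partial>hausdorff2)"
      by (rule nn_integral_indicator[symmetric]) simp
    also have "\<dots> = emeasure (density hausdorff2 (indicator (P ` Q))) B"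
      by (subst emeasure_density; (rule nn_integral_cong)?) (simp_all add: indicator_def)
    finally show "emeasure (distr N borel P') B = emeasure (density hausdorff2 (indicator (P ` Q))) B" .
  qed simp
  have "(\<integral>\<^sup>+g\<in>P ` Q. ennreal (h g) \<partial>hausdorff2) = (\<integral>\<^sup>+g. indicator (P ` Q) g * ennreal (h' g) \<partial>hausdorff2)"
    by (intro nn_integral_cong) (auto simp: indicator_def h hk)
  also have "\<dots> = (\<integral>\<^sup>+g. ennreal (h' g) \<partial>distr N borel P')"
    unfolding eq by (rule nn_integral_density[symmetric]) auto
  also have "\<dots> = (\<integral>\<^sup>+q. ennreal (h' (P' q)) \<partial>N)"
    by (rule nn_integral_distr) (auto simp: N_def)
  also have "\<dots> = (\<integral>\<^sup>+q. ennreal (hausdorff2_unit * (if q \<in> Q then J q else 0)) * ennreal (h' (P' q)) \<partial>lborel)"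
    unfolding N_def by (rule nn_integral_density) auto
  also have "\<dots> = (\<integral>\<^sup>+q\<in>Q. ennreal (hausdorff2_unit * (k q * J q)) \<partial>lborel)"
    using hausdorff2_unit_pos k(2) J_pos
    by (intro nn_integral_cong)
      (auto simp: indicator_def P'_def hk ennreal_mult[symmetric] less_imp_le mult_ac)
  finally show ?thesis .
qed

end

section \<open>Continuously differentiable functions and implicit functions\<close>

text \<open>The direction comes before the point, so that \<open>dd f v\<close> is a function of the
  point and can be differentiated again.\<close>

definition dd :: "('a::euclidean_space \<Rightarrow> 'b::euclidean_space) \<Rightarrow> 'a \<Rightarrow> 'a \<Rightarrow> 'b" where
  "dd f v x = frechet_derivative f (at x) v"

definition c1_on :: "'a::euclidean_space set \<Rightarrow> ('a \<Rightarrow> 'b::euclidean_space) \<Rightarrow> bool" where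
  "c1_on U f \<longleftrightarrow> (\<forall>x\<in>U. f differentiable (at x)) \<and> (\<forall>v. continuous_on U (dd f v))"

definition c2_on :: "'a::euclidean_space set \<Rightarrow> ('a \<Rightarrow> 'b::euclidean_space) \<Rightarrow> bool" where
  "c2_on U f \<longleftrightarrow> (\<forall>x\<in>U. f differentiable (at x)) \<and> (\<forall>v. c1_on U (dd f v))"

lemma C1_on_eq: "C1_on U f \<longleftrightarrow> c1_on U f"
  by (simp add: C1_on_def c1_on_def dd_def[abs_def])

lemma C2_on_eq: "C2_on U f \<longleftrightarrow> c2_on U f"
  by (simp add: C2_on_def c2_on_def C1_on_eq dd_def[abs_def])

lemma dd_eqI: "(f has_derivative f') (at x) \<Longrightarrow> dd f v x = f' v"
  unfolding dd_def by (metis frechet_derivative_at)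

lemma c1_on_has_derivative: "c1_on U f \<Longrightarrow> x \<in> U \<Longrightarrow> (f has_derivative (\<lambda>v. dd f v x)) (at x)"
  unfolding dd_def[abs_def] c1_on_def by (simp add: frechet_derivative_works)

lemma c2_on_has_derivative: "c2_on U f \<Longrightarrow> x \<in> U \<Longrightarrow> (f has_derivative (\<lambda>v. dd f v x)) (at x)"
  unfolding dd_def[abs_def] c2_on_def by (simp add: frechet_derivative_works)

lemma c1_on_continuous_dd: "c1_on U f \<Longrightarrow> continuous_on U (dd f v)"
  unfolding c1_on_def by auto

lemma c2_on_dd: "c2_on U f \<Longrightarrow> c1_on U (dd f v)"
  unfolding c2_on_def by auto

lemma c1_on_continuous: "c1_on U f \<Longrightarrow> continuous_on U f"
  by (meson c1_on_has_derivative has_derivative_at_withinI has_derivative_continuous_on)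

lemma c2_on_c1: "c2_on U f \<Longrightarrow> c1_on U f"
  unfolding c2_on_def c1_on_def[of U f] using c1_on_continuous by auto

lemma linear_dd: "f differentiable at x \<Longrightarrow> linear (\<lambda>v. dd f v x)"
  unfolding dd_def[abs_def]
  by (meson bounded_linear.linear frechet_derivative_works has_derivative_bounded_linear linear_frechet_derivative)

lemma c1_on_linear_dd: "c1_on U f \<Longrightarrow> x \<in> U \<Longrightarrow> linear (\<lambda>v. dd f v x)"
  by (rule linear_dd) (simp add: c1_on_def)

lemma c1_on_subset: "c1_on U f \<Longrightarrow> V \<subseteq> U \<Longrightarrow> c1_on V f"
  unfolding c1_on_def using continuous_on_subset by blast

lemma c2_on_subset: "c2_on U f \<Longrightarrow> V \<subseteq> U \<Longrightarrow> c2_on V f"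
  unfolding c2_on_def using c1_on_subset by blast

lemma c1_onI:
  assumes "\<And>x. x \<in> U \<Longrightarrow> (f has_derivative (\<lambda>v. f' v x)) (at x)" "\<And>v. continuous_on U (f' v)"
  shows "c1_on U f"
  unfolding c1_on_def
proof (intro conjI ballI allI)
  show "f differentiable at x" if "x \<in> U" for x using assms(1)[OF that] by (auto simp: differentiable_def)
  show "continuous_on U (dd f v)" for v
    using assms by (subst continuous_on_cong[OF refl, of _ _ "f' v"]) (auto simp: dd_eqI[OF assms(1)])
qed

lemma dd_cong:
  assumes "open U" "x \<in> U" "\<And>y. y \<in> U \<Longrightarrow> f y = g y"
  shows "dd f v x = dd g v x"
proof -
  have "(f has_derivative f') (at x) \<longleftrightarrow> (g has_derivative f') (at x)" for f'
    using has_derivative_transform_within_open[OF _ assms(1,2), of f f' UNIV g]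
      has_derivative_transform_within_open[OF _ assms(1,2), of g f' UNIV f] assms(3) by auto
  then show ?thesis unfolding dd_def frechet_derivative_def by simp
qed

lemma c1_on_cong:
  assumes "open U" "\<And>y. y \<in> U \<Longrightarrow> f y = g y" "c1_on U f"
  shows "c1_on U g"
proof (rule c1_onI[where f' = "dd f"])
  show "(g has_derivative (\<lambda>v. dd f v x)) (at x)" if "x \<in> U" for x
    by (rule has_derivative_transform_within_open[OF c1_on_has_derivative[OF assms(3) that] assms(1) that])
      (rule assms(2))
qed (rule c1_on_continuous_dd[OF assms(3)])

lemma c2_onI:
  assumes "open U" "\<And>x. x \<in> U \<Longrightarrow> (f has_derivative (\<lambda>v. f' v x)) (at x)" "\<And>v. c1_on U (f' v)"
  shows "c2_on U f"
  unfolding c2_on_def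
proof (intro conjI ballI allI)
  show "f differentiable at x" if "x \<in> U" for x using assms(2)[OF that] by (auto simp: differentiable_def)
  show "c1_on U (dd f v)" for v
    by (rule c1_on_cong[OF assms(1) _ assms(3)[of v]]) (simp add: dd_eqI[OF assms(2)])
qed

lemma c2_on_cong:
  assumes "open U" "\<And>y. y \<in> U \<Longrightarrow> f y = g y" "c2_on U f"
  shows "c2_on U g"
proof (rule c2_onI[where f' = "dd f"])
  show "(g has_derivative (\<lambda>v. dd f v x)) (at x)" if "x \<in> U" for x
    by (rule has_derivative_transform_within_open[OF c2_on_has_derivative[OF assms(3) that] assms(1) that])
      (rule assms(2))
qed (use assms c2_on_dd in auto)

lemma c1_on_const: "c1_on U (\<lambda>x. c)"
  by (rule c1_onI[where f' = "\<lambda>v x. 0"]) auto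

lemma c2_on_const: "open U \<Longrightarrow> c2_on U (\<lambda>x. c)"
  by (rule c2_onI[where f' = "\<lambda>v x. 0"]) (auto intro: c1_on_const)

lemma c1_on_bounded_linear: "bounded_linear f \<Longrightarrow> c1_on U f"
  by (rule c1_onI[where f' = "\<lambda>v x. f v"]) (auto intro: bounded_linear_imp_has_derivative)

lemma c2_on_bounded_linear: "open U \<Longrightarrow> bounded_linear f \<Longrightarrow> c2_on U f"
  by (rule c2_onI[where f' = "\<lambda>v x. f v"]) (auto intro: bounded_linear_imp_has_derivative c1_on_const)

lemma c1_on_add: "c1_on U f \<Longrightarrow> c1_on U g \<Longrightarrow> c1_on U (\<lambda>x. f x + g x)"
  by (rule c1_onI[where f' = "\<lambda>v x. dd f v x + dd g v x"])
    (auto intro!: has_derivative_add c1_on_has_derivative continuous_on_add c1_on_continuous_dd)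

lemma c2_on_add: "open U \<Longrightarrow> c2_on U f \<Longrightarrow> c2_on U g \<Longrightarrow> c2_on U (\<lambda>x. f x + g x)"
  by (rule c2_onI[where f' = "\<lambda>v x. dd f v x + dd g v x"])
    (auto intro!: has_derivative_add c2_on_has_derivative c1_on_add c2_on_dd)

lemma c1_on_scaleR: "c1_on U f \<Longrightarrow> c1_on U g \<Longrightarrow> c1_on U (\<lambda>x. f x *\<^sub>R g x)"
  by (rule c1_onI[where f' = "\<lambda>v x. f x *\<^sub>R dd g v x + dd f v x *\<^sub>R g x"])
    (intro has_derivative_scaleR continuous_on_add continuous_on_scaleR; simp add: c1_on_has_derivative c1_on_continuous_dd c1_on_continuous)+

lemma c2_on_scaleR: "open U \<Longrightarrow> c2_on U f \<Longrightarrow> c2_on U g \<Longrightarrow> c2_on U (\<lambda>x. f x *\<^sub>R g x)"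
  by (rule c2_onI[where f' = "\<lambda>v x. f x *\<^sub>R dd g v x + dd f v x *\<^sub>R g x"])
    (assumption | intro has_derivative_scaleR c1_on_add c1_on_scaleR; simp add: c2_on_has_derivative c2_on_dd c2_on_c1)+

lemma c1_on_mult: "c1_on U f \<Longrightarrow> c1_on U g \<Longrightarrow> c1_on U (\<lambda>x. f x * (g x :: real))"
  using c1_on_scaleR[of U f g] by simp

lemma c2_on_mult: "open U \<Longrightarrow> c2_on U f \<Longrightarrow> c2_on U g \<Longrightarrow> c2_on U (\<lambda>x. f x * (g x :: real))"
  using c2_on_scaleR[of U f g] by simp

lemma c1_on_minus: "c1_on U f \<Longrightarrow> c1_on U (\<lambda>x. - f x)"
  using c1_on_scaleR[OF c1_on_const[of U "-1"]] by simp

lemma c2_on_minus: "open U \<Longrightarrow> c2_on U f \<Longrightarrow> c2_on U (\<lambda>x. - f x)"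
  using c2_on_scaleR[OF _ c2_on_const[of U "-1"]] by simp

lemma c1_on_diff: "c1_on U f \<Longrightarrow> c1_on U g \<Longrightarrow> c1_on U (\<lambda>x. f x - g x)"
  using c1_on_add[OF _ c1_on_minus] by force

lemma c2_on_diff: "open U \<Longrightarrow> c2_on U f \<Longrightarrow> c2_on U g \<Longrightarrow> c2_on U (\<lambda>x. f x - g x)"
  using c2_on_add[OF _ _ c2_on_minus] by force

lemma c1_on_Pair: "c1_on U f \<Longrightarrow> c1_on U g \<Longrightarrow> c1_on U (\<lambda>x. (f x, g x))"
  by (rule c1_onI[where f' = "\<lambda>v x. (dd f v x, dd g v x)"])
    (auto intro!: has_derivative_Pair c1_on_has_derivative continuous_intros c1_on_continuous_dd)

lemma c2_on_Pair: "open U \<Longrightarrow> c2_on U f \<Longrightarrow> c2_on U g \<Longrightarrow> c2_on U (\<lambda>x. (f x, g x))"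
  by (rule c2_onI[where f' = "\<lambda>v x. (dd f v x, dd g v x)"])
    (auto intro!: has_derivative_Pair c2_on_has_derivative c1_on_Pair c2_on_dd)

lemma c1_on_sum: "(\<And>i. i \<in> I \<Longrightarrow> c1_on U (f i)) \<Longrightarrow> c1_on U (\<lambda>x. \<Sum>i\<in>I. f i x)"
  by (induction I rule: infinite_finite_induct) (auto intro: c1_on_const c1_on_add)

lemma c1_on_fst: "c1_on U f \<Longrightarrow> c1_on U (\<lambda>x. fst (f x))"
  by (rule c1_onI[where f' = "\<lambda>v x. fst (dd f v x)"])
    (auto intro!: has_derivative_fst c1_on_has_derivative continuous_intros c1_on_continuous_dd)

lemma c1_on_snd: "c1_on U f \<Longrightarrow> c1_on U (\<lambda>x. snd (f x))"
  by (rule c1_onI[where f' = "\<lambda>v x. snd (dd f v x)"])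
    (auto intro!: has_derivative_snd c1_on_has_derivative continuous_intros c1_on_continuous_dd)

lemma c2_on_fst: "open U \<Longrightarrow> c2_on U f \<Longrightarrow> c2_on U (\<lambda>x. fst (f x))"
  by (rule c2_onI[where f' = "\<lambda>v x. fst (dd f v x)"])
    (auto intro!: has_derivative_fst c2_on_has_derivative c1_on_fst c2_on_dd)

lemma c2_on_snd: "open U \<Longrightarrow> c2_on U f \<Longrightarrow> c2_on U (\<lambda>x. snd (f x))"
  by (rule c2_onI[where f' = "\<lambda>v x. snd (dd f v x)"])
    (auto intro!: has_derivative_snd c2_on_has_derivative c1_on_snd c2_on_dd)

lemma c1_on_id: "c1_on U (\<lambda>x. x)" by (intro c1_on_bounded_linear bounded_linear_ident)
lemma c2_on_id: "open U \<Longrightarrow> c2_on U (\<lambda>x. x)" by (intro c2_on_bounded_linear bounded_linear_ident)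

lemma c1_on_inner: "c1_on U f \<Longrightarrow> c1_on U (\<lambda>x. f x \<bullet> b)"
  by (rule c1_onI[where f' = "\<lambda>v x. dd f v x \<bullet> b"])
    (auto intro!: has_derivative_inner_left c1_on_has_derivative continuous_intros c1_on_continuous_dd)

text \<open>In the chain rule the direction moves with the point, whereas \<open>c1_on\<close> and
  \<open>c2_on\<close> speak of fixed directions. The expansion in the basis separates the
  two.\<close>

lemma dd_expand:
  assumes "f differentiable at x"
  shows "dd f w x = (\<Sum>b\<in>Basis. (w \<bullet> b) *\<^sub>R dd f b x)"
proof -
  have "dd f w x = dd f (\<Sum>b\<in>Basis. (w \<bullet> b) *\<^sub>R b) x" by (simp add: euclidean_representation)
  then show ?thesis
    using linear_sum[OF linear_dd[OF assms], of "\<lambda>b. (w \<bullet> b) *\<^sub>R b" Basis]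
    by (simp add: linear_scale[OF linear_dd[OF assms]])
qed

lemma compose_has_derivative:
  assumes "f differentiable at (h x)" "h differentiable at x"
  shows "((\<lambda>x. f (h x)) has_derivative (\<lambda>v. dd f (dd h v x) (h x))) (at x)"
  using has_derivative_compose[of h "\<lambda>v. dd h v x" x UNIV f "\<lambda>w. dd f w (h x)"]
    assms[THEN iffD1[OF frechet_derivative_works]]
  unfolding dd_def[abs_def] by blast

lemma dd_compose:
  assumes "f differentiable at (h x)" "h differentiable at x"
  shows "dd (\<lambda>x. f (h x)) v x = dd f (dd h v x) (h x)"
  by (rule dd_eqI[OF compose_has_derivative[OF assms]])

lemma c1_on_compose:
  assumes "c1_on V f" "c1_on U h" "h ` U \<subseteq> V"
  shows "c1_on U (\<lambda>x. f (h x))"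
proof (rule c1_onI[where f' = "\<lambda>v x. \<Sum>b\<in>Basis. (dd h v x \<bullet> b) *\<^sub>R dd f b (h x)"])
  fix x assume x: "x \<in> U"
  have d: "f differentiable at (h x)" "h differentiable at x" using assms x by (auto simp: c1_on_def)
  show "((\<lambda>x. f (h x)) has_derivative (\<lambda>v. \<Sum>b\<in>Basis. (dd h v x \<bullet> b) *\<^sub>R dd f b (h x))) (at x)"
    using compose_has_derivative[OF d] by (subst (asm) dd_expand[OF d(1)])
next
  show "continuous_on U (\<lambda>x. \<Sum>b\<in>Basis. (dd h v x \<bullet> b) *\<^sub>R dd f b (h x))" for v
    using assms by (intro continuous_intros c1_on_continuous_dd continuous_on_compose2[of V "dd f _" U h]
        c1_on_continuous) auto
qed

lemma c2_on_compose:
  assumes "open U" "c2_on V f" "c2_on U h" "h ` U \<subseteq> V"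
  shows "c2_on U (\<lambda>x. f (h x))"
proof (rule c2_onI[where f' = "\<lambda>v x. \<Sum>b\<in>Basis. (dd h v x \<bullet> b) *\<^sub>R dd f b (h x)"])
  fix x assume x: "x \<in> U"
  have d: "f differentiable at (h x)" "h differentiable at x" using assms x by (auto simp: c2_on_def)
  show "((\<lambda>x. f (h x)) has_derivative (\<lambda>v. \<Sum>b\<in>Basis. (dd h v x \<bullet> b) *\<^sub>R dd f b (h x))) (at x)"
    using compose_has_derivative[OF d] by (subst (asm) dd_expand[OF d(1)])
next
  show "c1_on U (\<lambda>x. \<Sum>b\<in>Basis. (dd h v x \<bullet> b) *\<^sub>R dd f b (h x))" for v
    using assms by (intro c1_on_sum c1_on_scaleR c1_on_inner c2_on_dd c1_on_compose[of V "dd f _" U h] c2_on_c1)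
qed (rule assms)

lemma c1_on_inverse_real: "c1_on (- {0}) (inverse :: real \<Rightarrow> real)"
  by (rule c1_onI[where f' = "\<lambda>v x. - (inverse x * v * inverse x)"])
    (auto intro!: has_derivative_inverse' continuous_intros)

lemma c1_on_divide:
  assumes "c1_on U f" "c1_on U g" "\<And>x. x \<in> U \<Longrightarrow> g x \<noteq> 0"
  shows "c1_on U (\<lambda>x. f x / (g x :: real))"
  unfolding divide_inverse
  using assms by (intro c1_on_mult c1_on_compose[OF c1_on_inverse_real]) auto

lemma c2_on_inverse_real: "c2_on (- {0}) (inverse :: real \<Rightarrow> real)"
  by (rule c2_onI[where f' = "\<lambda>v x. - (inverse x * v * inverse x)"])
    (auto intro!: has_derivative_inverse' c1_on_minus c1_on_mult c1_on_inverse_real c1_on_const)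

lemma c2_on_divide:
  assumes "open U" "c2_on U f" "c2_on U g" "\<And>x. x \<in> U \<Longrightarrow> g x \<noteq> 0"
  shows "c2_on U (\<lambda>x. f x / (g x :: real))"
  unfolding divide_inverse
  using assms by (intro c2_on_mult c2_on_compose[OF _ c2_on_inverse_real]) auto

lemmas c1_intros = c1_on_const c1_on_add c1_on_scaleR c1_on_mult c1_on_minus c1_on_diff c1_on_Pair
  c1_on_fst c1_on_snd c1_on_id c1_on_divide

lemmas c2_intros = c2_on_const c2_on_add c2_on_scaleR c2_on_mult c2_on_minus c2_on_diff c2_on_Pair
  c2_on_fst c2_on_snd c2_on_id c2_on_divide

section \<open>The implicit function theorem with a C2 solution\<close>

lemma strict_mono_solution:
  fixes g :: "real \<Rightarrow> real"
  assumes "a < b" "continuous_on {a..b} g" "g a < 0" "0 < g b"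
    "\<And>x y. a \<le> x \<Longrightarrow> x < y \<Longrightarrow> y \<le> b \<Longrightarrow> g x < g y"
  shows "\<exists>!x. a < x \<and> x < b \<and> g x = 0"
proof -
  obtain x where x: "a \<le> x" "x \<le> b" "g x = 0"
    using IVT'[of g a 0 b] assms by auto
  moreover have "a < x" "x < b" using x assms(3,4) by (auto simp: order_less_le)
  moreover have "y = x" if "a < y" "y < b" "g y = 0" for y
    using assms(5)[of x y] assms(5)[of y x] x that by (cases x y rule: linorder_cases) auto
  ultimately show ?thesis by blast
qed

text \<open>On a small box \<psi> is strictly increasing in \<open>x\<close>, so opposite signs at
  the two ends give exactly one root. This is claimed for every small \<open>r\<close> with its own
  \<open>d\<close>: arbitrarily small \<open>r\<close> are what makes the implicit function
  continuous.\<close>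

lemma implicit_solution_pos:
  fixes \<psi> :: "real \<times> 'b::euclidean_space \<Rightarrow> real"
  assumes U: "open U" "(x0, q0) \<in> U" and \<psi>: "c1_on U \<psi>" "\<psi> (x0, q0) = 0" "0 < dd \<psi> (1, 0) (x0, q0)"
  shows "\<exists>r0>0. \<forall>r. 0 < r \<longrightarrow> r \<le> r0 \<longrightarrow> (\<exists>d>0. {x0 - r..x0 + r} \<times> ball q0 d \<subseteq> U \<and>
    (\<forall>x\<in>{x0 - r..x0 + r}. \<forall>q\<in>ball q0 d. 0 < dd \<psi> (1, 0) (x, q)) \<and>
    (\<forall>q\<in>ball q0 d. \<exists>!x. \<bar>x - x0\<bar> < r \<and> \<psi> (x, q) = 0))"
proof -
  let ?\<psi>x = "dd \<psi> (1, 0)"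
  have "continuous_on U ?\<psi>x" using \<psi>(1) by (rule c1_on_continuous_dd)
  then have "open (U \<inter> ?\<psi>x -` {0<..})"
    using U(1) by (metis continuous_on_open_vimage open_greaterThan Int_commute)
  then obtain e where e: "0 < e" "ball (x0, q0) e \<subseteq> U \<inter> ?\<psi>x -` {0<..}"
    using U(2) \<psi>(3) by (metis IntI greaterThan_iff open_contains_ball vimageI)
  have box: "(x, q) \<in> U \<and> 0 < ?\<psi>x (x, q)" if "\<bar>x - x0\<bar> \<le> e / 4" "dist q0 q < e / 4" for x q
  proof -
    have "dist (x0, q0) (x, q) \<le> dist x0 x + dist q0 q"
      by (simp add: dist_Pair_Pair sqrt_sum_squares_le_sum)
    also have "\<dots> < e" using that e by (simp add: dist_real_def abs_minus_commute)
    finally show ?thesis using e by auto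
  qed
  have deriv: "((\<lambda>x. \<psi> (x, q)) has_real_derivative ?\<psi>x (x, q)) (at x)" if "(x, q) \<in> U" for x q
  proof -
    have "((\<lambda>x. (x, q)) has_derivative (\<lambda>v. (v, 0))) (at x)" by (auto intro!: derivative_eq_intros)
    then have "((\<lambda>x. \<psi> (x, q)) has_derivative (\<lambda>v. dd \<psi> (v, 0) (x, q))) (at x)"
      by (rule has_derivative_compose[where g = \<psi> and g' = "\<lambda>v. dd \<psi> v (x, q)"])
        (rule c1_on_has_derivative[OF \<psi>(1) that])
    moreover have "(\<lambda>v. dd \<psi> (v, 0) (x, q)) = (*) (?\<psi>x (x, q))"
    proof
      show "dd \<psi> (v, 0) (x, q) = ?\<psi>x (x, q) * v" for v
        using linear_scale[OF c1_on_linear_dd[OF \<psi>(1) that], of v "(1, 0)"] by simp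
    qed
    ultimately show ?thesis by (simp only: has_field_derivative_def)
  qed
  have mono: "\<psi> (x, q) < \<psi> (y, q)" if "x0 - e / 4 \<le> x" "x < y" "y \<le> x0 + e / 4" "dist q0 q < e / 4" for x y q
  proof (rule DERIV_pos_imp_increasing[OF that(2)])
    fix z assume "x \<le> z" "z \<le> y"
    then have "\<bar>z - x0\<bar> \<le> e / 4" using that unfolding abs_le_iff by linarith
    then have "(z, q) \<in> U \<and> 0 < ?\<psi>x (z, q)" using that by (intro box)
    then show "\<exists>d. ((\<lambda>x. \<psi> (x, q)) has_real_derivative d) (at z) \<and> 0 < d"
      using deriv[of z q] by (intro exI[of _ "?\<psi>x (z, q)"]) simp
  qed
  have "\<exists>d>0. {x0 - r..x0 + r} \<times> ball q0 d \<subseteq> U \<and>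
      (\<forall>x\<in>{x0 - r..x0 + r}. \<forall>q\<in>ball q0 d. 0 < ?\<psi>x (x, q)) \<and>
      (\<forall>q\<in>ball q0 d. \<exists>!x. \<bar>x - x0\<bar> < r \<and> \<psi> (x, q) = 0)" if r: "0 < r" "r \<le> e / 4" for r
  proof -
    have inbox: "(x, q) \<in> U" "0 < ?\<psi>x (x, q)" if "x \<in> {x0 - r..x0 + r}" "dist q0 q < e / 4" for x q
    proof -
      have "\<bar>x - x0\<bar> \<le> e / 4" unfolding abs_le_iff using that r by auto
      from box[OF this that(2)] show "(x, q) \<in> U" "0 < ?\<psi>x (x, q)" by auto
    qed
    have lo: "\<psi> (x0 - r, q0) < 0" and hi: "0 < \<psi> (x0 + r, q0)"
      using mono[of "x0 - r" x0 q0] mono[of x0 "x0 + r" q0] r e \<psi>(2) by auto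
    have near: "\<exists>d>0. \<forall>q. dist q0 q < d \<longrightarrow> (x, q) \<in> U \<and> dist (\<psi> (x, q)) (\<psi> (x, q0)) < \<bar>\<psi> (x, q0)\<bar>"
      if "\<bar>x - x0\<bar> \<le> e / 4" "\<psi> (x, q0) \<noteq> 0" for x
    proof -
      have "continuous_on (ball q0 (e / 4)) (\<lambda>q. \<psi> (x, q))"
        using box that by (intro continuous_on_compose2[OF c1_on_continuous[OF \<psi>(1)]] continuous_intros) auto
      from this[unfolded continuous_on_iff, rule_format, of q0 "\<bar>\<psi> (x, q0)\<bar>"] that(2) e
      obtain d where "d > 0" "\<forall>q\<in>ball q0 (e / 4). dist q q0 < d \<longrightarrow> dist (\<psi> (x, q)) (\<psi> (x, q0)) < \<bar>\<psi> (x, q0)\<bar>"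
        by auto
      then show ?thesis using e box that by (intro exI[of _ "min d (e / 4)"]) (auto simp: dist_commute)
    qed
    obtain d1 where d1: "d1 > 0" "\<And>q. dist q0 q < d1 \<Longrightarrow> dist (\<psi> (x0 - r, q)) (\<psi> (x0 - r, q0)) < \<bar>\<psi> (x0 - r, q0)\<bar>"
      using near[of "x0 - r"] r lo by auto
    obtain d2 where d2: "d2 > 0" "\<And>q. dist q0 q < d2 \<Longrightarrow> dist (\<psi> (x0 + r, q)) (\<psi> (x0 + r, q0)) < \<bar>\<psi> (x0 + r, q0)\<bar>"
      using near[of "x0 + r"] r hi by auto
    define d where "d = min (e / 4) (min d1 d2)"
    have "\<exists>!x. \<bar>x - x0\<bar> < r \<and> \<psi> (x, q) = 0" if q: "q \<in> ball q0 d" for q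
    proof -
      have "\<exists>!x. x0 - r < x \<and> x < x0 + r \<and> \<psi> (x, q) = 0"
      proof (rule strict_mono_solution)
        show "continuous_on {x0 - r..x0 + r} (\<lambda>x. \<psi> (x, q))"
          using r q by (intro continuous_on_compose2[OF c1_on_continuous[OF \<psi>(1)]] continuous_intros)
            (auto simp: d_def intro!: inbox(1))
        show "\<psi> (x0 - r, q) < 0" using d1(2)[of q] q lo by (auto simp: d_def dist_real_def)
        show "0 < \<psi> (x0 + r, q)" using d2(2)[of q] q hi by (auto simp: d_def dist_real_def)
      qed (use mono r q in \<open>auto simp: d_def\<close>)
      moreover have "\<bar>x - x0\<bar> < r \<longleftrightarrow> x0 - r < x \<and> x < x0 + r" for x by auto
      ultimately show ?thesis by simp
    qed
    moreover have "0 < d" using e d1 d2 by (simp add: d_def)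
    moreover have "(x, q) \<in> U \<and> 0 < ?\<psi>x (x, q)" if "x \<in> {x0 - r..x0 + r}" "q \<in> ball q0 d" for x q
      using inbox[OF that(1), of q] that(2) by (auto simp: d_def)
    ultimately show ?thesis by (intro exI[of _ d]) auto
  qed
  then show ?thesis using e by (intro exI[of _ "e / 4"]) auto
qed


text \<open>The first-order expansion of \<psi> leaves an error involving the increment of
  \<open>f\<close> itself, which is known only to be continuous. The expansion is therefore used
  twice: once to get a Lipschitz bound for \<open>f\<close>, then to get the derivative.\<close>

lemma implicit_derivative:
  fixes \<psi> :: "real \<times> 'b::euclidean_space \<Rightarrow> real"
  assumes L: "(\<psi> has_derivative L) (at (f q1, q1))" "0 < L (1, 0)"
    and cont: "isCont f q1" and z: "open B" "q1 \<in> B" "\<And>q. q \<in> B \<Longrightarrow> \<psi> (f q, q) = 0"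
  shows "(f has_derivative (\<lambda>v. - L (0, v) / L (1, 0))) (at q1)"
proof -
  let ?p = "L (1, 0)"
  have lin: "linear L" and bl: "bounded_linear L"
    using L(1) has_derivative_bounded_linear bounded_linear.linear by blast+
  have Ladd: "L (a, v) = a * ?p + L (0, v)" for a v
    using linear_add[OF lin, of "(a, 0)" "(0, v)"] linear_scale[OF lin, of a "(1, 0)"] by simp
  obtain K where K: "0 < K" "\<And>w. norm (L w) \<le> norm w * K"
    using bounded_linear.pos_bounded[OF bl] by blast
  have KL: "\<bar>L (0, v)\<bar> \<le> K * norm v" for v using K(2)[of "(0, v)"] by (simp add: mult.commute)
  define C where "C = 2 * K / ?p + 1"
  have C: "0 < C" using K L by (simp add: C_def add_pos_pos)
  have "\<exists>d>0. \<forall>q. norm (q - q1) < d \<longrightarrow> norm (f q - f q1 - - L (0, q - q1) / ?p) \<le> e * norm (q - q1)"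
    if "0 < e" for e
  proof -
    \<comment> \<open>The bound \<open>?p / 2\<close> absorbs the increment of \<open>f\<close> into
      the left side and yields the Lipschitz constant \<open>C\<close>; the other bound then turns
      the error into \<open>e * norm (q - q1)\<close>.\<close>
    define e1 where "e1 = min (?p / 2) (e * ?p / (C + 1))"
    have "0 < e1" using L C that by (simp add: e1_def)
    moreover have "e1 \<le> ?p / 2" "e1 \<le> e * ?p / (C + 1)"
      unfolding e1_def by (rule min.cobounded1, rule min.cobounded2)
    ultimately have e1: "0 < e1" "e1 \<le> ?p / 2" "e1 \<le> e * ?p / (C + 1)" by blast+
    obtain d1 where d1: "0 < d1" "\<And>w. norm (w - (f q1, q1)) < d1 \<Longrightarrow>
        norm (\<psi> w - \<psi> (f q1, q1) - L (w - (f q1, q1))) \<le> e1 * norm (w - (f q1, q1))"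
      using L(1) e1(1) unfolding has_derivative_at_alt by blast
    obtain d2 where d2: "0 < d2" "\<And>q. dist q q1 < d2 \<Longrightarrow> dist (f q) (f q1) < d1 / 2"
      using cont d1(1) unfolding continuous_at_eps_delta by (metis half_gt_zero)
    obtain d3 where d3: "0 < d3" "ball q1 d3 \<subseteq> B" using z open_contains_ball by blast
    have "norm (f q - f q1 - - L (0, q - q1) / ?p) \<le> e * norm (q - q1)"
      if q: "norm (q - q1) < min (d1 / 2) (min d2 d3)" for q
    proof -
      let ?D = "f q - f q1"
      have nle: "norm (?D, q - q1) \<le> \<bar>?D\<bar> + norm (q - q1)"
        using norm_Pair_le[of ?D "q - q1"] by simp
      also have "\<dots> < d1" using q d2(2)[of q] by (simp add: dist_norm)
      finally have "norm (\<psi> (f q, q) - \<psi> (f q1, q1) - L (?D, q - q1)) \<le> e1 * norm (?D, q - q1)"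
        using d1(2)[of "(f q, q)"] by simp
      moreover have "q \<in> B" using q d3 by (auto simp: dist_norm norm_minus_commute subset_iff)
      ultimately have "\<bar>?D * ?p + L (0, q - q1)\<bar> \<le> e1 * norm (?D, q - q1)"
        using z by (simp add: Ladd[of ?D])
      also have "\<dots> \<le> e1 * (\<bar>?D\<bar> + norm (q - q1))"
        using nle e1 by (intro mult_left_mono) auto
      finally have A: "\<bar>?D * ?p + L (0, q - q1)\<bar> \<le> e1 * (\<bar>?D\<bar> + norm (q - q1))" .
      have "\<bar>?D\<bar> * ?p = \<bar>?D * ?p\<bar>" using L by (simp add: abs_mult)
      also have "\<dots> \<le> K * norm (q - q1) + e1 * (\<bar>?D\<bar> + norm (q - q1))"
        using A KL[of "q - q1"] by linarith
      also have "\<dots> \<le> K * norm (q - q1) + ?p / 2 * (\<bar>?D\<bar> + norm (q - q1))"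
        using e1 by (intro add_left_mono mult_right_mono) auto
      finally have "\<bar>?D\<bar> \<le> C * norm (q - q1)"
        using L by (simp add: C_def field_simps)
      then have "e1 * (\<bar>?D\<bar> + norm (q - q1)) \<le> e1 * ((C + 1) * norm (q - q1))"
        using e1 by (intro mult_left_mono) (auto simp: algebra_simps)
      also have "\<dots> \<le> e * ?p / (C + 1) * ((C + 1) * norm (q - q1))"
        using e1 C by (intro mult_right_mono) auto
      also have "\<dots> = e * ?p * norm (q - q1)" using C by simp
      finally have "\<bar>?D * ?p + L (0, q - q1)\<bar> \<le> e * ?p * norm (q - q1)" using A by linarith
      moreover have "?D * ?p + L (0, q - q1) = (?D - - L (0, q - q1) / ?p) * ?p" using L by (simp add: field_simps)
      ultimately have "\<bar>?D - - L (0, q - q1) / ?p\<bar> * ?p \<le> (e * norm (q - q1)) * ?p"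
        using L by (simp add: abs_mult mult_ac)
      then show ?thesis using L by (simp only: real_norm_def mult_le_cancel_right_pos)
    qed
    then show ?thesis using d1 d2 d3 by (intro exI[of _ "min (d1 / 2) (min d2 d3)"]) auto
  qed
  moreover have "bounded_linear (\<lambda>v. - L (0, v) / ?p)"
  proof -
    have "bounded_linear (\<lambda>v. L (0, v))"
      by (rule bounded_linear_compose[OF bl]) (intro bounded_linear_Pair bounded_linear_zero bounded_linear_ident)
    then have "bounded_linear (\<lambda>v. (- 1 / ?p) * L (0, v))"
      by (rule bounded_linear_compose[OF bounded_linear_mult_right])
    then show ?thesis by simp
  qed
  ultimately show ?thesis unfolding has_derivative_at_alt by blast
qed

text \<open>Regularity comes by bootstrapping: the formula for the derivative of \<open>f\<close>
  contains \<open>f\<close> itself, so continuity of \<open>f\<close> makes it C1, and then the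
  derivative is C1 as a composition.\<close>

lemma implicit_function_pos:
  fixes \<psi> :: "real \<times> 'b::euclidean_space \<Rightarrow> real"
  assumes U: "open U" "(x0, q0) \<in> U" and \<psi>: "c2_on U \<psi>" "\<psi> (x0, q0) = 0" "0 < dd \<psi> (1, 0) (x0, q0)"
  shows "\<exists>r>0. \<exists>d>0. \<exists>f. {x. \<bar>x - x0\<bar> < r} \<times> ball q0 d \<subseteq> U \<and> c2_on (ball q0 d) f \<and>
    (\<forall>q\<in>ball q0 d. \<bar>f q - x0\<bar> < r) \<and> (\<forall>x. \<forall>q\<in>ball q0 d. \<bar>x - x0\<bar> < r \<longrightarrow> (\<psi> (x, q) = 0 \<longleftrightarrow> x = f q))"
proof -
  have c1: "c1_on U \<psi>" by (rule c2_on_c1[OF \<psi>(1)])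
  obtain r where r: "0 < r" and r0: "\<forall>s. 0 < s \<longrightarrow> s \<le> r \<longrightarrow> (\<exists>d>0. {x0 - s..x0 + s} \<times> ball q0 d \<subseteq> U \<and>
    (\<forall>x\<in>{x0 - s..x0 + s}. \<forall>q\<in>ball q0 d. 0 < dd \<psi> (1, 0) (x, q)) \<and>
    (\<forall>q\<in>ball q0 d. \<exists>!x. \<bar>x - x0\<bar> < s \<and> \<psi> (x, q) = 0))"
    using implicit_solution_pos[OF U c1 \<psi>(2,3)] by (elim exE conjE)
  obtain d where d: "0 < d" and box: "{x0 - r..x0 + r} \<times> ball q0 d \<subseteq> U"
    and pos': "\<forall>x\<in>{x0 - r..x0 + r}. \<forall>q\<in>ball q0 d. 0 < dd \<psi> (1, 0) (x, q)"
    and ex1': "\<forall>q\<in>ball q0 d. \<exists>!x. \<bar>x - x0\<bar> < r \<and> \<psi> (x, q) = 0"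
    using r0[rule_format, OF r order_refl] by (elim exE conjE)
  note pos = pos'[rule_format] and ex1 = ex1'[rule_format]
  define f where "f q = (THE x. \<bar>x - x0\<bar> < r \<and> \<psi> (x, q) = 0)" for q
  have f: "\<bar>f q - x0\<bar> < r" "\<psi> (f q, q) = 0" if "q \<in> ball q0 d" for q
    using theI'[OF ex1[OF that]] by (simp_all add: f_def)
  have uniq: "x = f q" if "q \<in> ball q0 d" "\<bar>x - x0\<bar> < r" "\<psi> (x, q) = 0" for x q
    using ex1[OF that(1)] f[OF that(1)] that by blast
  have fU: "(f q, q) \<in> U" "0 < dd \<psi> (1, 0) (f q, q)" if "q \<in> ball q0 d" for q
    using f[OF that] box pos[of "f q" q] that by (auto simp: abs_less_iff)
  have cont: "isCont f q1" if q1: "q1 \<in> ball q0 d" for q1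
    unfolding continuous_at_eps_delta
  proof clarify
    fix \<epsilon> :: real assume "0 < \<epsilon>"
    obtain r1 where r1: "0 < r1" and r1': "\<forall>s. 0 < s \<longrightarrow> s \<le> r1 \<longrightarrow> (\<exists>d>0. {f q1 - s..f q1 + s} \<times> ball q1 d \<subseteq> U \<and>
      (\<forall>x\<in>{f q1 - s..f q1 + s}. \<forall>q\<in>ball q1 d. 0 < dd \<psi> (1, 0) (x, q)) \<and>
      (\<forall>q\<in>ball q1 d. \<exists>!x. \<bar>x - f q1\<bar> < s \<and> \<psi> (x, q) = 0))"
      using implicit_solution_pos[OF U(1) fU(1)[OF q1] c1 f(2)[OF q1] fU(2)[OF q1]] by (elim exE conjE)
    \<comment> \<open>Apart from being below \<epsilon>, the window around \<open>f q1\<close> must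
      lie inside the original one, so that the root found in it is the value of
      \<open>f\<close>.\<close>
    define s where "s = min \<epsilon> (min r1 (r - \<bar>f q1 - x0\<bar>))"
    have s: "0 < s" "s \<le> \<epsilon>" "s \<le> r1" "s \<le> r - \<bar>f q1 - x0\<bar>"
      using \<open>0 < \<epsilon>\<close> r1 f(1)[OF q1] by (auto simp: s_def)
    obtain d1 where d1: "0 < d1" and d1': "\<forall>q\<in>ball q1 d1. \<exists>!x. \<bar>x - f q1\<bar> < s \<and> \<psi> (x, q) = 0"
      using r1'[rule_format, OF s(1,3)] by (elim exE conjE)
    obtain d2 where d2: "0 < d2" "ball q1 d2 \<subseteq> ball q0 d"
      using q1 by (meson open_ball open_contains_ball)
    have "dist (f q) (f q1) < \<epsilon>" if "dist q q1 < min d1 d2" for q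
    proof -
      have "q \<in> ball q1 d1" using that by (simp add: dist_commute)
      from d1'[rule_format, OF this] obtain x where x: "\<bar>x - f q1\<bar> < s" "\<psi> (x, q) = 0" by (elim ex1E conjE)
      moreover have "\<bar>x - x0\<bar> < r" using x s by linarith
      moreover have "q \<in> ball q0 d" using that d2 by (auto simp: dist_commute subset_iff)
      ultimately have "x = f q" using uniq by blast
      then show ?thesis using x s by (simp add: dist_real_def)
    qed
    then show "\<exists>d>0. \<forall>x'. dist x' q1 < d \<longrightarrow> dist (f x') (f q1) < \<epsilon>"
      using d1 d2 by (intro exI[of _ "min d1 d2"]) auto
  qed
  define f' where "f' v q = - dd \<psi> (0, v) (f q, q) / dd \<psi> (1, 0) (f q, q)" for v q
  have der: "(f has_derivative (\<lambda>v. f' v q)) (at q)" if "q \<in> ball q0 d" for q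
    unfolding f'_def
    by (rule implicit_derivative[OF c1_on_has_derivative[OF c1 fU(1)[OF that]] fU(2)[OF that] cont[OF that], of "ball q0 d"])
      (use that f in auto)
  have fc: "continuous_on (ball q0 d) f"
    by (rule has_derivative_continuous_on[OF has_derivative_at_withinI[OF der]])
  have c1f: "c1_on (ball q0 d) f"
  proof (rule c1_onI[where f' = f', OF der])
    show "continuous_on (ball q0 d) (f' v)" for v
      unfolding f'_def
      by (intro continuous_intros continuous_on_compose2[OF c1_on_continuous_dd[OF c1]] fc)
        (use fU in force)+
  qed
  have h: "c1_on (ball q0 d) (\<lambda>q. (f q, q))" by (intro c1_intros c1f)
  have "c2_on (ball q0 d) f"
  proof (rule c2_onI[where f' = f', OF _ der])
    show "c1_on (ball q0 d) (f' v)" for v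
      unfolding f'_def
      by (intro c1_intros c1_on_compose[OF c2_on_dd[OF \<psi>(1)] h]) (use fU in force)+
  qed auto
  moreover have "{x. \<bar>x - x0\<bar> < r} \<times> ball q0 d \<subseteq> U" using box by (auto simp: abs_less_iff subset_iff)
  ultimately show ?thesis
    by (intro exI[of _ r] exI[of _ d] exI[of _ f] conjI ballI allI impI r d f(1)) (use uniq f(2) in auto)
qed

theorem implicit_function:
  fixes \<psi> :: "real \<times> 'b::euclidean_space \<Rightarrow> real"
  assumes U: "open U" "(x0, q0) \<in> U" and \<psi>: "c2_on U \<psi>" "\<psi> (x0, q0) = 0" "dd \<psi> (1, 0) (x0, q0) \<noteq> 0"
  obtains r d f where "0 < r" "0 < d" "{x. \<bar>x - x0\<bar> < r} \<times> ball q0 d \<subseteq> U" "c2_on (ball q0 d) f"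
    "\<And>q. q \<in> ball q0 d \<Longrightarrow> \<bar>f q - x0\<bar> < r"
    "\<And>x q. q \<in> ball q0 d \<Longrightarrow> \<bar>x - x0\<bar> < r \<Longrightarrow> \<psi> (x, q) = 0 \<longleftrightarrow> x = f q"
proof (cases "0 < dd \<psi> (1, 0) (x0, q0)")
  case True
  show ?thesis using implicit_function_pos[OF U \<psi>(1,2) True] by (elim exE conjE) (rule that; blast)
next
  case False
  have "dd (\<lambda>x. - \<psi> x) (1, 0) (x0, q0) = - dd \<psi> (1, 0) (x0, q0)"
    using c2_on_has_derivative[OF \<psi>(1) U(2)] by (intro dd_eqI has_derivative_minus)
  then have "0 < dd (\<lambda>x. - \<psi> x) (1, 0) (x0, q0)" using False \<psi>(3) by simp
  from implicit_function_pos[OF U c2_on_minus[OF U(1) \<psi>(1)], unfolded neg_equal_0_iff_equal, OF \<psi>(2) this]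
  show ?thesis by (elim exE conjE) (rule that; blast)
qed

section \<open>Entire graphs are closed\<close>

lemma ivt_opposite_signs:
  fixes g :: "real \<Rightarrow> real"
  assumes "a < b" "continuous_on {a..b} g" "g a * g b < 0"
  shows "\<exists>x. a < x \<and> x < b \<and> g x = 0"
proof -
  obtain x where x: "a \<le> x" "x \<le> b" "g x = 0"
  proof (cases "g a < 0")
    case True
    then have "0 < g b" using assms(3) by (simp add: mult_less_0_iff)
    then show ?thesis using IVT'[of g a 0 b] assms True that by auto
  next
    case False
    then have "0 < g a" "g b < 0" using assms(3) by (auto simp: mult_less_0_iff)
    then show ?thesis using IVT2'[of g b 0 a] assms that by auto
  qed
  then show ?thesis using assms(3) by (metis less_irrefl mult_zero_left mult_zero_right order_less_le)
qed

lemma defining_functionD: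
  assumes "defining_function S U \<phi>"
  shows "open U" "c2_on U \<phi>" "\<And>g. g \<in> U \<Longrightarrow> g \<in> S \<longleftrightarrow> \<phi> g = 0"
    "\<And>g. g \<in> S \<Longrightarrow> g \<in> U \<Longrightarrow> \<exists>w. dd \<phi> w g \<noteq> 0"
  using assms unfolding defining_function_def C2_on_eq euclid_grad_def dd_def
  by (auto simp: zero_prod_def) blast

lemma decrease_along_direction:
  fixes \<phi> :: "'a::euclidean_space \<Rightarrow> real"
  assumes "(\<phi> has_derivative L) (at g)" "L w \<noteq> 0" "\<sigma> \<noteq> 0" "0 < d"
  obtains h where "dist h g < d" "\<sigma> * \<phi> h < \<sigma> * \<phi> g"
proof -
  \<comment> \<open>Scaled so that the derivative of \<open>\<sigma> * \<phi>\<close> along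
    \<open>v\<close> is minus a square.\<close>
  define v where "v = (- (\<sigma> * L w)) *\<^sub>R w"
  have lin: "linear L" using assms(1) has_derivative_linear by blast
  have "L v = - (\<sigma> * L w) * L w"
    unfolding v_def by (subst linear_scale[OF lin]) simp
  then have "\<sigma> * L v = - ((\<sigma> * L w)\<^sup>2)" by (simp add: power2_eq_square)
  then have Lv: "\<sigma> * L v < 0" using assms(2,3) by simp
  have "((\<lambda>t. g + t *\<^sub>R v) has_derivative (\<lambda>t. t *\<^sub>R v)) (at 0)"
    by (auto intro!: derivative_eq_intros)
  then have "((\<lambda>t. \<phi> (g + t *\<^sub>R v)) has_derivative (\<lambda>t. L (t *\<^sub>R v))) (at 0)"
    using has_derivative_compose[of "\<lambda>t. g + t *\<^sub>R v" "\<lambda>t. t *\<^sub>R v" 0 UNIV \<phi> L] assms(1) by simp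
  then have "((\<lambda>t. \<sigma> * \<phi> (g + t *\<^sub>R v)) has_derivative (\<lambda>t. \<sigma> * L (t *\<^sub>R v))) (at 0)"
    by (rule has_derivative_mult_right)
  moreover have "(\<lambda>t. \<sigma> * L (t *\<^sub>R v)) = (*) (\<sigma> * L v)"
    by (auto simp: linear_scale[OF lin])
  ultimately have "DERIV (\<lambda>t. \<sigma> * \<phi> (g + t *\<^sub>R v)) 0 :> \<sigma> * L v"
    by (simp add: has_field_derivative_def)
  from DERIV_neg_dec_right[OF this Lv]
  obtain e where e: "0 < e" "\<And>t. 0 < t \<Longrightarrow> t < e \<Longrightarrow> \<sigma> * \<phi> (g + t *\<^sub>R v) < \<sigma> * \<phi> g" by auto
  define t where "t = min (e / 2) (d / (2 * (norm v + 1)))"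
  have np: "0 < norm v + 1" by (simp add: add_nonneg_pos)
  have t: "0 < t" "t < e" using e(1) assms(4) np by (auto simp: t_def)
  have "t * norm v \<le> d / (2 * (norm v + 1)) * (norm v + 1)"
    using assms(4) t np by (intro mult_mono) (auto simp: t_def)
  also have "\<dots> = d / 2"
  proof -
    have "d / (2 * k) * k = d / 2" if "0 < k" for k using that by simp
    then show ?thesis using np by blast
  qed
  also have "\<dots> < d" using assms(4) by simp
  finally have "dist (g + t *\<^sub>R v) g < d" using t by (simp add: dist_norm)
  then show ?thesis using e(2)[OF t] that by blast
qed

text \<open>The graph property without its base plane: all lines of direction \<open>n\<close> are
  treated alike, wherever they start.\<close>

locale line_graph =
  fixes S :: "heis set" and n :: heis
  assumes surface: "C2_surface S" and n: "n \<noteq> 0" and hit: "\<And>h. \<exists>!s. h + s *\<^sub>R n \<in> S"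
begin

lemma hit_unique: "h + s *\<^sub>R n \<in> S \<Longrightarrow> h + t *\<^sub>R n \<in> S \<Longrightarrow> s = t"
  using hit by blast

text \<open>A defining function changes sign across \<open>S\<close> along each line of direction \<open>n\<close>: otherwise a
  nearby line would meet \<open>S\<close> twice.\<close>

lemma near_lines_hit_near:
  assumes g: "g \<in> S" and "0 < e"
  obtains d where "0 < d" "\<And>h. dist h g < d \<Longrightarrow> \<exists>s. \<bar>s\<bar> < e \<and> h + s *\<^sub>R n \<in> S"
proof -
  obtain U \<phi> where "g \<in> U" and def: "defining_function S U \<phi>"
    using surface g unfolding C2_surface_def by blast
  note \<phi> = defining_functionD[OF def]
  have cont: "continuous_on U \<phi>" by (intro c1_on_continuous c2_on_c1 \<phi>)
  obtain \<rho> where \<rho>: "0 < \<rho>" "ball g \<rho> \<subseteq> U" using \<phi>(1) \<open>g \<in> U\<close> open_contains_ball by blast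
  have nn: "0 < norm n" using n by simp
  define e' where "e' = min (e / 2) (\<rho> / (2 * norm n))"
  have e': "0 < e'" "e' < e" "e' * norm n \<le> \<rho> / 2"
  proof -
    show "0 < e'" "e' < e" using \<open>0 < e\<close> \<rho> nn by (auto simp: e'_def)
    have "e' * norm n \<le> \<rho> / (2 * norm n) * norm n" using nn by (intro mult_right_mono) (auto simp: e'_def)
    then show "e' * norm n \<le> \<rho> / 2" using nn by simp
  qed
  have inU: "h + s *\<^sub>R n \<in> U" if "dist h g < \<rho> / 2" "\<bar>s\<bar> \<le> e'" for h s
  proof -
    have "dist (h + s *\<^sub>R n) g \<le> dist (h + s *\<^sub>R n) h + dist h g" by (rule dist_triangle)
    also have "dist (h + s *\<^sub>R n) h \<le> \<rho> / 2"
      using mult_right_mono[OF that(2), of "norm n"] e'(3) by (simp add: dist_norm)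
    finally have "dist (h + s *\<^sub>R n) g < \<rho>" using that(1) by simp
    then show ?thesis using \<rho>(2) by (auto simp: dist_commute)
  qed
  have contline: "continuous_on {a..b} (\<lambda>s. \<phi> (h + s *\<^sub>R n))"
    if "dist h g < \<rho> / 2" "- e' \<le> a" "b \<le> e'" for h a b
    by (intro continuous_on_compose2[OF cont] continuous_intros image_subsetI inU) (use that in auto)
  have nz: "\<phi> (g + s *\<^sub>R n) \<noteq> 0" if "s \<noteq> 0" "\<bar>s\<bar> \<le> e'" for s
    using \<phi>(3)[OF inU[of g s]] \<rho> that hit_unique[of g s 0] g by auto
  have near: "\<exists>d>0. d \<le> \<rho> / 2 \<and> (\<forall>h. dist h g < d \<longrightarrow> 0 < \<phi> (g + s *\<^sub>R n) * \<phi> (h + s *\<^sub>R n))"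
    if "s \<noteq> 0" "\<bar>s\<bar> \<le> e'" for s
  proof -
    have "continuous_on (ball g (\<rho> / 2)) (\<lambda>h. \<phi> (g + s *\<^sub>R n) * \<phi> (h + s *\<^sub>R n))"
      by (intro continuous_intros continuous_on_compose2[OF cont] image_subsetI inU) (use that in \<open>auto simp: dist_commute\<close>)
    then have "open (ball g (\<rho> / 2) \<inter> (\<lambda>h. \<phi> (g + s *\<^sub>R n) * \<phi> (h + s *\<^sub>R n)) -` {0<..})"
      by (metis Int_commute continuous_on_open_vimage open_ball open_greaterThan)
    moreover have "0 < \<phi> (g + s *\<^sub>R n) * \<phi> (g + s *\<^sub>R n)" using nz[OF that] by (metis not_square_less_zero linorder_neqE_linordered_idom mult_eq_0_iff)
    then have "g \<in> ball g (\<rho> / 2) \<inter> (\<lambda>h. \<phi> (g + s *\<^sub>R n) * \<phi> (h + s *\<^sub>R n)) -` {0<..}" using \<rho> by simp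
    ultimately obtain d where "0 < d" "ball g d \<subseteq> ball g (\<rho> / 2) \<inter> (\<lambda>h. \<phi> (g + s *\<^sub>R n) * \<phi> (h + s *\<^sub>R n)) -` {0<..}"
      by (meson open_contains_ball)
    then show ?thesis using \<rho> by (intro exI[of _ "min d (\<rho> / 2)"]) (auto simp: subset_iff dist_commute)
  qed
  obtain d1 where d1: "0 < d1" "d1 \<le> \<rho> / 2" "\<And>h. dist h g < d1 \<Longrightarrow> 0 < \<phi> (g + e' *\<^sub>R n) * \<phi> (h + e' *\<^sub>R n)"
    using near[of e'] e' by auto
  obtain d2 where d2: "0 < d2" "d2 \<le> \<rho> / 2" "\<And>h. dist h g < d2 \<Longrightarrow> 0 < \<phi> (g + (- e') *\<^sub>R n) * \<phi> (h + (- e') *\<^sub>R n)"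
    using near[of "- e'"] e' by auto
  let ?p = "\<phi> (g + e' *\<^sub>R n)" and ?m = "\<phi> (g + (- e') *\<^sub>R n)"
  have pm0: "?p \<noteq> 0" "?m \<noteq> 0" using nz[of e'] nz[of "- e'"] e' by auto
  have opp: "?p * ?m < 0"
  proof (rule ccontr)
    assume "\<not> ?p * ?m < 0"
    then have same: "0 < ?p * ?m" using pm0 by (metis linorder_neqE_linordered_idom mult_eq_0_iff)
    \<comment> \<open>The nonzero differential supplies a point \<open>h\<close> near
      \<open>g\<close> where \<phi> has the sign opposite to both ends; its line then has a zero on
      either side of \<open>h\<close>.\<close>
    obtain w where "dd \<phi> w g \<noteq> 0" using \<phi>(4)[OF g \<open>g \<in> U\<close>] by blast
    then obtain h where h: "dist h g < min d1 d2" "?p * \<phi> h < ?p * \<phi> g"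
      using decrease_along_direction[OF c2_on_has_derivative[OF \<phi>(2) \<open>g \<in> U\<close>], of w ?p "min d1 d2"] pm0 d1 d2
      by auto
    have neg: "?p * \<phi> h < 0" using h \<phi>(3)[OF \<open>g \<in> U\<close>] g by simp
    have "\<phi> h * \<phi> (h + e' *\<^sub>R n) < 0"
      using neg d1(3)[of h] h by (auto simp: mult_less_0_iff zero_less_mult_iff)
    then obtain s where s: "0 < s" "s < e'" "\<phi> (h + s *\<^sub>R n) = 0"
      using ivt_opposite_signs[of 0 e' "\<lambda>s. \<phi> (h + s *\<^sub>R n)"] contline[of h 0 e'] h d1 e' by auto
    have "\<phi> (h + (- e') *\<^sub>R n) * \<phi> h < 0"
      using neg d2(3)[of h] h same by (auto simp: mult_less_0_iff zero_less_mult_iff)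
    then obtain s' where s': "- e' < s'" "s' < 0" "\<phi> (h + s' *\<^sub>R n) = 0"
      using ivt_opposite_signs[of "- e'" 0 "\<lambda>s. \<phi> (h + s *\<^sub>R n)"] contline[of h "- e'" 0] h d1 e' by auto
    have "h + s *\<^sub>R n \<in> S" "h + s' *\<^sub>R n \<in> S"
      using \<phi>(3)[OF inU[of h]] s s' h d1 by auto
    then show False using hit_unique s s' by fastforce
  qed
  have "\<exists>s. \<bar>s\<bar> < e \<and> h + s *\<^sub>R n \<in> S" if h: "dist h g < min d1 d2" for h
  proof -
    have "\<phi> (h + (- e') *\<^sub>R n) * \<phi> (h + e' *\<^sub>R n) < 0"
      using opp d1(3)[of h] d2(3)[of h] h by (auto simp: mult_less_0_iff zero_less_mult_iff)
    then obtain s where s: "- e' < s" "s < e'" "\<phi> (h + s *\<^sub>R n) = 0"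
      using ivt_opposite_signs[of "- e'" e' "\<lambda>s. \<phi> (h + s *\<^sub>R n)"] contline[of h "- e'" e'] h d1 e' by auto
    then have "h + s *\<^sub>R n \<in> S" using \<phi>(3)[OF inU[of h]] h d1 by auto
    then show ?thesis using s e' by (intro exI[of _ s]) auto
  qed
  then show ?thesis using d1 d2 that[of "min d1 d2"] by auto
qed

text \<open>The line through a point outside the set meets it at a parameter \<open>s0\<close>
  different from 0. Lines through nearby points meet it at parameters within
  \<open>\<bar>s0\<bar>\<close> of \<open>s0\<close>, hence not at 0, and by uniqueness these points
  are outside as well.\<close>

lemma closed_S: "closed S"
proof -
  have "\<exists>e>0. ball h e \<inter> S = {}" if "h \<notin> S" for h
  proof -
    obtain s0 where s0: "h + s0 *\<^sub>R n \<in> S" using hit by blast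
    then have "s0 \<noteq> 0" using that by auto
    then obtain d where d: "0 < d" "\<And>k. dist k (h + s0 *\<^sub>R n) < d \<Longrightarrow> \<exists>s. \<bar>s\<bar> < \<bar>s0\<bar> \<and> k + s *\<^sub>R n \<in> S"
      using near_lines_hit_near[OF s0, of "\<bar>s0\<bar>"] by auto
    have "k \<notin> S" if "dist h k < d" for k
    proof
      assume "k \<in> S"
      have "dist (k + s0 *\<^sub>R n) (h + s0 *\<^sub>R n) < d" using that by (simp add: dist_commute)
      then obtain s where s: "\<bar>s\<bar> < \<bar>s0\<bar>" "k + s0 *\<^sub>R n + s *\<^sub>R n \<in> S" using d(2) by blast
      then have "k + (s0 + s) *\<^sub>R n \<in> S" by (simp add: scaleR_add_left add.assoc)
      then have "s0 + s = 0" using hit_unique[of k "s0 + s" 0] \<open>k \<in> S\<close> by simp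
      then show False using s(1) by simp
    qed
    then show ?thesis using d by auto
  qed
  then show ?thesis
    unfolding closed_def open_contains_ball by (metis ComplD disjoint_eq_subset_Compl)
qed

end

lemma entire_graph_line_graph:
  assumes "entire_graph S"
  obtains n where "line_graph S n"
proof -
  obtain a b c \<gamma> where nz: "(a, b, c) \<noteq> (0, 0, 0)"
    and ex1: "\<And>g0. g0 \<in> {(x, y, t). a * x + b * y + c * t = \<gamma>} \<Longrightarrow>
      \<exists>!g. g \<in> S \<inter> {g0 + s *\<^sub>R (a, b, c) |s::real. True}"
    using assms unfolding entire_graph_def
    by (elim conjE exE) (rule that, assumption, erule (1) bspec)
  let ?n = "(a, b, c)"
  have n0: "?n \<noteq> 0" using nz by (simp add: zero_prod_def)
  have N: "0 < a * a + b * b + c * c"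
    using nz by (metis add_nonneg_eq_0_iff add_nonneg_nonneg less_eq_real_def mult_eq_0_iff zero_le_square)
  have "\<exists>!s. h + s *\<^sub>R ?n \<in> S" for h
  proof -
    obtain x y t where h: "h = (x, y, t)" by (metis surj_pair)
    \<comment> \<open>The parameter at which the line through \<open>h\<close> reaches the base
      plane; it exists because the direction is the normal of the plane.\<close>
    define s0 where "s0 = (\<gamma> - (a * x + b * y + c * t)) / (a * a + b * b + c * c)"
    have s0: "s0 * (a * a + b * b + c * c) = \<gamma> - (a * x + b * y + c * t)"
      using N by (simp add: s0_def)
    have "h + s0 *\<^sub>R ?n \<in> {(x, y, t). a * x + b * y + c * t = \<gamma>}"
      using s0 by (simp add: h algebra_simps)
    from ex1[OF this] obtain g where g': "g \<in> S \<inter> {h + s0 *\<^sub>R ?n + s *\<^sub>R ?n |s. True}"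
      and u': "\<forall>g'. g' \<in> S \<inter> {h + s0 *\<^sub>R ?n + s *\<^sub>R ?n |s. True} \<longrightarrow> g' = g" by (elim ex1E)
    note g = IntD1[OF g'] IntD2[OF g'] and u = u'[rule_format, OF IntI]
    obtain s where s: "g = h + s0 *\<^sub>R ?n + s *\<^sub>R ?n" using g(2) by blast
    show ?thesis
    proof (rule ex1I[of _ "s0 + s"])
      show "h + (s0 + s) *\<^sub>R ?n \<in> S" using g(1) by (simp add: s scaleR_add_left add.assoc distrib_right)
      fix s' assume s': "h + s' *\<^sub>R ?n \<in> S"
      have eq: "h + s' *\<^sub>R ?n = h + s0 *\<^sub>R ?n + (s' - s0) *\<^sub>R ?n"
        by (simp only: scaleR_diff_left) simp
      have "h + s' *\<^sub>R ?n = g"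
        by (rule u[OF s']) (use eq in blast)
      then have "s' *\<^sub>R ?n = (s0 + s) *\<^sub>R ?n" by (simp only: s scaleR_add_left add.assoc add_left_cancel)
      then show "s' = s0 + s" using n0 unfolding scaleR_cancel_right by blast
    qed
  qed
  then show ?thesis using assms n0 that[of ?n] unfolding entire_graph_def line_graph_def by blast
qed

section \<open>Tangent curves and characteristic points\<close>

lemma derivative_eq_0_if_eventually_0:
  assumes "\<forall>\<^sub>F s in nhds x. f s = 0" "(f has_derivative f') (at x)"
  shows "f' v = 0"
proof -
  obtain W where W: "open W" "x \<in> W" "\<And>s. s \<in> W \<Longrightarrow> f s = 0"
    using assms(1) unfolding eventually_nhds by blast
  have "(f has_derivative (\<lambda>_. 0)) (at x)"
    by (rule has_derivative_transform_within_open[OF has_derivative_const[of 0] W(1,2)]) (simp add: W(3))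
  from has_derivative_unique[OF assms(2) this] show ?thesis by simp
qed

text \<open>If both horizontal derivatives vanish, the differential of \<phi> is a nonzero multiple
  of the contact form dt + (y dx - x dy) / 2, whose kernel is the horizontal plane. Tangent vectors
  being velocities of curves, every vector of the kernel needs a curve in the surface; the surface
  is locally a graph over the (x, y)-plane, and the curve is lifted to it.\<close>

lemma noncharacteristic:
  assumes char: "char_locus S = {}" and def: "defining_function S U \<phi>" and g: "g \<in> S" "g \<in> U"
  shows "dd \<phi> (X1 g) g \<noteq> 0 \<or> dd \<phi> (X2 g) g \<noteq> 0"
proof (rule ccontr)
  assume "\<not> ?thesis"
  then have h: "dd \<phi> (X1 g) g = 0" "dd \<phi> (X2 g) g = 0" by auto
  note \<phi> = defining_functionD[OF def]
  obtain x y t where gt: "g = (x, y, t)" by (metis surj_pair)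
  have der: "(\<phi> has_derivative (\<lambda>v. dd \<phi> v g)) (at g)" by (rule c2_on_has_derivative[OF \<phi>(2) g(2)])
  have lin: "linear (\<lambda>v. dd \<phi> v g)" by (rule c1_on_linear_dd[OF c2_on_c1[OF \<phi>(2)] g(2)])
  let ?T = "(0, 0, 1) :: heis"
  have split: "(v1, v2, v3) = v1 *\<^sub>R X1 g + v2 *\<^sub>R X2 g + (v3 + v1 * y / 2 - v2 * x / 2) *\<^sub>R ?T" for v1 v2 v3
    by (simp add: gt)
  define K where "K = dd \<phi> ?T g"
  have ddv: "dd \<phi> (v1, v2, v3) g = (v3 + v1 * y / 2 - v2 * x / 2) * K" for v1 v2 v3
    unfolding K_def by (subst split) (simp only: linear_add[OF lin] linear_scale[OF lin] h, simp)
  have T: "K \<noteq> 0"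
    using \<phi>(4)[OF g] ddv by (metis mult_zero_right prod_cases3)
  have span: "span {X1 g, X2 g} = {(v1, v2, v3). v3 + v1 * y / 2 - v2 * x / 2 = 0}"
  proof -
    have "(v1, v2, v3) \<in> span {X1 g, X2 g} \<longleftrightarrow> v3 + v1 * y / 2 - v2 * x / 2 = 0" for v1 v2 v3
    proof
      assume "(v1, v2, v3) \<in> span {X1 g, X2 g}"
      then obtain k l where "(v1, v2, v3) - k *\<^sub>R X1 g = l *\<^sub>R X2 g"
        unfolding span_insert span_singleton by auto
      then show "v3 + v1 * y / 2 - v2 * x / 2 = 0" by (auto simp: gt)
    next
      assume "v3 + v1 * y / 2 - v2 * x / 2 = 0"
      then have "(v1, v2, v3) = v1 *\<^sub>R X1 g + v2 *\<^sub>R X2 g" by (simp add: gt)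
      then show "(v1, v2, v3) \<in> span {X1 g, X2 g}"
        by (metis insertI1 insertI2 span_add span_base span_scale)
    qed
    then show ?thesis by auto
  qed
  have "tangent_space S g = span {X1 g, X2 g}"
  proof (intro set_eqI iffI)
    fix v assume "v \<in> tangent_space S g"
    then obtain c \<epsilon> where c: "\<epsilon> > 0" "\<And>s. \<bar>s\<bar> < \<epsilon> \<Longrightarrow> c s \<in> S" "c 0 = g"
      "(c has_vector_derivative v) (at (0::real))" unfolding tangent_space_def by blast
    have dc: "(c has_derivative (\<lambda>s. s *\<^sub>R v)) (at 0)" using c(4) by (simp add: has_vector_derivative_def)
    have d1: "((\<lambda>s. \<phi> (c s)) has_derivative (\<lambda>s. dd \<phi> (s *\<^sub>R v) g)) (at 0)"
      using has_derivative_compose[OF dc, of \<phi> "\<lambda>v. dd \<phi> v g"] der c(3) by simp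
    have "isCont c 0" using dc has_derivative_continuous by blast
    then have "\<forall>\<^sub>F s in nhds 0. c s \<in> U"
      using \<phi>(1) g(2) c(3) by (simp add: continuous_at topological_tendstoD isCont_def eventually_nhds_conv_at)
    moreover have "\<forall>\<^sub>F s in nhds 0. s \<in> {- \<epsilon><..<\<epsilon>}"
      by (rule eventually_nhds_in_open) (use c(1) in auto)
    ultimately have "\<forall>\<^sub>F s in nhds 0. \<phi> (c s) = 0"
    proof eventually_elim
      case (elim s)
      then show ?case using c(2)[of s] \<phi>(3)[of "c s"] by (simp add: abs_less_iff)
    qed
    from derivative_eq_0_if_eventually_0[OF this d1] have "dd \<phi> (1 *\<^sub>R v) g = 0" .
    then show "v \<in> span {X1 g, X2 g}" using ddv T unfolding span by (cases v) auto
  next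
    fix v assume "v \<in> span {X1 g, X2 g}"
    then obtain v1 v2 v3 where v: "v = (v1, v2, v3)" "v3 + v1 * y / 2 - v2 * x / 2 = 0" unfolding span by auto
    \<comment> \<open>Reorders the coordinates so that \<open>t\<close>, the variable to be solved
      for, comes first.\<close>
    define \<sigma> :: "real \<times> real \<times> real \<Rightarrow> heis" where "\<sigma> p = (fst (snd p), snd (snd p), fst p)" for p
    have bl\<sigma>: "bounded_linear \<sigma>" unfolding \<sigma>_def by (intro bounded_linear_intros)
    define V where "V = \<sigma> -` U"
    have V: "open V" unfolding V_def using bounded_linear.linear[OF bl\<sigma>] \<phi>(1)
      by (intro open_vimage) (auto intro: linear_continuous_on[OF bl\<sigma>])
    have c2\<sigma>: "c2_on V \<sigma>" by (rule c2_on_bounded_linear[OF V bl\<sigma>])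
    have c2: "c2_on V (\<lambda>p. \<phi> (\<sigma> p))" by (rule c2_on_compose[OF V \<phi>(2) c2\<sigma>]) (auto simp: V_def)
    have p: "(t, x, y) \<in> V" using g by (simp add: V_def \<sigma>_def gt)
    have dd\<sigma>: "dd \<sigma> w p = \<sigma> w" for w p
      by (rule dd_eqI[OF bounded_linear_imp_has_derivative[OF bl\<sigma>]])
    have "dd (\<lambda>p. \<phi> (\<sigma> p)) (1, 0) (t, x, y) = K"
      unfolding K_def
      using p g \<phi>(2) c2\<sigma> by (subst dd_compose) (auto simp: dd\<sigma> c2_on_def, simp_all add: \<sigma>_def gt zero_prod_def)
    then have nz: "dd (\<lambda>p. \<phi> (\<sigma> p)) (1, 0) (t, x, y) \<noteq> 0" using T by simp
    have z: "\<phi> (\<sigma> (t, x, y)) = 0" using g \<phi>(3) by (simp add: \<sigma>_def gt)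
    obtain r d f where rd: "0 < r" "0 < d" "{z. \<bar>z - t\<bar> < r} \<times> ball (x, y) d \<subseteq> V" "c2_on (ball (x, y) d) f"
      "\<And>q. q \<in> ball (x, y) d \<Longrightarrow> \<bar>f q - t\<bar> < r"
      "\<And>z q. q \<in> ball (x, y) d \<Longrightarrow> \<bar>z - t\<bar> < r \<Longrightarrow> \<phi> (\<sigma> (z, q)) = 0 \<longleftrightarrow> z = f q"
      by (rule implicit_function[OF V p c2 z nz]) (rule that; assumption)
    have ft: "f (x, y) = t" using rd(6)[of "(x, y)" t] rd(1,2) z by auto
    define c where "c s = (x + s * v1, y + s * v2, f (x + s * v1, y + s * v2))" for s
    define \<epsilon> where "\<epsilon> = d / (norm (v1, v2) + 1)"
    have np: "0 < norm (v1, v2) + 1" by (simp add: add_nonneg_pos)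
    have \<epsilon>: "0 < \<epsilon>" using rd(2) np by (simp add: \<epsilon>_def)
    have cS: "c s \<in> S" if "\<bar>s\<bar> < \<epsilon>" for s
    proof -
      have "dist (x, y) (x + s * v1, y + s * v2) = norm (s *\<^sub>R (v1, v2))"
        by (simp add: dist_norm norm_Pair)
      also have "\<dots> = \<bar>s\<bar> * norm (v1, v2)" by (rule norm_scaleR)
      also have "\<dots> \<le> \<bar>s\<bar> * (norm (v1, v2) + 1)" by (intro mult_left_mono) auto
      also have "\<dots> < \<epsilon> * (norm (v1, v2) + 1)" using that np by (intro mult_strict_right_mono)
      also have "\<dots> = d" using np by (simp add: \<epsilon>_def)
      finally have q: "(x + s * v1, y + s * v2) \<in> ball (x, y) d" by simp
      have "(f (x + s * v1, y + s * v2), (x + s * v1, y + s * v2)) \<in> V" "\<phi> (\<sigma> (f (x + s * v1, y + s * v2), (x + s * v1, y + s * v2))) = 0"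
        using rd(3) rd(5)[OF q] rd(6)[OF q] q by auto
      then have "c s \<in> U" "\<phi> (c s) = 0" by (simp_all add: c_def V_def \<sigma>_def)
      then show ?thesis using \<phi>(3) by blast
    qed
    have df: "(f has_derivative (\<lambda>w. dd f w (x, y))) (at (x + 0 * v1, y + 0 * v2))"
      using c2_on_has_derivative[OF rd(4)] rd(2) by simp
    define v3' where "v3' = dd f (v1, v2) (x, y)"
    have "((\<lambda>s. (x + s * v1, y + s * v2)) has_derivative (\<lambda>s. (s * v1, s * v2))) (at 0)"
      by (auto intro!: derivative_eq_intros)
    from has_derivative_compose[OF this df]
    have "((\<lambda>s. f (x + s * v1, y + s * v2)) has_derivative (\<lambda>s. dd f (s *\<^sub>R (v1, v2)) (x, y))) (at 0)"
      by simp
    then have df': "((\<lambda>s. f (x + s * v1, y + s * v2)) has_derivative (\<lambda>s. s * v3')) (at 0)"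
      using linear_scale[OF c1_on_linear_dd[OF c2_on_c1[OF rd(4)]], of "(x, y)" _ "(v1, v2)"] rd(2)
      by (simp add: v3'_def)
    have dc: "(c has_derivative (\<lambda>s. s *\<^sub>R (v1, v2, v3'))) (at 0)"
      unfolding c_def using df' by (auto intro!: derivative_eq_intros)
    have c0: "c 0 = g" by (simp add: c_def gt ft)
    have d1: "((\<lambda>s. \<phi> (c s)) has_derivative (\<lambda>s. dd \<phi> (s *\<^sub>R (v1, v2, v3')) g)) (at 0)"
      using has_derivative_compose[OF dc, of \<phi> "\<lambda>v. dd \<phi> v g"] der c0 by simp
    have "isCont c 0" using dc has_derivative_continuous by blast
    then have "\<forall>\<^sub>F s in nhds 0. c s \<in> U"
      using \<phi>(1) g(2) c0 by (simp add: continuous_at topological_tendstoD isCont_def eventually_nhds_conv_at)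
    moreover have "\<forall>\<^sub>F s in nhds 0. s \<in> {- \<epsilon><..<\<epsilon>}"
      by (rule eventually_nhds_in_open) (use \<epsilon> in auto)
    ultimately have "\<forall>\<^sub>F s in nhds 0. \<phi> (c s) = 0"
    proof eventually_elim
      case (elim s)
      then show ?case using cS[of s] \<phi>(3)[of "c s"] by (simp add: abs_less_iff)
    qed
    from derivative_eq_0_if_eventually_0[OF this d1] have "dd \<phi> (1 *\<^sub>R (v1, v2, v3')) g = 0" .
    \<comment> \<open>The lifted curve has the prescribed first two velocity components; as its
      velocity lies in the kernel of the contact form, they determine the third.\<close>
    then have "v3' = v3" using ddv[of v1 v2 v3'] T v(2) by simp
    then have "(c has_vector_derivative v) (at 0)" using dc by (simp add: has_vector_derivative_def v)
    then show "v \<in> tangent_space S g"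
      unfolding tangent_space_def using \<epsilon> cS c0 by blast
  qed
  then have "g \<in> char_locus S" using g by (simp add: char_locus_def)
  then show False using char by simp
qed

section \<open>Intrinsic graphs\<close>

lemma has_derivative_ddI: "f differentiable at x \<Longrightarrow> (f has_derivative (\<lambda>v. dd f v x)) (at x)"
  unfolding dd_def[abs_def] by (simp add: frechet_derivative_works)

lemma dd_linear:
  assumes "f differentiable at x"
  shows "dd f (v + w) x = dd f v x + dd f w x" "dd f (a *\<^sub>R v) x = a *\<^sub>R dd f v x" "dd f 0 x = 0"
  using linear_dd[OF assms] by (rule linear_add, rule linear_scale, rule linear_0)

lemma defining_functionI:
  assumes "open U" "c2_on U \<phi>" "\<And>g. g \<in> U \<Longrightarrow> g \<in> S \<longleftrightarrow> \<phi> g = 0"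
    and nz: "\<And>g. g \<in> U \<Longrightarrow> g \<in> S \<Longrightarrow> \<exists>w. dd \<phi> w g \<noteq> 0"
  shows "defining_function S U \<phi>"
  unfolding defining_function_def C2_on_eq
proof (intro conjI ballI)
  fix g assume g: "g \<in> S \<inter> U"
  have d: "\<phi> differentiable at g" using assms(2) g by (simp add: c2_on_def)
  obtain w1 w2 w3 where w: "dd \<phi> (w1, w2, w3) g \<noteq> 0" using nz[of g] g by auto
  have "(w1, w2, w3) = w1 *\<^sub>R (1, 0, 0) + w2 *\<^sub>R (0, 1, 0) + w3 *\<^sub>R (0, 0, 1 :: real)" by simp
  then have "dd \<phi> (w1, w2, w3) g = w1 * dd \<phi> (1, 0, 0) g + w2 * dd \<phi> (0, 1, 0) g + w3 * dd \<phi> (0, 0, 1) g"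
    by (metis dd_linear(1,2)[OF d] real_scaleR_def)
  then show "euclid_grad \<phi> g \<noteq> 0"
    using w by (auto simp: euclid_grad_def dd_def zero_prod_def)
qed (use assms in auto)

text \<open>The horizontal frame rotated by a constant angle. The angle will be chosen so that
  \<open>E2\<close> is tangent to the surface at the base point; then \<open>E1\<close> is
  transversal to it.\<close>

definition E1 :: "real \<Rightarrow> real \<Rightarrow> heis \<Rightarrow> heis" where "E1 c s g = c *\<^sub>R X1 g + s *\<^sub>R X2 g"
definition E2 :: "real \<Rightarrow> real \<Rightarrow> heis \<Rightarrow> heis" where "E2 c s g = (- s) *\<^sub>R X1 g + c *\<^sub>R X2 g"

text \<open>The left translation by \<open>g0\<close> after the rotation with matrix \<open>(c, -s; s, c)\<close> about the
  \<open>t\<close>-axis, read in the coordinates \<open>(x, y, \<tau>)\<close> with \<open>\<tau> = t + x y / 2\<close> in which the first frame field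
  is \<open>\<partial>/\<partial>x\<close>. Graphs of functions of \<open>(y, \<tau>)\<close> are intrinsic graphs.\<close>

definition chart :: "heis \<Rightarrow> real \<Rightarrow> real \<Rightarrow> heis \<Rightarrow> heis" where
  "chart g0 c s p = (fst g0 + (c * fst p - s * fst (snd p)), fst (snd g0) + (s * fst p + c * fst (snd p)),
     snd (snd g0) + snd (snd p) - fst p * fst (snd p) / 2 +
     (fst g0 * (s * fst p + c * fst (snd p)) - fst (snd g0) * (c * fst p - s * fst (snd p))) / 2)"

definition unchart :: "heis \<Rightarrow> real \<Rightarrow> real \<Rightarrow> heis \<Rightarrow> heis" where
  "unchart g0 c s g =
     (c * (fst g - fst g0) + s * (fst (snd g) - fst (snd g0)),
      c * (fst (snd g) - fst (snd g0)) - s * (fst g - fst g0),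
      snd (snd g) - snd (snd g0) +
      (c * (fst g - fst g0) + s * (fst (snd g) - fst (snd g0))) * (c * (fst (snd g) - fst (snd g0)) - s * (fst g - fst g0)) / 2 -
      (fst g0 * (fst (snd g) - fst (snd g0)) - fst (snd g0) * (fst g - fst g0)) / 2)"

locale heis_chart =
  fixes g0 :: heis and c s :: real
  assumes cs: "c * c + s * s = 1"
begin

abbreviation "\<Phi> \<equiv> chart g0 c s"
abbreviation "\<Psi> \<equiv> unchart g0 c s"

lemma rot: "c * (c * u + s * v) - s * (c * v - s * u) = u" "s * (c * u + s * v) + c * (c * v - s * u) = v"
  "c * (c * u - s * v) + s * (s * u + c * v) = u" "c * (s * u + c * v) - s * (c * u - s * v) = v"
proof -
  have "c * (c * u + s * v) - s * (c * v - s * u) = (c * c + s * s) * u"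
    "s * (c * u + s * v) + c * (c * v - s * u) = (c * c + s * s) * v"
    "c * (c * u - s * v) + s * (s * u + c * v) = (c * c + s * s) * u"
    "c * (s * u + c * v) - s * (c * u - s * v) = (c * c + s * s) * v"
    by (simp_all add: algebra_simps)
  then show "c * (c * u + s * v) - s * (c * v - s * u) = u" "s * (c * u + s * v) + c * (c * v - s * u) = v"
    "c * (c * u - s * v) + s * (s * u + c * v) = u" "c * (s * u + c * v) - s * (c * u - s * v) = v"
    by (simp_all only: cs mult_1)
qed

lemma chart_unchart [simp]: "\<Phi> (\<Psi> g) = g"
  unfolding chart_def unchart_def by (cases g; cases g0) (simp add: rot)

lemma unchart_chart [simp]: "\<Psi> (\<Phi> p) = p"
  unfolding chart_def unchart_def by (cases p; cases g0) (simp add: rot)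

lemma c2_chart: "open U \<Longrightarrow> c2_on U \<Phi>"
  unfolding chart_def by (intro c2_intros) auto

lemma c2_unchart: "open U \<Longrightarrow> c2_on U \<Psi>"
  unfolding unchart_def by (intro c2_intros) auto

lemma cont_chart: "continuous_on U \<Phi>"
  unfolding chart_def by (intro continuous_intros) auto

lemma cont_unchart: "continuous_on U \<Psi>"
  unfolding unchart_def by (intro continuous_intros) auto

lemma open_vimage_chart: "open U \<Longrightarrow> open (\<Phi> -` U)"
  by (rule open_vimage[OF _ cont_chart])

lemma open_vimage_unchart: "open U \<Longrightarrow> open (\<Psi> -` U)"
  by (rule open_vimage[OF _ cont_unchart])

lemma chart_differentiable: "\<Phi> differentiable at p"
  using c2_chart[OF open_UNIV] unfolding c2_on_def by blast

lemma unchart_differentiable: "\<Psi> differentiable at g"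
  using c2_unchart[OF open_UNIV] unfolding c2_on_def by blast

text \<open>The coordinate fields of the chart become \<open>E1\<close>, \<open>E2\<close> minus
  \<open>x\<close> times T, and T. So \<open>E2\<close> reads \<partial>/\<partial>y + x
  \<partial>/\<partial>\<tau>, which is the origin of the Burgers operator.\<close>

lemma dd_chart: "dd \<Phi> v p = fst v *\<^sub>R E1 c s (\<Phi> p) + fst (snd v) *\<^sub>R E2 c s (\<Phi> p) + (snd (snd v) - fst p * fst (snd v)) *\<^sub>R (0, 0, 1)"
proof -
  have "(\<Phi> has_derivative (\<lambda>v. (c * fst v - s * fst (snd v), s * fst v + c * fst (snd v),
      snd (snd v) - (fst p * fst (snd v) + fst v * fst (snd p)) / 2 +
      (fst g0 * (s * fst v + c * fst (snd v)) - fst (snd g0) * (c * fst v - s * fst (snd v))) / 2))) (at p)"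
    unfolding chart_def[abs_def] by (auto intro!: derivative_eq_intros simp: fun_eq_iff field_simps)
  from dd_eqI[OF this, of v]
  have 1: "dd \<Phi> v p = (c * fst v - s * fst (snd v), s * fst v + c * fst (snd v),
      snd (snd v) - (fst p * fst (snd v) + fst v * fst (snd p)) / 2 +
      (fst g0 * (s * fst v + c * fst (snd v)) - fst (snd g0) * (c * fst v - s * fst (snd v))) / 2)" .
  obtain x y \<tau> where p: "p = (x, y, \<tau>)" by (metis surj_pair)
  obtain a b d where g: "g0 = (a, b, d)" by (metis surj_pair)
  have k1: "(s * (a + (c * x - s * y)) - c * (b + (s * x + c * y))) = s * a - c * b - y"
    using rot(4)[of x y] by (simp add: algebra_simps)
  have k2: "(c * (a + (c * x - s * y)) + s * (b + (s * x + c * y))) = c * a + s * b + x"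
    using rot(3)[of x y] by (simp add: algebra_simps)
  have e1: "E1 c s (\<Phi> p) = (c, s, (s * (a + (c * x - s * y)) - c * (b + (s * x + c * y))) / 2)"
    by (simp add: E1_def chart_def p g algebra_simps diff_divide_distrib add_divide_distrib)
  have e2: "E2 c s (\<Phi> p) = (- s, c, (c * (a + (c * x - s * y)) + s * (b + (s * x + c * y))) / 2)"
    by (simp add: E2_def chart_def p g algebra_simps diff_divide_distrib add_divide_distrib)
  show ?thesis
    unfolding 1 e1[unfolded k1] e2[unfolded k2]
    by (cases v) (simp add: p g algebra_simps diff_divide_distrib add_divide_distrib)
qed

text \<open>\<open>E1\<close> is constant along its own integral lines, so the
  \<open>x\<close>-lines of the chart are Euclidean straight lines. The Euclidean displacement in
  the definition of a deformation is therefore exactly a shift of the coordinate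
  \<open>x\<close>.\<close>

lemma chart_shift: "\<Phi> (x + h, q) = \<Phi> (x, q) + h *\<^sub>R E1 c s (\<Phi> (x, q))"
proof -
  obtain y \<tau> where q: "q = (y, \<tau>)" by (metis surj_pair)
  obtain a b d where g: "g0 = (a, b, d)" by (metis surj_pair)
  have k1: "(s * (a + (c * x - s * y)) - c * (b + (s * x + c * y))) = s * a - c * b - y"
    using rot(4)[of x y] by (simp add: algebra_simps)
  have e1: "E1 c s (\<Phi> (x, q)) = (c, s, (s * (a + (c * x - s * y)) - c * (b + (s * x + c * y))) / 2)"
    by (simp add: E1_def chart_def q g algebra_simps diff_divide_distrib add_divide_distrib)
  show ?thesis
    unfolding e1[unfolded k1]
    by (simp add: chart_def q g algebra_simps diff_divide_distrib add_divide_distrib)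
qed

lemma chart_line: "\<Phi> (0, y, \<tau>) = g0 + y *\<^sub>R E2 c s g0 + \<tau> *\<^sub>R (0, 0, 1)"
  by (cases g0) (simp add: chart_def E2_def algebra_simps diff_divide_distrib add_divide_distrib)

lemma E2_line: "E2 c s (g0 + y *\<^sub>R E2 c s g0) = E2 c s g0"
  by (cases g0) (simp add: E2_def algebra_simps diff_divide_distrib add_divide_distrib)

lemma X_eq_E: "X1 g = c *\<^sub>R E1 c s g + (- s) *\<^sub>R E2 c s g" "X2 g = s *\<^sub>R E1 c s g + c *\<^sub>R E2 c s g"
proof -
  have "c *\<^sub>R E1 c s g + (- s) *\<^sub>R E2 c s g = (c * c + s * s) *\<^sub>R X1 g"
    "s *\<^sub>R E1 c s g + c *\<^sub>R E2 c s g = (c * c + s * s) *\<^sub>R X2 g"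
    unfolding E1_def E2_def by (simp_all add: algebra_simps del: X1.simps X2.simps)
  then show "X1 g = c *\<^sub>R E1 c s g + (- s) *\<^sub>R E2 c s g" "X2 g = s *\<^sub>R E1 c s g + c *\<^sub>R E2 c s g"
    by (simp_all add: cs)
qed

lemma dd_frame:
  assumes "\<phi> differentiable at (\<Phi> p)"
  shows "dd \<phi> (E1 c s (\<Phi> p)) (\<Phi> p) = dd (\<lambda>p. \<phi> (\<Phi> p)) (1, 0, 0) p"
    "dd \<phi> (E2 c s (\<Phi> p)) (\<Phi> p) = dd (\<lambda>p. \<phi> (\<Phi> p)) (0, 1, fst p) p"
    "dd \<phi> (0, 0, 1) (\<Phi> p) = dd (\<lambda>p. \<phi> (\<Phi> p)) (0, 0, 1) p"
  by (simp_all add: dd_compose[OF assms chart_differentiable] dd_chart flip: zero_prod_def)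

lemma dd_unchart: "dd \<Psi> (dd \<Phi> v p) (\<Phi> p) = v"
proof -
  have "dd (\<lambda>p. \<Psi> (\<Phi> p)) v p = dd \<Psi> (dd \<Phi> v p) (\<Phi> p)"
    by (rule dd_compose[OF unchart_differentiable chart_differentiable])
  moreover have "dd (\<lambda>p. \<Psi> (\<Phi> p)) v p = v"
    by (rule dd_eqI) (simp add: has_derivative_ident)
  ultimately show ?thesis by simp
qed

text \<open>The surface coincides with the graph in the whole tube, which is why
  \<open>patch_fun f\<close> is a defining function and why \<open>f\<close> can be recovered from
  \<open>S\<close>.\<close>

definition patch :: "heis set \<Rightarrow> real \<Rightarrow> real \<Rightarrow> (real \<times> real) set \<Rightarrow> (real \<times> real \<Rightarrow> real) \<Rightarrow> bool" where
  "patch S x0 r V f \<longleftrightarrow> open V \<and> c2_on V f \<and> (\<forall>q\<in>V. \<bar>f q - x0\<bar> < r) \<and>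
     (\<forall>q\<in>V. \<forall>x. \<bar>x - x0\<bar> < r \<longrightarrow> (\<Phi> (x, q) \<in> S \<longleftrightarrow> x = f q))"

definition tube :: "real \<Rightarrow> real \<Rightarrow> (real \<times> real) set \<Rightarrow> heis set" where
  "tube x0 r V = \<Psi> -` ({x0 - r<..<x0 + r} \<times> V)"

definition patch_fun :: "(real \<times> real \<Rightarrow> real) \<Rightarrow> heis \<Rightarrow> real" where
  "patch_fun f g = fst (\<Psi> g) - f (snd (\<Psi> g))"

lemma open_tube: "open V \<Longrightarrow> open (tube x0 r V)"
  unfolding tube_def by (intro open_vimage_unchart open_Times) auto

lemma c2_patch_fun:
  assumes "c2_on V f" "open V"
  shows "c2_on (tube x0 r V) (patch_fun f)"
  unfolding patch_fun_def
  by (intro c2_on_diff c2_on_fst c2_unchart c2_on_compose[OF _ assms(1)] c2_on_snd open_tube assms)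
    (auto simp: tube_def)

lemma dd_patch_fun:
  assumes "f differentiable at (snd p)"
  shows "dd (patch_fun f) (dd \<Phi> v p) (\<Phi> p) = fst v - dd f (snd v) (snd p)"
proof -
  have 1: "(\<Psi> has_derivative (\<lambda>v. dd \<Psi> v (\<Phi> p))) (at (\<Phi> p))"
    by (rule has_derivative_ddI[OF unchart_differentiable])
  have 2: "((\<lambda>g. f (snd (\<Psi> g))) has_derivative (\<lambda>v. dd f (snd (dd \<Psi> v (\<Phi> p))) (snd p))) (at (\<Phi> p))"
    by (rule has_derivative_compose[OF has_derivative_snd[OF 1], where g = f and g' = "\<lambda>v. dd f v (snd p)"])
      (simp add: has_derivative_ddI[OF assms])
  have "(patch_fun f has_derivative (\<lambda>v. fst (dd \<Psi> v (\<Phi> p)) - dd f (snd (dd \<Psi> v (\<Phi> p))) (snd p))) (at (\<Phi> p))"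
    unfolding patch_fun_def[abs_def] by (intro has_derivative_diff has_derivative_fst 1 2)
  from dd_eqI[OF this] show ?thesis by (simp add: dd_unchart)
qed

lemma dd_chart_frame:
  "dd \<Phi> (1, 0, 0) p = E1 c s (\<Phi> p)" "dd \<Phi> (0, 1, fst p) p = E2 c s (\<Phi> p)" "dd \<Phi> (0, 0, 1) p = (0, 0, 1)"
  by (simp_all add: dd_chart flip: zero_prod_def)

lemma patch_defining:
  assumes "patch S x0 r V f"
  shows "defining_function S (tube x0 r V) (patch_fun f)"
proof (rule defining_functionI)
  have V: "open V" and f: "c2_on V f"
    and S: "\<And>q x. q \<in> V \<Longrightarrow> \<bar>x - x0\<bar> < r \<Longrightarrow> \<Phi> (x, q) \<in> S \<longleftrightarrow> x = f q"
    using assms unfolding patch_def by auto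
  show "open (tube x0 r V)" by (rule open_tube[OF V])
  show "c2_on (tube x0 r V) (patch_fun f)" by (rule c2_patch_fun[OF f V])
  fix g assume g: "g \<in> tube x0 r V"
  then have "snd (\<Psi> g) \<in> V" "\<bar>fst (\<Psi> g) - x0\<bar> < r" by (auto simp: tube_def)
  from S[OF this] show "g \<in> S \<longleftrightarrow> patch_fun f g = 0" by (auto simp: patch_fun_def)
  have "f differentiable at (snd (\<Psi> g))" using f \<open>snd (\<Psi> g) \<in> V\<close> by (auto simp: c2_on_def)
  then have "dd (patch_fun f) (dd \<Phi> (1, 0, 0) (\<Psi> g)) g = 1"
    using dd_patch_fun[of f "\<Psi> g" "(1, 0, 0)"] by (simp add: dd_linear flip: zero_prod_def)
  then show "\<exists>w. dd (patch_fun f) w g \<noteq> 0" by (metis zero_neq_one)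
qed

lemma patch_exists:
  assumes def: "defining_function S U \<phi>" and p0: "\<Phi> (x0, q0) \<in> S" "\<Phi> (x0, q0) \<in> U"
    and nz: "dd \<phi> (E1 c s (\<Phi> (x0, q0))) (\<Phi> (x0, q0)) \<noteq> 0"
  obtains r d f where "0 < r" "0 < d" "patch S x0 r (ball q0 d) f"
proof -
  note \<phi> = defining_functionD[OF def]
  let ?U = "\<Phi> -` U"
  have U: "open ?U" by (rule open_vimage_chart[OF \<phi>(1)])
  have c2: "c2_on ?U (\<lambda>p. \<phi> (\<Phi> p))" by (rule c2_on_compose[OF U \<phi>(2) c2_chart[OF U]]) auto
  have d: "\<phi> differentiable at (\<Phi> (x0, q0))" using \<phi>(2) p0 by (simp add: c2_on_def)
  have nz': "dd (\<lambda>p. \<phi> (\<Phi> p)) (1, 0) (x0, q0) \<noteq> 0"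
    using nz dd_frame(1)[OF d] by (simp add: zero_prod_def)
  have z: "\<phi> (\<Phi> (x0, q0)) = 0" using \<phi>(3) p0 by blast
  have p: "(x0, q0) \<in> ?U" using p0 by simp
  obtain r d f where rd: "0 < r" "0 < d" "{x. \<bar>x - x0\<bar> < r} \<times> ball q0 d \<subseteq> ?U" "c2_on (ball q0 d) f"
    "\<And>q. q \<in> ball q0 d \<Longrightarrow> \<bar>f q - x0\<bar> < r"
    "\<And>x q. q \<in> ball q0 d \<Longrightarrow> \<bar>x - x0\<bar> < r \<Longrightarrow> \<phi> (\<Phi> (x, q)) = 0 \<longleftrightarrow> x = f q"
    by (rule implicit_function[OF U p c2 z nz']) (rule that; assumption)
  have "patch S x0 r (ball q0 d) f"
    unfolding patch_def
  proof (intro conjI ballI allI impI)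
    fix q x assume qx: "q \<in> ball q0 d" "\<bar>x - x0\<bar> < r"
    then have "\<Phi> (x, q) \<in> U" using rd(3) by blast
    then show "\<Phi> (x, q) \<in> S \<longleftrightarrow> x = f q" using \<phi>(3) rd(6)[OF qx] by blast
  qed (use rd in auto)
  then show ?thesis using that rd by blast
qed

end

section \<open>The minimal surface equation for intrinsic graphs\<close>

definition burgers :: "(real \<times> real \<Rightarrow> real) \<Rightarrow> real \<times> real \<Rightarrow> real" where
  "burgers f q = dd f (1, 0) q + f q * dd f (0, 1) q"

lemma burgers_eq:
  assumes "f differentiable at q"
  shows "burgers f q = dd f (1, f q) q"
proof -
  have "(1, f q) = (1, 0) + f q *\<^sub>R (0, 1 :: real)" by simp
  then show ?thesis unfolding burgers_def using dd_linear[OF assms] by (metis real_scaleR_def)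
qed

lemma c1_burgers: "c2_on V f \<Longrightarrow> c1_on V (burgers f)"
  unfolding burgers_def[abs_def] by (intro c1_on_add c1_on_mult c2_on_dd c2_on_c1)

lemma dd_burgers:
  assumes "c2_on V f" "q \<in> V"
  shows "dd (burgers f) v q = dd (dd f (1, 0)) v q + (f q * dd (dd f (0, 1)) v q + dd f v q * dd f (0, 1) q)"
proof (rule dd_eqI)
  show "(burgers f has_derivative (\<lambda>v. dd (dd f (1, 0)) v q + (f q * dd (dd f (0, 1)) v q + dd f v q * dd f (0, 1) q))) (at q)"
    unfolding burgers_def[abs_def]
    by (intro has_derivative_add has_derivative_mult c2_on_has_derivative[OF assms]
        c1_on_has_derivative[OF c2_on_dd[OF assms(1)] assms(2)])
qed

lemma DERIV_sqrt_one_plus_square: "((\<lambda>z. sqrt (1 + z\<^sup>2)) has_real_derivative z / sqrt (1 + z\<^sup>2)) (at z)"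
proof -
  have pos: "0 < 1 + z\<^sup>2" by (simp add: add_pos_nonneg)
  have "((\<lambda>z. 1 + z\<^sup>2) has_real_derivative 2 * z) (at z)"
    by (auto intro!: derivative_eq_intros)
  from DERIV_chain2[OF DERIV_real_sqrt[OF pos] this] show ?thesis by (simp add: field_simps)
qed

lemma DERIV_affine_over_sqrt:
  "((\<lambda>z. (m + n * z) / sqrt (1 + z\<^sup>2)) has_real_derivative
    (n * sqrt (1 + z\<^sup>2) - (m + n * z) * (z / sqrt (1 + z\<^sup>2))) / (sqrt (1 + z\<^sup>2) * sqrt (1 + z\<^sup>2))) (at z)"
proof (rule DERIV_divide[OF _ DERIV_sqrt_one_plus_square])
  show "((\<lambda>z. m + n * z) has_real_derivative n) (at z)" by (auto intro!: derivative_eq_intros)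
  have "0 < 1 + z\<^sup>2" by (simp add: add_pos_nonneg)
  then show "sqrt (1 + z\<^sup>2) \<noteq> 0" by simp
qed

text \<open>For the defining function x - f the derivatives along \<open>E1\<close> and
  \<open>E2\<close> are 1 and \<open>- Q\<close>, with \<open>Q\<close> equal to
  \<open>burgers f\<close> on the surface. The curvature is the divergence of
  \<open>(1, - Q) / sqrt (1 + Q\<^sup>2)\<close> in the rotated frame; it reduces to
  \<open>- (Q * \<alpha> + \<beta>) / R ^ 3\<close>, where \<alpha> and \<beta> are the frame
  derivatives of \<open>Q\<close>, and the bracket is the derivative of \<open>burgers f\<close>
  along \<open>(1, f q)\<close>.\<close>

lemma (in heis_chart) patch_burgers:
  assumes P: "patch S x0 r V f" and H: "H_minimal S" and q: "q \<in> V"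
  shows "dd (burgers f) (1, f q) q = 0"
proof -
  have V: "open V" and f: "c2_on V f" using P unfolding patch_def by auto
  have fr: "\<bar>f q - x0\<bar> < r" and fS: "\<Phi> (f q, q) \<in> S" using P q unfolding patch_def by auto
  let ?U = "tube x0 r V" and ?\<phi> = "patch_fun f"
  let ?g = "\<Phi> (f q, q)"
  have gU: "?g \<in> ?U" using fr q by (auto simp: tube_def abs_less_iff)
  have H0: "H_mean_curvature ?\<phi> ?g = 0"
    using H patch_defining[OF P] fS gU unfolding H_minimal_def by blast
  \<comment> \<open>Here the coordinate \<open>x\<close> stands in place of \<open>f\<close>,
    because the derivatives of the defining function are needed off the surface, in a full
    neighbourhood.\<close>
  define G where "G p = dd f (1, 0) (snd p) + fst p * dd f (0, 1) (snd p)" for p :: heis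
  define Q where "Q g = G (\<Psi> g)" for g
  have fd: "f differentiable at q'" if "q' \<in> V" for q' using f that by (auto simp: c2_on_def)
  have frame: "dd ?\<phi> (E1 c s h) h = 1" "dd ?\<phi> (E2 c s h) h = - Q h" if h: "h \<in> ?U" for h
  proof -
    have hV: "snd (\<Psi> h) \<in> V" using h by (auto simp: tube_def)
    note dp = dd_patch_fun[OF fd[OF hV], unfolded chart_unchart]
    have l: "dd f (1, a) q' = dd f (1, 0) q' + a * dd f (0, 1) q'" if "q' \<in> V" for a q'
    proof -
      have "(1, a) = (1, 0) + a *\<^sub>R (0, 1 :: real)" by simp
      then show ?thesis using dd_linear[OF fd[OF that]] by (metis real_scaleR_def)
    qed
    show "dd ?\<phi> (E1 c s h) h = 1"
      using dp[of "(1, 0, 0)"] dd_chart_frame(1)[of "\<Psi> h"] dd_linear(3)[OF fd[OF hV]] by (simp add: zero_prod_def)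
    show "dd ?\<phi> (E2 c s h) h = - Q h"
      using dp[of "(0, 1, fst (\<Psi> h))"] dd_chart_frame(2)[of "\<Psi> h"] l[OF hV, of "fst (\<Psi> h)"] by (simp add: Q_def G_def)
  qed
  have \<phi>d: "?\<phi> differentiable at h" if "h \<in> ?U" for h
    using c2_patch_fun[OF f V] that by (auto simp: c2_on_def)
  have X: "vf_deriv X1 ?\<phi> h = c + s * Q h" "vf_deriv X2 ?\<phi> h = s - c * Q h" if h: "h \<in> ?U" for h
    unfolding vf_deriv_def dd_def[symmetric] X_eq_E
    by (simp_all add: dd_linear[OF \<phi>d[OF h]] frame[OF h] del: scaleR_minus_left)
  have W: "heis_W ?\<phi> h = sqrt (1 + (Q h)\<^sup>2)" if h: "h \<in> ?U" for h
  proof -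
    have "(c + s * Q h)\<^sup>2 + (s - c * Q h)\<^sup>2 = (c * c + s * s) + (c * c + s * s) * (Q h)\<^sup>2"
      by (simp add: power2_eq_square algebra_simps)
    then show ?thesis by (simp add: heis_W_def X[OF h] cs)
  qed
  have c1G: "c1_on (UNIV \<times> V) G"
    unfolding G_def by (intro c1_intros c1_on_compose[OF c2_on_dd[OF f]]) auto
  have Gd: "G differentiable at (f q, q)" using c1G q by (auto simp: c1_on_def)
  have ddG: "dd G v (f q, q) = dd (dd f (1, 0)) (snd v) q + (f q * dd (dd f (0, 1)) (snd v) q + fst v * dd f (0, 1) q)" for v
  proof (rule dd_eqI)
    have e: "((\<lambda>p. dd f w (snd p)) has_derivative (\<lambda>v. dd (dd f w) (snd v) q)) (at (f q, q))" for w
      by (rule has_derivative_compose[OF has_derivative_snd[OF has_derivative_ident], where g = "dd f w"])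
        (simp add: c1_on_has_derivative[OF c2_on_dd[OF f] q])
    show "(G has_derivative (\<lambda>v. dd (dd f (1, 0)) (snd v) q + (f q * dd (dd f (0, 1)) (snd v) q + fst v * dd f (0, 1) q))) (at (f q, q))"
      using has_derivative_add[OF e[of "(1, 0)"] has_derivative_mult[OF has_derivative_fst[OF has_derivative_ident] e[of "(0, 1)"]]]
      unfolding G_def[abs_def] by simp
  qed
  have Qd: "Q differentiable at ?g"
    unfolding Q_def
    by (rule differentiableI[OF compose_has_derivative]) (simp_all add: Gd unchart_differentiable)
  have ddQ: "dd Q (dd \<Phi> v (f q, q)) ?g = dd G v (f q, q)" for v
    unfolding Q_def using dd_compose[of G \<Psi> ?g] Gd unchart_differentiable by (simp add: dd_unchart)
  define \<alpha> where "\<alpha> = dd Q (E1 c s ?g) ?g"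
  define \<beta> where "\<beta> = dd Q (E2 c s ?g) ?g"
  have \<alpha>: "\<alpha> = dd f (0, 1) q"
    using ddQ[of "(1, 0, 0)"] ddG[of "(1, 0, 0)"] dd_chart_frame(1)[of "(f q, q)"]
      dd_linear(3)[OF c1_on_has_derivative[OF c2_on_dd[OF f] q, THEN differentiableI]]
    by (simp add: \<alpha>_def zero_prod_def)
  have \<beta>: "\<beta> = dd (dd f (1, 0)) (1, f q) q + f q * dd (dd f (0, 1)) (1, f q) q"
    using ddQ[of "(0, 1, f q)"] ddG[of "(0, 1, f q)"] dd_chart_frame(2)[of "(f q, q)"]
    by (simp add: \<beta>_def)
  have XQ: "dd Q (X1 ?g) ?g = c * \<alpha> - s * \<beta>" "dd Q (X2 ?g) ?g = s * \<alpha> + c * \<beta>"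
    unfolding X_eq_E \<alpha>_def \<beta>_def by (simp_all add: dd_linear[OF Qd] del: scaleR_minus_left)
  have Qg: "Q ?g = burgers f q" by (simp add: Q_def G_def burgers_def)
  define R where "R = sqrt (1 + (Q ?g)\<^sup>2)"
  have R0: "0 < R" and R2: "R * R = 1 + (Q ?g)\<^sup>2" by (auto simp: R_def add_pos_nonneg)
  \<comment> \<open>Both components of the normalized horizontal gradient have this shape; the
    numerator simplifies by \<open>R * R = 1 + (Q ?g)\<^sup>2\<close>.\<close>
  have quot: "dd (\<lambda>h. (m + n * Q h) / sqrt (1 + (Q h)\<^sup>2)) v ?g = (n - m * Q ?g) / R ^ 3 * dd Q v ?g" for m n v
  proof (rule dd_eqI)
    have "((\<lambda>z. (m + n * z) / sqrt (1 + z\<^sup>2)) has_real_derivative (n * R - (m + n * Q ?g) * (Q ?g / R)) / (R * R)) (at (Q ?g))"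
      unfolding R_def by (rule DERIV_affine_over_sqrt)
    moreover have "(n * R - (m + n * Q ?g) * (Q ?g / R)) / (R * R) = (n - m * Q ?g) / R ^ 3"
    proof -
      have "n * R - (m + n * Q ?g) * (Q ?g / R) = (n * (R * R) - (m + n * Q ?g) * Q ?g) / R"
        using R0 by (simp add: field_simps)
      also have "\<dots> = (n - m * Q ?g) / R" by (simp add: R2 power2_eq_square algebra_simps)
      finally show ?thesis by (simp add: power3_eq_cube)
    qed
    ultimately have "((\<lambda>z. (m + n * z) / sqrt (1 + z\<^sup>2)) has_derivative (*) ((n - m * Q ?g) / R ^ 3)) (at (Q ?g))"
      by (simp add: has_field_derivative_def)
    from has_derivative_compose[OF has_derivative_ddI[OF Qd] this]
    show "((\<lambda>h. (m + n * Q h) / sqrt (1 + (Q h)\<^sup>2)) has_derivative (\<lambda>v. (n - m * Q ?g) / R ^ 3 * dd Q v ?g)) (at ?g)" .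
  qed
  have U: "open ?U" by (rule open_tube[OF V])
  have 1: "vf_deriv X1 (\<lambda>h. vf_deriv X1 ?\<phi> h / heis_W ?\<phi> h) ?g = (s - c * Q ?g) / R ^ 3 * (c * \<alpha> - s * \<beta>)"
  proof -
    have "dd (\<lambda>h. vf_deriv X1 ?\<phi> h / heis_W ?\<phi> h) (X1 ?g) ?g = dd (\<lambda>h. (c + s * Q h) / sqrt (1 + (Q h)\<^sup>2)) (X1 ?g) ?g"
      by (rule dd_cong[OF U gU]) (simp add: X W)
    also have "\<dots> = (s - c * Q ?g) / R ^ 3 * (c * \<alpha> - s * \<beta>)" unfolding quot XQ ..
    finally show ?thesis unfolding vf_deriv_def dd_def[symmetric] .
  qed
  have 2: "vf_deriv X2 (\<lambda>h. vf_deriv X2 ?\<phi> h / heis_W ?\<phi> h) ?g = (- c - s * Q ?g) / R ^ 3 * (s * \<alpha> + c * \<beta>)"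
  proof -
    have "dd (\<lambda>h. vf_deriv X2 ?\<phi> h / heis_W ?\<phi> h) (X2 ?g) ?g = dd (\<lambda>h. (s + (- c) * Q h) / sqrt (1 + (Q h)\<^sup>2)) (X2 ?g) ?g"
      by (rule dd_cong[OF U gU]) (simp add: X W)
    also have "\<dots> = (- c - s * Q ?g) / R ^ 3 * (s * \<alpha> + c * \<beta>)" unfolding quot XQ ..
    finally show ?thesis unfolding vf_deriv_def dd_def[symmetric] .
  qed
  have "0 = ((s - c * Q ?g) * (c * \<alpha> - s * \<beta>) + (- c - s * Q ?g) * (s * \<alpha> + c * \<beta>)) / R ^ 3"
    using H0 unfolding H_mean_curvature_def 1 2 by (simp add: add_divide_distrib)
  also have "(s - c * Q ?g) * (c * \<alpha> - s * \<beta>) + (- c - s * Q ?g) * (s * \<alpha> + c * \<beta>) = - (c * c + s * s) * (Q ?g * \<alpha> + \<beta>)"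
    by (simp add: algebra_simps)
  finally have "Q ?g * \<alpha> + \<beta> = 0" using R0 by (simp add: cs)
  then show ?thesis
    unfolding dd_burgers[OF f q] \<alpha> \<beta> Qg burgers_eq[OF fd[OF q]] by (simp add: algebra_simps)
qed

text \<open>Gronwall in both directions of time: \<open>u s * exp (- K * s)\<close> decreases to the
  right of 0, and \<open>u s * exp (K * s)\<close> increases on the left of it.\<close>

lemma gronwall_zero:
  fixes u :: "real \<Rightarrow> real"
  assumes der: "\<And>s. a \<le> s \<Longrightarrow> s \<le> b \<Longrightarrow> (u has_real_derivative u' s) (at s)"
    and bound: "\<And>s. a \<le> s \<Longrightarrow> s \<le> b \<Longrightarrow> \<bar>u' s\<bar> \<le> K * u s"
    and nn: "\<And>s. 0 \<le> u s" and u0: "u 0 = 0" and ab: "a \<le> 0" "0 \<le> b" and s: "a \<le> s" "s \<le> b"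
  shows "u s = 0"
proof (cases "0 \<le> s")
  case True
  have "u s * exp (- K * s) \<le> u 0 * exp (- K * 0)"
  proof (rule DERIV_nonpos_imp_nonincreasing[OF True])
    fix x assume x: "0 \<le> x" "x \<le> s"
    then have "((\<lambda>s. u s * exp (- K * s)) has_real_derivative u' x * exp (- K * x) + u x * (exp (- K * x) * - K)) (at x)"
      using ab s by (auto intro!: derivative_eq_intros der)
    moreover have "u' x * exp (- K * x) + u x * (exp (- K * x) * - K) = (u' x - K * u x) * exp (- K * x)"
      by (simp add: algebra_simps)
    moreover have "u' x - K * u x \<le> 0" using bound[of x] x ab s by (simp add: abs_le_iff)
    ultimately show "\<exists>y. ((\<lambda>s. u s * exp (- K * s)) has_real_derivative y) (at x) \<and> y \<le> 0"
      by (metis exp_ge_zero mult_nonpos_nonneg)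
  qed
  then have "u s * exp (- K * s) \<le> 0" by (simp add: u0)
  then have "u s \<le> 0" by (simp add: mult_le_0_iff)
  then show ?thesis using nn[of s] by simp
next
  case False
  have "u s * exp (K * s) \<le> u 0 * exp (K * 0)"
  proof (rule DERIV_nonneg_imp_nondecreasing[of s 0 "\<lambda>s. u s * exp (K * s)"])
    fix x assume x: "s \<le> x" "x \<le> 0"
    then have "((\<lambda>s. u s * exp (K * s)) has_real_derivative u' x * exp (K * x) + u x * (exp (K * x) * K)) (at x)"
      using ab s by (auto intro!: derivative_eq_intros der)
    moreover have "u' x * exp (K * x) + u x * (exp (K * x) * K) = (u' x + K * u x) * exp (K * x)"
      by (simp add: algebra_simps)
    moreover have "0 \<le> u' x + K * u x" using bound[of x] x ab s by (simp add: abs_le_iff)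
    ultimately show "\<exists>y. ((\<lambda>s. u s * exp (K * s)) has_real_derivative y) (at x) \<and> 0 \<le> y"
      by (metis exp_ge_zero mult_nonneg_nonneg)
  qed (use False in simp)
  then have "u s * exp (K * s) \<le> 0" by (simp add: u0)
  then have "u s \<le> 0" by (simp add: mult_le_0_iff)
  then show ?thesis using nn[of s] by simp
qed

text \<open>A solution of the Burgers equation \<open>B\<^sub>y + f B\<^sub>\<tau> = 0\<close>, \<open>B = f\<^sub>y + f f\<^sub>\<tau>\<close>, is affine along parabolas, which
  are the horizontal lines of the surface; both differences below solve a linear system.\<close>

lemma straight_characteristics:
  assumes f: "c2_on V f" and burgers: "\<And>q. q \<in> V \<Longrightarrow> dd (burgers f) (1, f q) q = 0"
    and ab: "a \<le> 0" "0 \<le> b" and V: "\<And>s. a \<le> s \<Longrightarrow> s \<le> b \<Longrightarrow> (s, \<sigma> + x0 * s + G * s\<^sup>2 / 2) \<in> V"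
    and x0: "x0 = f (0, \<sigma>)" and G: "G = burgers f (0, \<sigma>)" and s: "a \<le> s" "s \<le> b"
  shows "f (s, \<sigma> + x0 * s + G * s\<^sup>2 / 2) = x0 + G * s \<and> burgers f (s, \<sigma> + x0 * s + G * s\<^sup>2 / 2) = G"
proof -
  define q where "q s = (s, \<sigma> + x0 * s + G * s\<^sup>2 / 2)" for s
  have qV: "q s \<in> V" if "a \<le> s" "s \<le> b" for s using V[OF that] by (simp add: q_def)
  have c1: "c1_on V f" "c1_on V (burgers f)" by (rule c2_on_c1[OF f], rule c1_burgers[OF f])
  have dq: "(q has_derivative (\<lambda>h. h *\<^sub>R (1, x0 + G * s))) (at s)" for s
    unfolding q_def by (auto intro!: derivative_eq_intros simp: algebra_simps)
  have along: "((\<lambda>s. F (q s)) has_real_derivative dd F (1, f (q s)) (q s) + (x0 + G * s - f (q s)) * dd F (0, 1) (q s)) (at s)"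
    if F: "c1_on V F" and s: "a \<le> s" "s \<le> b" for F s
  proof -
    have d: "F differentiable at (q s)" using F qV[OF s] by (auto simp: c1_on_def)
    have "((\<lambda>s. F (q s)) has_derivative (\<lambda>h. dd F (h *\<^sub>R (1, x0 + G * s)) (q s))) (at s)"
      by (rule has_derivative_compose[OF dq, where g = F and g' = "\<lambda>v. dd F v (q s)"]) (rule has_derivative_ddI[OF d])
    moreover have "(\<lambda>h. dd F (h *\<^sub>R (1, x0 + G * s)) (q s)) = (*) (dd F (1, x0 + G * s) (q s))"
      by (rule ext) (simp only: dd_linear(2)[OF d] real_scaleR_def mult.commute)
    moreover have "dd F (1, x0 + G * s) (q s) = dd F (1, f (q s)) (q s) + (x0 + G * s - f (q s)) * dd F (0, 1) (q s)"
    proof -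
      have "(1, x0 + G * s) = (1, f (q s)) + (x0 + G * s - f (q s)) *\<^sub>R (0, 1 :: real)" by simp
      then show ?thesis using dd_linear(1,2)[OF d] by (metis real_scaleR_def)
    qed
    ultimately show ?thesis by (simp only: has_field_derivative_def)
  qed
  \<comment> \<open>The parabola has direction \<open>(1, x0 + G * s)\<close> instead of
    \<open>(1, f)\<close>, an error of \<open>- h\<close> in the second component. Hence the linear
    system \<open>h' = e - h f\<^sub>\<tau>\<close>, \<open>e' = - h B\<^sub>\<tau>\<close> with
    zero initial values.\<close>
  define h where "h s = f (q s) - (x0 + G * s)" for s
  define e where "e s = burgers f (q s) - G" for s
  have dh: "(h has_real_derivative e s - h s * dd f (0, 1) (q s)) (at s)" if s: "a \<le> s" "s \<le> b" for s
  proof -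
    have d: "f differentiable at (q s)" using c1(1) qV[OF s] by (auto simp: c1_on_def)
    show ?thesis
      unfolding h_def[abs_def]
      by (rule derivative_eq_intros along[OF c1(1) s] refl)+
        (simp add: e_def burgers_eq[OF d] h_def algebra_simps)
  qed
  have de: "(e has_real_derivative - h s * dd (burgers f) (0, 1) (q s)) (at s)" if s: "a \<le> s" "s \<le> b" for s
    unfolding e_def[abs_def]
    by (rule derivative_eq_intros along[OF c1(2) s] refl)+
      (simp add: burgers[OF qV[OF s]] h_def algebra_simps)
  have cq: "continuous_on {a..b} q" unfolding q_def by (intro continuous_intros) auto
  have bd: "\<exists>C. \<forall>s\<in>{a..b}. \<bar>dd F (0, 1) (q s)\<bar> \<le> C" if F: "c1_on V F" for F :: "real \<times> real \<Rightarrow> real"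
  proof -
    have "continuous_on {a..b} (\<lambda>s. dd F (0, 1) (q s))"
      by (rule continuous_on_compose2[OF c1_on_continuous_dd[OF F] cq]) (use qV in auto)
    then have "bounded ((\<lambda>s. dd F (0, 1) (q s)) ` {a..b})"
      by (intro compact_imp_bounded compact_continuous_image) auto
    then obtain C where "\<forall>z\<in>(\<lambda>s. dd F (0, 1) (q s)) ` {a..b}. norm z \<le> C" unfolding bounded_iff by blast
    then show ?thesis by (intro exI[of _ C]) simp
  qed
  obtain C1 where C1: "\<And>s. s \<in> {a..b} \<Longrightarrow> \<bar>dd f (0, 1) (q s)\<bar> \<le> C1" using bd[OF c1(1)] by blast
  obtain C2 where C2: "\<And>s. s \<in> {a..b} \<Longrightarrow> \<bar>dd (burgers f) (0, 1) (q s)\<bar> \<le> C2" using bd[OF c1(2)] by blast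
  let ?u = "\<lambda>s. h s * h s + e s * e s"
  let ?u' = "\<lambda>s. 2 * h s * e s - 2 * (h s * h s) * dd f (0, 1) (q s) - 2 * (h s * e s) * dd (burgers f) (0, 1) (q s)"
  have "?u s = 0"
  proof (rule gronwall_zero[OF _ _ _ _ ab s])
    fix s assume s: "a \<le> s" "s \<le> b"
    show "(?u has_real_derivative ?u' s) (at s)"
      by (rule derivative_eq_intros dh[OF s] de[OF s] refl)+ (simp add: algebra_simps)
    have he: "\<bar>2 * (h s * e s)\<bar> \<le> ?u s"
      using sum_squares_bound[of "h s" "e s"] sum_squares_bound[of "h s" "- e s"]
      by (simp add: abs_le_iff power2_eq_square)
    have "\<bar>?u' s\<bar> \<le> \<bar>2 * (h s * e s)\<bar> + 2 * (h s * h s) * \<bar>dd f (0, 1) (q s)\<bar> + \<bar>2 * (h s * e s)\<bar> * \<bar>dd (burgers f) (0, 1) (q s)\<bar>"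
    proof -
      have "\<bar>A - B - D\<bar> \<le> \<bar>A\<bar> + \<bar>B\<bar> + \<bar>D\<bar>" for A B D :: real by linarith
      from this[of "2 * h s * e s" "2 * (h s * h s) * dd f (0, 1) (q s)" "2 * (h s * e s) * dd (burgers f) (0, 1) (q s)"]
      show ?thesis by (simp add: abs_mult)
    qed
    also have "\<dots> \<le> ?u s + 2 * ?u s * C1 + ?u s * C2"
      using he C1[of s] C2[of s] s by (intro add_mono mult_mono) auto
    finally show "\<bar>?u' s\<bar> \<le> (1 + 2 * C1 + C2) * ?u s" by (simp add: algebra_simps)
  qed (auto simp: h_def e_def q_def x0 G)
  then have "h s = 0 \<and> e s = 0" by (simp add: add_nonneg_eq_0_iff)
  then show ?thesis by (simp add: h_def e_def q_def)
qed

section \<open>The ruling of a minimal surface\<close>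

lemma c1_on_local:
  assumes "\<And>x. x \<in> V \<Longrightarrow> \<exists>A. open A \<and> x \<in> A \<and> c1_on A f"
  shows "c1_on V f"
  unfolding c1_on_def
proof (intro conjI ballI allI)
  fix x assume "x \<in> V"
  then obtain A where "x \<in> A" "c1_on A f" using assms by blast
  then show "f differentiable at x" unfolding c1_on_def by blast
next
  fix v
  show "continuous_on V (dd f v)"
  proof (rule continuous_at_imp_continuous_on, rule ballI)
    fix x assume "x \<in> V"
    then obtain A where A: "open A" "x \<in> A" "c1_on A f" using assms by blast
    from c1_on_continuous_dd[OF A(3)] show "isCont (dd f v) x"
      using A(1,2) continuous_on_eq_continuous_at by blast
  qed
qed

lemma c2_on_local:
  assumes "\<And>x. x \<in> V \<Longrightarrow> \<exists>A. open A \<and> x \<in> A \<and> c2_on A f"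
  shows "c2_on V f"
  unfolding c2_on_def
proof (intro conjI ballI allI)
  fix x assume "x \<in> V"
  then obtain A where "x \<in> A" "c2_on A f" using assms by blast
  then show "f differentiable at x" unfolding c2_on_def by blast
next
  show "c1_on V (dd f v)" for v
  proof (rule c1_on_local)
    fix x assume "x \<in> V"
    then obtain A where "open A" "x \<in> A" "c2_on A f" using assms by blast
    then show "\<exists>A. open A \<and> x \<in> A \<and> c1_on A (dd f v)" using c2_on_dd by blast
  qed
qed

context heis_chart
begin

lemma patchD:
  assumes "patch S x0 r V f"
  shows "open V" "c2_on V f" "\<And>q. q \<in> V \<Longrightarrow> \<bar>f q - x0\<bar> < r"
    "\<And>q x. q \<in> V \<Longrightarrow> \<bar>x - x0\<bar> < r \<Longrightarrow> \<Phi> (x, q) \<in> S \<longleftrightarrow> x = f q"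
    "\<And>q. q \<in> V \<Longrightarrow> \<Phi> (f q, q) \<in> S"
    "\<And>q. q \<in> V \<Longrightarrow> f differentiable at q"
proof -
  show V: "open V" and f: "c2_on V f" and a: "\<And>q. q \<in> V \<Longrightarrow> \<bar>f q - x0\<bar> < r"
    and b: "\<And>q x. q \<in> V \<Longrightarrow> \<bar>x - x0\<bar> < r \<Longrightarrow> \<Phi> (x, q) \<in> S \<longleftrightarrow> x = f q"
    using assms unfolding patch_def by blast+
  show "\<And>q. q \<in> V \<Longrightarrow> \<Phi> (f q, q) \<in> S" using a b by blast
  show "\<And>q. q \<in> V \<Longrightarrow> f differentiable at q" using f unfolding c2_on_def by blast
qed

text \<open>The images of the directions \<open>(1, f q)\<close> and \<open>(0, 1)\<close> are
  tangent to the graph: they are \<open>burgers f q\<close> times \<open>E1\<close> plus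
  \<open>E2\<close>, which is horizontal, and the \<tau>-derivative of \<open>f\<close> times
  \<open>E1\<close> plus T. So T itself is tangent exactly where that derivative vanishes.\<close>

lemma patch_tangent:
  assumes P: "patch S x0 r V f" and def: "defining_function S U \<phi>" and q: "q \<in> V" and U: "\<Phi> (f q, q) \<in> U"
  shows "burgers f q * dd \<phi> (E1 c s (\<Phi> (f q, q))) (\<Phi> (f q, q)) + dd \<phi> (E2 c s (\<Phi> (f q, q))) (\<Phi> (f q, q)) = 0"
    "dd f (0, 1) q * dd \<phi> (E1 c s (\<Phi> (f q, q))) (\<Phi> (f q, q)) + dd \<phi> (0, 0, 1) (\<Phi> (f q, q)) = 0"
proof -
  note p = patchD[OF P] and \<phi> = defining_functionD[OF def]
  let ?g = "\<Phi> (f q, q)"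
  have fd: "f differentiable at q" by (rule p(6)[OF q])
  have \<phi>d: "\<phi> differentiable at ?g" using \<phi>(2) U unfolding c2_on_def by blast
  have d1: "((\<lambda>q. (f q, q)) has_derivative (\<lambda>w. (dd f w q, w))) (at q)"
    by (intro has_derivative_Pair has_derivative_ddI[OF fd] has_derivative_ident)
  have d2: "((\<lambda>q. \<Phi> (f q, q)) has_derivative (\<lambda>w. dd \<Phi> (dd f w q, w) (f q, q))) (at q)"
    by (rule has_derivative_compose[OF d1, where g = \<Phi> and g' = "\<lambda>v. dd \<Phi> v (f q, q)"])
      (rule has_derivative_ddI[OF chart_differentiable])
  have d3: "((\<lambda>q. \<phi> (\<Phi> (f q, q))) has_derivative (\<lambda>w. dd \<phi> (dd \<Phi> (dd f w q, w) (f q, q)) ?g)) (at q)"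
    by (rule has_derivative_compose[OF d2, where g = \<phi> and g' = "\<lambda>v. dd \<phi> v ?g"]) (rule has_derivative_ddI[OF \<phi>d])
  have "isCont (\<lambda>q. \<Phi> (f q, q)) q" using d2 has_derivative_continuous by blast
  then have "\<forall>\<^sub>F q' in nhds q. \<Phi> (f q', q') \<in> U"
    using \<phi>(1) U by (simp add: continuous_at topological_tendstoD isCont_def eventually_nhds_conv_at)
  moreover have "\<forall>\<^sub>F q' in nhds q. q' \<in> V" by (rule eventually_nhds_in_open[OF p(1) q])
  ultimately have "\<forall>\<^sub>F q' in nhds q. \<phi> (\<Phi> (f q', q')) = 0"
  proof eventually_elim
    case (elim q')
    then show ?case using p(5)[of q'] \<phi>(3) by blast
  qed
  note z = derivative_eq_0_if_eventually_0[OF this d3]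
  have "dd \<Phi> (dd f (1, f q) q, (1, f q)) (f q, q) = burgers f q *\<^sub>R E1 c s ?g + E2 c s ?g"
    by (simp add: dd_chart burgers_eq[OF fd] flip: zero_prod_def)
  then have "dd \<phi> (burgers f q *\<^sub>R E1 c s ?g + E2 c s ?g) ?g = 0" using z[of "(1, f q)"] by simp
  then show "burgers f q * dd \<phi> (E1 c s ?g) ?g + dd \<phi> (E2 c s ?g) ?g = 0"
    by (simp only: dd_linear[OF \<phi>d] real_scaleR_def)
  have "dd \<Phi> (dd f (0, 1) q, (0, 1)) (f q, q) = dd f (0, 1) q *\<^sub>R E1 c s ?g + (0, 0, 1)"
    by (simp add: dd_chart flip: zero_prod_def)
  then have "dd \<phi> (dd f (0, 1) q *\<^sub>R E1 c s ?g + (0, 0, 1)) ?g = 0" using z[of "(0, 1)"] by simp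
  then show "dd f (0, 1) q * dd \<phi> (E1 c s ?g) ?g + dd \<phi> (0, 0, 1) ?g = 0"
    by (simp only: dd_linear[OF \<phi>d] real_scaleR_def)
qed

lemma transversal:
  assumes char: "char_locus S = {}" and def: "defining_function S U \<phi>" and g: "g \<in> S" "g \<in> U"
    and t: "dd \<phi> (E2 c s g) g = 0"
  shows "dd \<phi> (E1 c s g) g \<noteq> 0"
proof
  assume z: "dd \<phi> (E1 c s g) g = 0"
  have \<phi>d: "\<phi> differentiable at g" using defining_functionD(2)[OF def] g unfolding c2_on_def by blast
  have "dd \<phi> (X1 g) g = 0" "dd \<phi> (X2 g) g = 0"
    unfolding X_eq_E by (simp_all only: dd_linear[OF \<phi>d] z t) simp_all
  then show False using noncharacteristic[OF char def g] by blast
qed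

lemma chart_0: "\<Phi> (0, 0) = g0" "\<Phi> (0, (0, 0)) = g0"
  using chart_line[of 0 0] by (simp_all add: zero_prod_def)

text \<open>If \<open>E2\<close> is tangent at the base point, then \<open>f\<close> and
  \<open>burgers f\<close> vanish at the origin, and the characteristic parabola through it
  degenerates to the \<open>y\<close>-axis.\<close>

lemma line_locally_in_surface:
  assumes char: "char_locus S = {}" and H: "H_minimal S" and def: "defining_function S U \<phi>"
    and g: "g0 \<in> S" "g0 \<in> U" and t: "dd \<phi> (E2 c s g0) g0 = 0"
  shows "\<exists>e>0. \<forall>y. \<bar>y\<bar> < e \<longrightarrow> g0 + y *\<^sub>R E2 c s g0 \<in> S"
proof -
  have nz: "dd \<phi> (E1 c s g0) g0 \<noteq> 0" by (rule transversal[OF char def g t])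
  obtain r d f where rd: "0 < r" "0 < d" and P: "patch S 0 r (ball (0, 0) d) f"
    by (rule patch_exists[OF def, of 0 "(0, 0)"]) (use g nz chart_0 in auto)
  note p = patchD[OF P]
  have q0: "(0, 0) \<in> ball (0, 0) d" using rd by simp
  have f0: "f (0, 0) = 0" using p(4)[OF q0, of 0] rd g chart_0 by simp
  have B0: "burgers f (0, 0) = 0"
    using patch_tangent(1)[OF P def q0] g t nz by (simp add: f0 chart_0)
  have "g0 + y *\<^sub>R E2 c s g0 \<in> S" if y: "\<bar>y\<bar> < d" for y
  proof -
    have V: "(z, 0 + 0 * z + 0 * z\<^sup>2 / 2) \<in> ball (0, 0) d" if "- \<bar>y\<bar> \<le> z" "z \<le> \<bar>y\<bar>" for z
      using that y by (simp add: dist_Pair_Pair dist_real_def)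
    have yy: "- \<bar>y\<bar> \<le> y" "y \<le> \<bar>y\<bar>" "- \<bar>y\<bar> \<le> 0" "0 \<le> \<bar>y\<bar>" by auto
    have "f (y, 0 + 0 * y + 0 * y\<^sup>2 / 2) = 0 + 0 * y \<and> burgers f (y, 0 + 0 * y + 0 * y\<^sup>2 / 2) = 0"
      by (rule straight_characteristics[OF p(2) patch_burgers[OF P H] yy(3,4) V _ _ yy(1,2)])
        (auto simp: f0 B0)
    then have "f (y, 0) = 0" by simp
    moreover have "(y, 0 :: real) \<in> ball (0, 0) d" using V[of y] yy by simp
    ultimately have "\<Phi> (0, (y, 0)) \<in> S" using p(5) by metis
    then show ?thesis by (simp add: chart_line flip: zero_prod_def)
  qed
  then show ?thesis using rd by blast
qed

end

text \<open>The set of parameters near which the line stays in \<open>S\<close> is open and closed.\<close>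

lemma line_in_surface:
  assumes cs: "c * c + s * s = (1::real)" and cl: "closed S" and surf: "C2_surface S"
    and char: "char_locus S = {}" and H: "H_minimal S" and def: "defining_function S U \<phi>"
    and g: "g \<in> S" "g \<in> U" and t: "dd \<phi> (E2 c s g) g = 0"
  shows "g + y *\<^sub>R E2 c s g \<in> S"
proof -
  let ?l = "\<lambda>y. g + y *\<^sub>R E2 c s g"
  have E2l: "E2 c s (?l y) = E2 c s g" for y
  proof -
    interpret heis_chart g c s by unfold_locales (rule cs)
    show ?thesis by (rule E2_line)
  qed
  \<comment> \<open>The interior is taken so that a whole segment around each parameter lies in
    \<open>S\<close> and the direction is tangent there. Tangency passes to limit points by
    continuity, and it is all that is needed to restart the local argument.\<close>
  define C where "C = interior {y. ?l y \<in> S}"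
  have inC: "y \<in> C" if gS: "?l y \<in> S" and def': "defining_function S U' \<phi>'" "?l y \<in> U'"
    and t': "dd \<phi>' (E2 c s g) (?l y) = 0" for y U' \<phi>'
  proof -
    interpret heis_chart "?l y" c s by unfold_locales (rule cs)
    obtain e where e: "0 < e" "\<And>z. \<bar>z\<bar> < e \<Longrightarrow> ?l y + z *\<^sub>R E2 c s g \<in> S"
      using line_locally_in_surface[OF char H def'(1) gS def'(2)] t' unfolding E2l by blast
    have "ball y e \<subseteq> {y. ?l y \<in> S}"
    proof
      fix z assume "z \<in> ball y e"
      then have "\<bar>z - y\<bar> < e" by (simp add: dist_real_def abs_minus_commute)
      from e(2)[OF this] show "z \<in> {y. ?l y \<in> S}" by (simp add: add.assoc flip: scaleR_add_left)
    qed
    then show ?thesis unfolding C_def using e(1) by (meson centre_in_ball interiorI open_ball)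
  qed
  have "0 \<in> C" using inC[of 0 U \<phi>] def g t by simp
  moreover have "open C" by (simp add: C_def)
  moreover have "closed C"
    unfolding closed_limpt
  proof (intro allI impI)
    fix y assume y: "y islimpt C"
    have clS: "closed {y. ?l y \<in> S}"
      using closed_vimage[OF cl, of ?l] by (simp add: vimage_def continuous_intros)
    have "y islimpt {y. ?l y \<in> S}"
      using y interior_subset unfolding C_def by (rule islimpt_subset)
    then have yS: "?l y \<in> S" using clS unfolding closed_limpt by blast
    obtain U' \<phi>' where U': "?l y \<in> U'" and def': "defining_function S U' \<phi>'"
      using surf yS unfolding C2_surface_def by blast
    note \<phi> = defining_functionD[OF def']
    define W where "W = ?l -` U'"
    have oW: "open W" unfolding W_def by (rule open_vimage[OF \<phi>(1)]) (intro continuous_intros)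
    define k where "k z = dd \<phi>' (E2 c s g) (?l z)" for z
    have ck: "continuous_on W k"
      unfolding k_def by (rule continuous_on_compose2[OF c1_on_continuous_dd[OF c2_on_c1[OF \<phi>(2)]]])
        (auto intro!: continuous_intros simp: W_def)
    have k0: "k z = 0" if z: "z \<in> C" "z \<in> W" for z
    proof -
      have \<phi>d: "\<phi>' differentiable at (?l z)" using \<phi>(2) z unfolding c2_on_def W_def by blast
      have dl: "(?l has_derivative (\<lambda>h. h *\<^sub>R E2 c s g)) (at z)" by (auto intro!: derivative_eq_intros)
      have d: "((\<lambda>z. \<phi>' (?l z)) has_derivative (\<lambda>h. dd \<phi>' (h *\<^sub>R E2 c s g) (?l z))) (at z)"
        by (rule has_derivative_compose[OF dl, where g = \<phi>' and g' = "\<lambda>v. dd \<phi>' v (?l z)"]) (rule has_derivative_ddI[OF \<phi>d])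
      have "\<forall>\<^sub>F z in nhds z. z \<in> C \<inter> W"
        by (rule eventually_nhds_in_open) (use oW z in \<open>auto simp: C_def\<close>)
      then have "\<forall>\<^sub>F z in nhds z. \<phi>' (?l z) = 0"
      proof eventually_elim
        case (elim z)
        then have "?l z \<in> S" "?l z \<in> U'" using interior_subset unfolding C_def W_def by auto
        then show ?case using \<phi>(3) by blast
      qed
      from derivative_eq_0_if_eventually_0[OF this d, of 1] show ?thesis by (simp add: k_def)
    qed
    have "k y = 0"
    proof (rule ccontr)
      assume "k y \<noteq> 0"
      have "open (W \<inter> k -` (- {0}))"
        using continuous_on_open_vimage[OF oW] ck by (metis Int_commute open_Compl closed_singleton)
      moreover have "y \<in> W \<inter> k -` (- {0})" using \<open>k y \<noteq> 0\<close> U' by (simp add: W_def)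
      ultimately obtain z where "z \<in> C" "z \<in> W \<inter> k -` (- {0})"
        using y[unfolded islimpt_def, rule_format, of "W \<inter> k -` (- {0})"] by blast
      then show False using k0 by blast
    qed
    then show "y \<in> C" using inC[OF yS def' U'] by (simp add: k_def)
  qed
  ultimately have "C = UNIV" using clopen[of C] by blast
  then show ?thesis using interior_subset unfolding C_def by blast
qed

section \<open>A neighbourhood of one complete ruling line\<close>

locale ruled_strip = heis_chart +
  fixes S :: "heis set"
  assumes surf: "C2_surface S" and char: "char_locus S = {}" and H: "H_minimal S"
    and line: "\<And>y. \<Phi> (0, (y, 0)) \<in> S"
begin

lemma patch_zero_section:
  assumes P: "patch S 0 r V f" and q: "(y, 0) \<in> V"
  shows "f (y, 0) = 0" "dd f (1, 0) (y, 0) = 0" "burgers f (y, 0) = 0"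
proof -
  note p = patchD[OF P]
  have z: "f (y, 0) = 0" if "(y, 0) \<in> V" for y
    using p(4)[OF that, of 0] p(3)[OF that] line[of y] by auto
  then show f0: "f (y, 0) = 0" using q by blast
  have "((\<lambda>y. (y, 0 :: real)) has_derivative (\<lambda>h. (h, 0))) (at y)" by (auto intro!: derivative_eq_intros)
  then have d: "((\<lambda>y. f (y, 0)) has_derivative (\<lambda>h. dd f (h, 0) (y, 0))) (at y)"
    by (rule has_derivative_compose[where g = f and g' = "\<lambda>v. dd f v (y, 0)"]) (rule has_derivative_ddI[OF p(6)[OF q]])
  have "open ((\<lambda>y. (y, 0 :: real)) -` V)" by (rule open_vimage[OF p(1)]) (intro continuous_intros)
  from eventually_nhds_in_open[OF this, of y] have "\<forall>\<^sub>F y in nhds y. f (y, 0) = 0"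
    using q by (auto elim!: eventually_mono simp: z)
  from derivative_eq_0_if_eventually_0[OF this d] show "dd f (1, 0) (y, 0) = 0" .
  then show "burgers f (y, 0) = 0" by (simp add: burgers_def f0)
qed

lemma patch_at_line:
  obtains r d f where "0 < r" "0 < d" "patch S 0 r (ball (y, 0) d) f"
proof -
  let ?g = "\<Phi> (0, (y, 0))"
  obtain U \<phi> where U: "?g \<in> U" and def: "defining_function S U \<phi>"
    using surf line[of y] unfolding C2_surface_def by blast
  note \<phi> = defining_functionD[OF def]
  have \<phi>d: "\<phi> differentiable at ?g" using \<phi>(2) U unfolding c2_on_def by blast
  have "((\<lambda>y. (0, (y, 0)) :: heis) has_derivative (\<lambda>h. (0, (h, 0)))) (at y)" by (auto intro!: derivative_eq_intros)
  then have d1: "((\<lambda>y. \<Phi> (0, (y, 0))) has_derivative (\<lambda>h. dd \<Phi> (0, (h, 0)) (0, (y, 0)))) (at y)"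
    by (rule has_derivative_compose[where g = \<Phi> and g' = "\<lambda>v. dd \<Phi> v (0, (y, 0))"]) (rule has_derivative_ddI[OF chart_differentiable])
  have d2: "((\<lambda>y. \<phi> (\<Phi> (0, (y, 0)))) has_derivative (\<lambda>h. dd \<phi> (dd \<Phi> (0, (h, 0)) (0, (y, 0))) ?g)) (at y)"
    by (rule has_derivative_compose[OF d1, where g = \<phi> and g' = "\<lambda>v. dd \<phi> v ?g"]) (rule has_derivative_ddI[OF \<phi>d])
  have "open ((\<lambda>y. \<Phi> (0, (y, 0))) -` U)"
    by (rule open_vimage[OF \<phi>(1)]) (intro continuous_on_compose2[OF cont_chart[of UNIV]] continuous_intros, auto)
  from eventually_nhds_in_open[OF this, of y] U
  have "\<forall>\<^sub>F y in nhds y. y \<in> (\<lambda>y. \<Phi> (0, (y, 0))) -` U" by simp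
  then have "\<forall>\<^sub>F y in nhds y. \<phi> (\<Phi> (0, (y, 0))) = 0"
  proof eventually_elim
    case (elim z)
    then show ?case using \<phi>(3)[of "\<Phi> (0, (z, 0))"] line[of z] by simp
  qed
  from derivative_eq_0_if_eventually_0[OF this d2, of 1] have "dd \<phi> (E2 c s ?g) ?g = 0"
    using dd_chart_frame(2)[of "(0, (y, 0))"] by simp
  then have nz: "dd \<phi> (E1 c s ?g) ?g \<noteq> 0" by (rule transversal[OF char def line U])
  show ?thesis by (rule patch_exists[OF def line U nz]) (rule that)
qed

text \<open>Compactness of a segment of the axis gives finitely many patches. The function on the
  strip is defined from \<open>S\<close> itself, as the only point of the surface within the common
  radius \<open>R\<close>, so the local functions need no compatibility check. The length
  \<open>M\<close> is arbitrary; long test functions depend on this.\<close>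

lemma tube_exists:
  assumes "0 < M"
  obtains r \<epsilon> f where "0 < r" "0 < \<epsilon>" "patch S 0 r ({-M<..<M} \<times> {-\<epsilon><..<\<epsilon>}) f"
proof -
  have "\<exists>r d f. 0 < r \<and> 0 < d \<and> patch S 0 r (ball (y, 0) d) f" for y
    by (rule patch_at_line[of y]) blast
  then obtain r d f where rd: "\<And>y. 0 < r y" "\<And>y. 0 < d y" "\<And>y. patch S 0 (r y) (ball (y, 0) (d y)) (f y)"
    by metis
  let ?K = "{-M..M} \<times> {0 :: real}"
  have "compact ?K" by (intro compact_Times) auto
  moreover have "?K \<subseteq> (\<Union>y\<in>{-M..M}. ball (y, 0) (d y))" using rd(2) by force
  ultimately obtain F where F: "finite F" "F \<subseteq> {-M..M}" "?K \<subseteq> (\<Union>y\<in>F. ball (y, 0) (d y))"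
    by (elim compactE_image) auto
  have "F \<noteq> {}" using F(3) assms by force
  define R where "R = Min (r ` F)"
  have R: "0 < R" "\<And>y. y \<in> F \<Longrightarrow> R \<le> r y" using F(1) \<open>F \<noteq> {}\<close> rd(1) by (auto simp: R_def)
  \<comment> \<open>The patches have different radii. Each is restricted to where its function stays
    below the common radius; the axis remains covered because all these functions vanish on
    it.\<close>
  define A where "A y = ball (y, 0) (d y) \<inter> (\<lambda>q. \<bar>f y q\<bar>) -` {..<R}" for y
  have oA: "open (A y)" for y
  proof -
    have "continuous_on (ball (y, 0) (d y)) (\<lambda>q. \<bar>f y q\<bar>)"
      by (intro continuous_on_rabs c1_on_continuous c2_on_c1 patchD(2)[OF rd(3)])
    then show ?thesis unfolding A_def by (metis Int_commute continuous_on_open_vimage open_ball open_lessThan)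
  qed
  have "?K \<subseteq> (\<Union>y\<in>F. A y)"
  proof
    fix q assume "q \<in> ?K"
    then have "q \<in> (\<Union>y\<in>F. ball (y, 0) (d y))" "snd q = 0" using subsetD[OF F(3)] by (blast, auto)
    then obtain z y where q: "q = (z, 0)" "y \<in> F" "(z, 0 :: real) \<in> ball (y, 0) (d y)" by (cases q) auto
    have "f y (z, 0) = 0" by (rule patch_zero_section(1)[OF rd(3) q(3)])
    then show "q \<in> (\<Union>y\<in>F. A y)" using q R(1) unfolding A_def by auto
  qed
  moreover have "open (\<Union>y\<in>F. A y)" using oA by blast
  ultimately obtain \<epsilon> where \<epsilon>: "0 < \<epsilon>" "(\<Union>q\<in>?K. ball q \<epsilon>) \<subseteq> (\<Union>y\<in>F. A y)"
    using compact_subset_open_imp_ball_epsilon_subset[OF \<open>compact ?K\<close>] by metis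
  let ?V = "{-M<..<M} \<times> {-\<epsilon><..<\<epsilon>}"
  have VA: "\<exists>y\<in>F. q \<in> A y" if "q \<in> ?V" for q
  proof -
    have "q \<in> ball (fst q, 0) \<epsilon>" using that by (cases q) (auto simp: dist_Pair_Pair dist_real_def)
    moreover have "(fst q, 0) \<in> ?K" using that by auto
    ultimately show ?thesis using \<epsilon>(2) by blast
  qed
  have onA: "\<bar>f y q - 0\<bar> < R" "\<And>x. \<bar>x - 0\<bar> < R \<Longrightarrow> \<Phi> (x, q) \<in> S \<longleftrightarrow> x = f y q" if "y \<in> F" "q \<in> A y" for y q
  proof -
    show "\<bar>f y q - 0\<bar> < R" using that by (simp add: A_def)
    fix x assume "\<bar>x - 0\<bar> < R"
    then have "\<bar>x - 0\<bar> < r y" using R(2)[OF that(1)] by simp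
    moreover have "q \<in> ball (y, 0) (d y)" using that by (simp add: A_def)
    ultimately show "\<Phi> (x, q) \<in> S \<longleftrightarrow> x = f y q" using patchD(4)[OF rd(3)] by blast
  qed
  define h where "h q = (THE x. \<bar>x - 0\<bar> < R \<and> \<Phi> (x, q) \<in> S)" for q
  have h: "h q = f y q" if "y \<in> F" "q \<in> A y" for y q
    unfolding h_def by (rule the_equality) (use onA[OF that] in auto)
  have "patch S 0 R ?V h"
    unfolding patch_def
  proof (intro conjI ballI allI impI)
    show "open ?V" by (intro open_Times) auto
    show "c2_on ?V h"
    proof (rule c2_on_local)
      fix q assume "q \<in> ?V"
      then obtain y where y: "y \<in> F" "q \<in> A y" using VA by blast
      have "c2_on (A y) (f y)" by (rule c2_on_subset[OF patchD(2)[OF rd(3)[of y]]]) (auto simp: A_def)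
      then have "c2_on (A y) h" by (rule c2_on_cong[OF oA, rotated]) (simp add: h[OF y(1)])
      then show "\<exists>A. open A \<and> q \<in> A \<and> c2_on A h" using oA y by blast
    qed
  next
    fix q assume "q \<in> ?V"
    then obtain y where y: "y \<in> F" "q \<in> A y" using VA by blast
    show "\<bar>h q - 0\<bar> < R" using onA(1)[OF y] h[OF y] by simp
    fix x assume "\<bar>x - 0\<bar> < R"
    then show "\<Phi> (x, q) \<in> S \<longleftrightarrow> x = h q" using onA(2)[OF y] h[OF y] by simp
  qed
  then show ?thesis using that R \<epsilon> by blast
qed

lemma patch_unique_near_0:
  assumes P: "patch S 0 r V f" "patch S 0 r' V' f'" and V: "(0, 0) \<in> V" "(0, 0) \<in> V'"
  obtains A where "open A" "(0, 0) \<in> A" "\<And>q. q \<in> A \<Longrightarrow> f q = f' q"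
proof -
  note p = patchD[OF P(1)] and p' = patchD[OF P(2)]
  let ?A = "V \<inter> (\<lambda>q. \<bar>f q\<bar>) -` {..<r'}"
  have "continuous_on V (\<lambda>q. \<bar>f q\<bar>)" by (intro continuous_on_rabs c1_on_continuous c2_on_c1 p)
  then have "open ?A" using p(1) by (metis Int_commute continuous_on_open_vimage open_lessThan)
  then have "open (?A \<inter> V')" using p'(1) by blast
  moreover have "(0, 0) \<in> ?A \<inter> V'"
    using V patch_zero_section(1)[OF P(1) V(1)] p'(3)[OF V(2)] by auto
  moreover have "f q = f' q" if "q \<in> ?A \<inter> V'" for q
    using p(5)[of q] p'(4)[of q "f q"] that by auto
  ultimately show ?thesis using that by blast
qed

text \<open>The coefficients \<open>m\<close> and \<open>n\<close> thus belong to the surface and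
  not to the patch, and may be carried over to strips of any length.\<close>

lemma patch_jet_unique:
  assumes P: "patch S 0 r V f" "patch S 0 r' V' f'" and V: "(0, 0) \<in> V" "(0, 0) \<in> V'"
  shows "dd f v (0, 0) = dd f' v (0, 0)" "dd (burgers f) v (0, 0) = dd (burgers f') v (0, 0)"
proof -
  obtain A where A: "open A" "(0, 0) \<in> A" "\<And>q. q \<in> A \<Longrightarrow> f q = f' q"
    by (rule patch_unique_near_0[OF P V]) (rule that)
  have d: "dd f v q = dd f' v q" if "q \<in> A" for q v by (rule dd_cong[OF A(1) that A(3)])
  then show "dd f v (0, 0) = dd f' v (0, 0)" using A by blast
  have "burgers f q = burgers f' q" if "q \<in> A" for q using d[OF that] A(3)[OF that] by (simp add: burgers_def)
  then show "dd (burgers f) v (0, 0) = dd (burgers f') v (0, 0)" by (rule dd_cong[OF A(1,2)])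
qed

text \<open>The characteristic starting at \<open>(0, \<sigma>)\<close> is the parabola
  \<open>\<tau> \<sigma>\<close>, along which \<open>burgers f\<close> keeps its initial value and
  \<open>f\<close> is affine. Both identities are differentiated in \<sigma> at 0. The factor
  \<open>1 + m * y + n * y\<^sup>2 / 2\<close> is the derivative of the parabolas in \<sigma>: it
  measures how neighbouring ruling lines spread.\<close>

lemma coefficients:
  assumes P: "patch S 0 r ({-M<..<M} \<times> {-\<epsilon><..<\<epsilon>}) f" and M: "0 < M" "0 < \<epsilon>" and y: "\<bar>y\<bar> < M"
    and m: "m = dd f (0, 1) (0, 0)" and n: "n = dd (burgers f) (0, 1) (0, 0)"
  shows "dd f (0, 1) (y, 0) * (1 + m * y + n * y\<^sup>2 / 2) = m + n * y"
    "dd (burgers f) (0, 1) (y, 0) * (1 + m * y + n * y\<^sup>2 / 2) = n"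
proof -
  let ?V = "{-M<..<M} \<times> {-\<epsilon><..<\<epsilon>}"
  note p = patchD[OF P]
  have o: "(0, 0) \<in> ?V" using M by auto
  have yV: "(y, 0) \<in> ?V" using M y by (auto simp: abs_less_iff)
  define a where "a \<sigma> = f (0, \<sigma>)" for \<sigma>
  define G where "G \<sigma> = burgers f (0, \<sigma>)" for \<sigma>
  have Bc1: "c1_on ?V (burgers f)" by (rule c1_burgers[OF p(2)])
  have fc1: "c1_on ?V f" by (rule c2_on_c1[OF p(2)])
  have a0: "a 0 = 0" "G 0 = 0" using patch_zero_section[OF P o] by (simp_all add: a_def G_def)
  have dsec: "((\<lambda>\<sigma>. F (0, \<sigma>)) has_real_derivative dd F (0, 1) (0, 0)) (at 0)" if F: "c1_on ?V F" for F
  proof -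
    have Fd: "F differentiable at (0, 0)" using F o unfolding c1_on_def by blast
    have "((\<lambda>\<sigma>. (0 :: real, \<sigma>)) has_derivative (\<lambda>h. (0, h))) (at 0)" by (auto intro!: derivative_eq_intros)
    then have "((\<lambda>\<sigma>. F (0, \<sigma>)) has_derivative (\<lambda>h. dd F (0, h) (0, 0))) (at 0)"
      by (rule has_derivative_compose[where g = F and g' = "\<lambda>v. dd F v (0, 0)"]) (rule has_derivative_ddI[OF Fd])
    moreover have "(\<lambda>h. dd F (0, h) (0, 0)) = (*) (dd F (0, 1) (0, 0))"
    proof
      fix h
      show "dd F (0, h) (0, 0) = dd F (0, 1) (0, 0) * h"
        using dd_linear(2)[OF Fd, of h "(0, 1)"] by simp
    qed
    ultimately show ?thesis by (simp only: has_field_derivative_def)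
  qed
  have da: "(a has_real_derivative m) (at 0)" unfolding a_def[abs_def] m by (rule dsec[OF fc1])
  have dG: "(G has_real_derivative n) (at 0)" unfolding G_def[abs_def] n by (rule dsec[OF Bc1])
  define \<tau> where "\<tau> \<sigma> z = \<sigma> + a \<sigma> * z + G \<sigma> * z\<^sup>2 / 2" for \<sigma> z
  \<comment> \<open>Bounds the height of the parabola on the whole way from 0 to \<open>y\<close>;
    as it tends to 0 with \<sigma>, the parabola stays inside the strip.\<close>
  define T where "T \<sigma> = \<bar>\<sigma>\<bar> + \<bar>a \<sigma>\<bar> * \<bar>y\<bar> + \<bar>G \<sigma>\<bar> * y\<^sup>2 / 2" for \<sigma>
  have "isCont T 0"
    unfolding T_def using DERIV_isCont[OF da] DERIV_isCont[OF dG] by (intro continuous_intros) auto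
  then have "(T \<longlongrightarrow> 0) (nhds 0)" using a0 tendsto_at_iff_tendsto_nhds[of T 0] by (simp add: isCont_def T_def)
  then have "\<forall>\<^sub>F \<sigma> in nhds 0. T \<sigma> < \<epsilon>" by (rule order_tendstoD(2)) (rule M)
  then have ev: "\<forall>\<^sub>F \<sigma> in nhds 0. f (y, \<tau> \<sigma> y) = a \<sigma> + G \<sigma> * y \<and> burgers f (y, \<tau> \<sigma> y) = G \<sigma>"
  proof eventually_elim
    case (elim \<sigma>)
    have V: "(z, \<sigma> + a \<sigma> * z + G \<sigma> * z\<^sup>2 / 2) \<in> ?V" if "- \<bar>y\<bar> \<le> z" "z \<le> \<bar>y\<bar>" for z
    proof -
      have z: "\<bar>z\<bar> \<le> \<bar>y\<bar>" using that by (simp add: abs_le_iff)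
      then have z2: "z\<^sup>2 \<le> y\<^sup>2" by (rule abs_le_square_iff[THEN iffD1])
      have "\<bar>\<sigma> + a \<sigma> * z + G \<sigma> * z\<^sup>2 / 2\<bar> \<le> \<bar>\<sigma>\<bar> + \<bar>a \<sigma> * z\<bar> + \<bar>G \<sigma> * z\<^sup>2 / 2\<bar>" by linarith
      also have "\<dots> \<le> T \<sigma>"
        unfolding T_def abs_mult using z z2 by (intro add_mono mult_left_mono) (auto simp: abs_mult intro!: mult_left_mono)
      finally have "\<bar>\<sigma> + a \<sigma> * z + G \<sigma> * z\<^sup>2 / 2\<bar> < \<epsilon>" using elim by simp
      moreover have "\<bar>z\<bar> < M" using z y by simp
      ultimately show ?thesis by (auto simp: abs_less_iff)
    qed
    have yy: "- \<bar>y\<bar> \<le> y" "y \<le> \<bar>y\<bar>" "- \<bar>y\<bar> \<le> 0" "0 \<le> \<bar>y\<bar>" by auto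
    show ?case
      unfolding \<tau>_def
      by (rule straight_characteristics[OF p(2) patch_burgers[OF P H] yy(3,4) V _ _ yy(1,2)])
        (auto simp: a_def G_def)
  qed
  have \<tau>0: "\<tau> 0 y = 0" by (simp add: \<tau>_def a0)
  have d\<tau>: "((\<lambda>\<sigma>. (y, \<tau> \<sigma> y)) has_derivative (\<lambda>h. h *\<^sub>R (0, 1 + m * y + n * y\<^sup>2 / 2))) (at 0)"
  proof -
    have "((\<lambda>\<sigma>. \<tau> \<sigma> y) has_real_derivative (1 + m * y + n * y\<^sup>2 / 2)) (at 0)"
      unfolding \<tau>_def by (auto intro!: derivative_eq_intros da dG)
    moreover have "(*) (1 + m * y + n * y\<^sup>2 / 2) = (\<lambda>h. h * (1 + m * y + n * y\<^sup>2 / 2))"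
      by (rule ext) (rule mult.commute)
    ultimately have "((\<lambda>\<sigma>. \<tau> \<sigma> y) has_derivative (\<lambda>h. h * (1 + m * y + n * y\<^sup>2 / 2))) (at 0)"
      by (simp only: has_field_derivative_def)
    from has_derivative_Pair[OF has_derivative_const this] show ?thesis by simp
  qed
  have comp: "((\<lambda>\<sigma>. F (y, \<tau> \<sigma> y)) has_real_derivative dd F (0, 1) (y, 0) * (1 + m * y + n * y\<^sup>2 / 2)) (at 0)"
    if F: "c1_on ?V F" for F
  proof -
    let ?D = "1 + m * y + n * y\<^sup>2 / 2"
    have Fd: "F differentiable at (y, 0)" using F yV unfolding c1_on_def by blast
    have "((\<lambda>\<sigma>. F (y, \<tau> \<sigma> y)) has_derivative (\<lambda>h. dd F (h *\<^sub>R (0, ?D)) (y, 0))) (at 0)"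
      by (rule has_derivative_compose[OF d\<tau>, where g = F and g' = "\<lambda>v. dd F v (y, 0)"])
        (simp add: \<tau>0 has_derivative_ddI[OF Fd])
    moreover have "(\<lambda>h. dd F (h *\<^sub>R (0, ?D)) (y, 0)) = (*) (dd F (0, 1) (y, 0) * ?D)"
    proof
      fix h
      have "h *\<^sub>R (0 :: real, ?D) = (h * ?D) *\<^sub>R (0, 1)" by simp
      then show "dd F (h *\<^sub>R (0, ?D)) (y, 0) = dd F (0, 1) (y, 0) * ?D * h"
        using dd_linear(2)[OF Fd, of "h * ?D" "(0, 1)"] by (simp only: real_scaleR_def mult_ac)
    qed
    ultimately show ?thesis by (simp only: has_field_derivative_def)
  qed
  have 1: "((\<lambda>\<sigma>. f (y, \<tau> \<sigma> y) - (a \<sigma> + G \<sigma> * y)) has_real_derivative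
      dd f (0, 1) (y, 0) * (1 + m * y + n * y\<^sup>2 / 2) - (m + n * y)) (at 0)"
    by (intro DERIV_diff comp[OF fc1] DERIV_add da DERIV_cmult_right dG)
  have "\<forall>\<^sub>F \<sigma> in nhds 0. f (y, \<tau> \<sigma> y) - (a \<sigma> + G \<sigma> * y) = 0" using ev by eventually_elim simp
  from derivative_eq_0_if_eventually_0[OF this 1[unfolded has_field_derivative_def], of 1]
  show "dd f (0, 1) (y, 0) * (1 + m * y + n * y\<^sup>2 / 2) = m + n * y" by simp
  have 2: "((\<lambda>\<sigma>. burgers f (y, \<tau> \<sigma> y) - G \<sigma>) has_real_derivative
      dd (burgers f) (0, 1) (y, 0) * (1 + m * y + n * y\<^sup>2 / 2) - n) (at 0)"
    by (intro DERIV_diff comp[OF Bc1] dG)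
  have "\<forall>\<^sub>F \<sigma> in nhds 0. burgers f (y, \<tau> \<sigma> y) - G \<sigma> = 0" using ev by eventually_elim simp
  from derivative_eq_0_if_eventually_0[OF this 2[unfolded has_field_derivative_def], of 1]
  show "dd (burgers f) (0, 1) (y, 0) * (1 + m * y + n * y\<^sup>2 / 2) = n" by simp
qed

text \<open>At a real root of the quadratic, both identities of \<open>coefficients\<close>, on a
  strip reaching beyond the root, have left side 0. They give \<open>n = 0\<close> and then
  \<open>m = 0\<close>. So there is no root; in particular \<open>n = 0\<close> is excluded, as it
  would leave the root \<open>- 1 / m\<close>.\<close>

lemma discriminant:
  assumes P: "patch S 0 r V f" and V: "(0, 0) \<in> V"
    and m: "m = dd f (0, 1) (0, 0)" and n: "n = dd (burgers f) (0, 1) (0, 0)" and m0: "m \<noteq> 0"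
  shows "0 < n" "m\<^sup>2 < 2 * n"
proof -
  have nz: "1 + m * y + n * y\<^sup>2 / 2 \<noteq> 0" for y
  proof
    assume z: "1 + m * y + n * y\<^sup>2 / 2 = 0"
    define M where "M = \<bar>y\<bar> + 1"
    obtain r' \<epsilon> f' where f': "0 < r'" "0 < \<epsilon>" "patch S 0 r' ({-M<..<M} \<times> {-\<epsilon><..<\<epsilon>}) f'"
      by (rule tube_exists[of M]) (auto simp: M_def)
    have M: "0 < M" "\<bar>y\<bar> < M" by (auto simp: M_def)
    have "(0, 0) \<in> {-M<..<M} \<times> {-\<epsilon><..<\<epsilon>}" using M f' by auto
    note j = patch_jet_unique[OF P f'(3) V this]
    have "m + n * y = 0" "n = 0"
      using coefficients[OF f'(3) M(1) f'(2) M(2) m[unfolded j] n[unfolded j]] by (simp_all add: z)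
    then show False using m0 by simp
  qed
  have d: "m\<^sup>2 < 2 * n"
  proof (rule ccontr)
    assume "\<not> m\<^sup>2 < 2 * n"
    then have D: "0 \<le> m\<^sup>2 - 2 * n" by simp
    show False
    proof (cases "n = 0")
      case True
      then show False using nz[of "- 1 / m"] m0 by simp
    next
      case False
      define w where "w = sqrt (m\<^sup>2 - 2 * n)"
      have w: "w\<^sup>2 = m\<^sup>2 - 2 * n" using D by (simp add: w_def)
      have "n * ((w - m) / n)\<^sup>2 / 2 = (w - m)\<^sup>2 / (2 * n)"
        using False by (simp add: power_divide power2_eq_square)
      also have "(w - m)\<^sup>2 = 2 * m\<^sup>2 - 2 * n - 2 * w * m"
        using w by (simp add: power2_diff)
      finally have "1 + m * ((w - m) / n) + n * ((w - m) / n)\<^sup>2 / 2 = 0"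
        using False by (simp add: field_simps power2_eq_square)
      then show False using nz by blast
    qed
  qed
  then show "m\<^sup>2 < 2 * n" .
  have "0 \<le> m\<^sup>2" by simp
  then show "0 < n" using d by linarith
qed

end

section \<open>Test functions and the second derivative of the area\<close>

lemma c1_on_DERIV:
  fixes f :: "real \<Rightarrow> real"
  assumes "\<And>x. (f has_real_derivative f' x) (at x)" "continuous_on UNIV f'"
  shows "c1_on U f"
proof (rule c1_onI[where f' = "\<lambda>v x. f' x * v"])
  show "(f has_derivative (\<lambda>v. f' x * v)) (at x)" for x
    using assms(1)[of x] by (simp only: has_field_derivative_def)
  show "continuous_on U (\<lambda>x. f' x * v)" for v
    by (intro continuous_intros continuous_on_subset[OF assms(2)]) auto
qed

lemma c2_on_DERIV:
  fixes f :: "real \<Rightarrow> real"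
  assumes "open U" "\<And>x. (f has_real_derivative f' x) (at x)" "c1_on U f'"
  shows "c2_on U f"
proof (rule c2_onI[where f' = "\<lambda>v x. f' x * v", OF assms(1)])
  show "(f has_derivative (\<lambda>v. f' x * v)) (at x)" for x
    using assms(2)[of x] by (simp only: has_field_derivative_def)
  show "c1_on U (\<lambda>x. f' x * v)" for v by (intro c1_on_mult assms(3) c1_on_const)
qed

lemma DERIV_pos_part_power:
  "((\<lambda>z. max 0 z ^ Suc (Suc k)) has_real_derivative real (Suc (Suc k)) * max 0 z ^ Suc k) (at (z :: real))"
proof (cases "z = 0")
  case True
  have "((\<lambda>h. max 0 h ^ Suc k) \<longlongrightarrow> max 0 0 ^ Suc k) (at (0 :: real))"
    by (intro tendsto_intros)
  then have "((\<lambda>h. max 0 h ^ Suc k) \<longlongrightarrow> 0) (at (0 :: real))" by simp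
  moreover have "\<forall>\<^sub>F h in at (0 :: real). max 0 h ^ Suc k = (max 0 (0 + h) ^ Suc (Suc k) - max 0 0 ^ Suc (Suc k)) / h"
    unfolding eventually_at by (intro exI[of _ 1]) (auto simp: max_def)
  ultimately have "((\<lambda>h. (max 0 (0 + h) ^ Suc (Suc k) - max 0 0 ^ Suc (Suc k)) / h) \<longlongrightarrow> 0) (at (0 :: real))"
    using tendsto_cong by fast
  then show ?thesis by (simp add: DERIV_def True)
next
  case False
  show ?thesis
  proof (cases "0 < z")
    case True
    have "((\<lambda>z. z ^ Suc (Suc k)) has_real_derivative real (Suc (Suc k)) * z ^ Suc k) (at z)"
      by (rule derivative_eq_intros refl)+ simp
    then have "((\<lambda>z. max 0 z ^ Suc (Suc k)) has_real_derivative real (Suc (Suc k)) * z ^ Suc k) (at z)"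
      by (rule has_field_derivative_transform_within_open[of _ _ _ "{0<..}"]) (use True in auto)
    then show ?thesis using True by simp
  next
    case neg: False
    have "((\<lambda>z. 0) has_real_derivative 0) (at z)" by simp
    then have "((\<lambda>z. max 0 z ^ Suc (Suc k)) has_real_derivative 0) (at z)"
      by (rule has_field_derivative_transform_within_open[of _ _ _ "{..<0}"]) (use neg False in auto)
    then show ?thesis using neg by simp
  qed
qed

text \<open>The third power is the least one for which this compactly supported function is
  C2.\<close>

definition bump :: "real \<Rightarrow> real" where "bump z = max 0 (1 - z\<^sup>2) ^ 3"
definition bump' :: "real \<Rightarrow> real" where "bump' z = - 6 * z * max 0 (1 - z\<^sup>2) ^ 2"

lemma DERIV_bump: "(bump has_real_derivative bump' z) (at z)"
proof -
  have "((\<lambda>z. 1 - z\<^sup>2) has_real_derivative - 2 * z) (at z)" by (auto intro!: derivative_eq_intros)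
  from DERIV_chain2[OF DERIV_pos_part_power[of 1 "1 - z\<^sup>2"] this]
  show ?thesis by (simp add: bump_def[abs_def] bump'_def numeral_3_eq_3 numeral_2_eq_2 algebra_simps)
qed

lemma c2_bump: "c2_on UNIV bump"
proof (rule c2_on_DERIV[OF open_UNIV DERIV_bump])
  have p: "c1_on UNIV (\<lambda>z::real. max 0 z ^ 2)"
  proof (rule c1_on_DERIV)
    show "((\<lambda>z. max 0 z ^ 2) has_real_derivative 2 * max 0 z) (at z)" for z :: real
      using DERIV_pos_part_power[of 0 z] by (simp add: numeral_2_eq_2)
    show "continuous_on UNIV (\<lambda>z::real. 2 * max 0 z)" by (intro continuous_intros)
  qed
  have "c1_on UNIV (\<lambda>z::real. max 0 (1 - z * z) ^ 2)"
    by (rule c1_on_compose[OF p]) (auto intro!: c1_intros)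
  then show "c1_on UNIV bump'"
    unfolding bump'_def[abs_def] power2_eq_square[of z for z :: real, symmetric]
    by (intro c1_intros) (simp_all add: power2_eq_square)
qed

lemma continuous_on_bump [continuous_intros]: "continuous_on A g \<Longrightarrow> continuous_on A (\<lambda>x. bump (g x))"
  unfolding bump_def by (intro continuous_intros)

lemma continuous_on_bump' [continuous_intros]: "continuous_on A g \<Longrightarrow> continuous_on A (\<lambda>x. bump' (g x))"
  unfolding bump'_def by (intro continuous_intros)

lemma bump_nonzero: "bump z \<noteq> 0 \<Longrightarrow> \<bar>z\<bar> < 1"
proof -
  assume "bump z \<noteq> 0"
  then have "0 < 1 - z\<^sup>2" by (auto simp: bump_def max_def split: if_splits)
  then show ?thesis by (simp add: abs_square_less_1)
qed

lemma bump_le: "0 \<le> bump z" "bump z \<le> 1"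
  by (auto simp: bump_def intro!: power_le_one)

lemma bump'_le: "\<bar>z\<bar> \<le> 1 \<Longrightarrow> \<bar>bump' z\<bar> \<le> 6"
proof -
  assume z: "\<bar>z\<bar> \<le> 1"
  have "max 0 (1 - z\<^sup>2) ^ 2 \<le> (1 :: real)" by (intro power_le_one) auto
  then have "\<bar>z\<bar> * max 0 (1 - z\<^sup>2) ^ 2 \<le> 1 * 1" using z by (intro mult_mono) auto
  then show ?thesis by (simp add: bump'_def abs_mult)
qed

text \<open>\<open>G\<close> is the average of the \<tau>-derivative over the segment from the axis.
  Applied to \<open>f\<close> and \<open>burgers f\<close>, it extracts the factor \<tau> that
  compensates the factor 1 / \<epsilon> in the \<tau>-derivative of a test function concentrated at
  scale \<epsilon>.\<close>

lemma hadamard: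
  fixes F :: "real \<times> real \<Rightarrow> real"
  assumes F: "c1_on (I \<times> {-e<..<e}) F" and e: "0 < e" and F0: "\<And>y. y \<in> I \<Longrightarrow> F (y, 0) = 0"
  obtains G where "continuous_on (I \<times> {-e<..<e}) G" "\<And>y \<tau>. y \<in> I \<Longrightarrow> \<bar>\<tau>\<bar> < e \<Longrightarrow> F (y, \<tau>) = \<tau> * G (y, \<tau>)"
    "\<And>y. y \<in> I \<Longrightarrow> G (y, 0) = dd F (0, 1) (y, 0)"
proof -
  let ?V = "I \<times> {-e<..<e}"
  define G where "G q = integral (cbox 0 1) (\<lambda>t. dd F (0, 1) (fst q, t * snd q))" for q
  have inV: "(fst q, t * snd q) \<in> ?V" if "q \<in> ?V" "t \<in> cbox 0 1" for q t
  proof -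
    have q: "fst q \<in> I" "\<bar>snd q\<bar> < e" using that(1) by (auto simp: abs_less_iff)
    have "\<bar>t * snd q\<bar> \<le> 1 * \<bar>snd q\<bar>" unfolding abs_mult using that(2) by (intro mult_right_mono) auto
    then have "\<bar>t * snd q\<bar> < e" using q(2) by simp
    then show ?thesis using q(1) by (auto simp: abs_less_iff)
  qed
  have "continuous_on (?V \<times> cbox 0 1) (\<lambda>(q, t). dd F (0, 1) (fst q, t * snd q))"
    unfolding case_prod_beta
    by (rule continuous_on_compose2[OF c1_on_continuous_dd[OF F]])
      (use inV in \<open>auto intro!: continuous_intros\<close>)
  then have "continuous_on ?V G"
    unfolding G_def[abs_def] by (rule integral_continuous_on_param)
  moreover have "F (y, \<tau>) = \<tau> * G (y, \<tau>)" if y: "y \<in> I" "\<bar>\<tau>\<bar> < e" for y \<tau>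
  proof -
    have q: "(y, \<tau>) \<in> ?V" using y by (auto simp: abs_less_iff)
    have "((\<lambda>t. \<tau> * dd F (0, 1) (y, t * \<tau>)) has_integral (F (y, 1 * \<tau>) - F (y, 0 * \<tau>))) {0..1}"
    proof (rule fundamental_theorem_of_calculus)
      fix t :: real assume t: "t \<in> {0..1}"
      have Fd: "F differentiable at (y, t * \<tau>)" using F inV[OF q, of t] t unfolding c1_on_def by auto
      have "((\<lambda>t. (y, t * \<tau>)) has_derivative (\<lambda>h. (0, h * \<tau>))) (at t)" by (auto intro!: derivative_eq_intros)
      then have "((\<lambda>t. F (y, t * \<tau>)) has_derivative (\<lambda>h. dd F (0, h * \<tau>) (y, t * \<tau>))) (at t)"
        by (rule has_derivative_compose[where g = F and g' = "\<lambda>v. dd F v (y, t * \<tau>)"]) (rule has_derivative_ddI[OF Fd])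
      moreover have "(\<lambda>h. dd F (0, h * \<tau>) (y, t * \<tau>)) = (\<lambda>h. h *\<^sub>R (\<tau> * dd F (0, 1) (y, t * \<tau>)))"
      proof
        fix h
        show "dd F (0, h * \<tau>) (y, t * \<tau>) = h *\<^sub>R (\<tau> * dd F (0, 1) (y, t * \<tau>))"
          using dd_linear(2)[OF Fd, of "h * \<tau>" "(0, 1)"] by simp
      qed
      ultimately show "((\<lambda>t. F (y, t * \<tau>)) has_vector_derivative \<tau> * dd F (0, 1) (y, t * \<tau>)) (at t within {0..1})"
        by (simp only: has_vector_derivative_def has_derivative_at_withinI)
    qed simp
    then have "integral {0..1} (\<lambda>t. \<tau> * dd F (0, 1) (y, t * \<tau>)) = F (y, 1 * \<tau>) - F (y, 0 * \<tau>)"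
      by (rule integral_unique)
    then show ?thesis using F0[OF y(1)] by (simp add: G_def)
  qed
  moreover have "G (y, 0) = dd F (0, 1) (y, 0)" if "y \<in> I" for y
    by (simp add: G_def)
  ultimately show ?thesis using that by blast
qed

text \<open>Two differentiations under the integral sign, everything being jointly continuous over a
  compact rectangle. The quadratic polynomial in \<open>l\<close> is what \<open>burgers\<close>
  becomes on \<open>f + l a\<close>. \<open>A\<close> is known for small \<open>l\<close> only, so
  \<open>deriv A\<close> is identified on that interval before it is differentiated again.\<close>

lemma second_deriv_area_integral:
  fixes a b :: "real \<times> real" and w p0 p1 p2 :: "real \<times> real \<Rightarrow> real"
  assumes c: "continuous_on (cbox a b) w" "continuous_on (cbox a b) p0"
      "continuous_on (cbox a b) p1" "continuous_on (cbox a b) p2"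
    and A: "0 < l0" "\<And>l. \<bar>l\<bar> < l0 \<Longrightarrow> A l = integral (cbox a b) (\<lambda>q. w q * sqrt (1 + (p0 q + l * p1 q + l\<^sup>2 * p2 q)\<^sup>2))"
  shows "deriv (deriv A) 0 = integral (cbox a b) (\<lambda>q. w q * ((p1 q)\<^sup>2 / sqrt (1 + (p0 q)\<^sup>2) ^ 3 + 2 * p0 q * p2 q / sqrt (1 + (p0 q)\<^sup>2)))"
proof -
  define p where "p l q = p0 q + l * p1 q + l\<^sup>2 * p2 q" for l q
  define p' where "p' l q = p1 q + 2 * l * p2 q" for l q
  define s where "s l q = sqrt (1 + (p l q)\<^sup>2)" for l q
  have s0: "0 < s l q" and s2: "s l q * s l q = 1 + (p l q)\<^sup>2" for l q
    by (auto simp: s_def add_pos_nonneg)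
  define g0 where "g0 l q = w q * s l q" for l q
  define g1 where "g1 l q = w q * (p l q * p' l q / s l q)" for l q
  define g2 where "g2 l q = w q * (((p' l q * p' l q + p l q * (2 * p2 q)) * s l q - p l q * p' l q * (p l q * p' l q / s l q)) / (s l q * s l q))" for l q
  have dp: "((\<lambda>l. p l q) has_real_derivative p' l q) (at l)" for l q
    unfolding p_def p'_def by (auto intro!: derivative_eq_intros)
  have dp': "((\<lambda>l. p' l q) has_real_derivative 2 * p2 q) (at l)" for l q
    unfolding p'_def by (auto intro!: derivative_eq_intros)
  have ds: "((\<lambda>l. s l q) has_real_derivative p l q * p' l q / s l q) (at l)" for l q
    using DERIV_chain2[OF DERIV_sqrt_one_plus_square[of "p l q"] dp[of q l]] unfolding s_def by simp
  have dg0: "((\<lambda>l. g0 l q) has_real_derivative g1 l q) (at l)" for l q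
    unfolding g0_def g1_def by (rule DERIV_cmult[OF ds])
  have dg1: "((\<lambda>l. g1 l q) has_real_derivative g2 l q) (at l)" for l q
  proof -
    have "((\<lambda>l. p l q * p' l q) has_real_derivative p' l q * p' l q + p l q * (2 * p2 q)) (at l)"
      using DERIV_mult[OF dp[of q l] dp'[of q l]] by (simp add: algebra_simps)
    from DERIV_cmult[OF DERIV_divide[OF this ds], where c = "w q"]
    show ?thesis unfolding g1_def g2_def using s0[of l q] by simp
  qed
  let ?X = "UNIV \<times> cbox a b :: (real \<times> real \<times> real) set"
  have snd: "continuous_on ?X (\<lambda>z. k (snd z))" if "continuous_on (cbox a b) k" for k :: "real \<times> real \<Rightarrow> real"
    by (rule continuous_on_compose2[OF that]) (auto intro!: continuous_intros)
  have cp: "continuous_on ?X (\<lambda>z. p (fst z) (snd z))" unfolding p_def by (intro continuous_intros snd c)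
  have cp': "continuous_on ?X (\<lambda>z. p' (fst z) (snd z))" unfolding p'_def by (intro continuous_intros snd c)
  have cs: "continuous_on ?X (\<lambda>z. s (fst z) (snd z))" unfolding s_def by (intro continuous_intros cp)
  have sn: "s l q \<noteq> 0" for l q using s0[of l q] by simp
  have cg0: "continuous_on ?X (\<lambda>z. g0 (fst z) (snd z))" unfolding g0_def by (intro continuous_intros snd c cs)
  have cg1: "continuous_on ?X (\<lambda>z. g1 (fst z) (snd z))" unfolding g1_def
    by (intro continuous_intros snd c cp cp' cs) (simp add: sn)
  have cg2: "continuous_on ?X (\<lambda>z. g2 (fst z) (snd z))" unfolding g2_def
    by (intro continuous_intros snd c cp cp' cs) (simp_all add: sn)
  have int: "k l integrable_on cbox a b" if "continuous_on ?X (\<lambda>z. k (fst z) (snd z))" for k :: "real \<Rightarrow> real \<times> real \<Rightarrow> real" and l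
  proof (rule integrable_continuous)
    show "continuous_on (cbox a b) (k l)"
    proof -
      have "continuous_on (cbox a b) (Pair l)" by (intro continuous_intros)
      from continuous_on_compose2[OF that this] show ?thesis by auto
    qed
  qed
  have D1: "((\<lambda>l. integral (cbox a b) (g0 l)) has_real_derivative integral (cbox a b) (g1 l)) (at l)" for l
    by (rule leibniz_rule_field_derivative[where U = UNIV])
      (use dg0 int[OF cg0] cg1 in \<open>auto simp: case_prod_beta\<close>)
  have D2: "((\<lambda>l. integral (cbox a b) (g1 l)) has_real_derivative integral (cbox a b) (g2 l)) (at l)" for l
    by (rule leibniz_rule_field_derivative[where U = UNIV])
      (use dg1 int[OF cg1] cg2 in \<open>auto simp: case_prod_beta\<close>)
  have Aeq: "A l = integral (cbox a b) (g0 l)" if "\<bar>l\<bar> < l0" for l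
    using A(2)[OF that] by (simp add: g0_def[abs_def] s_def p_def)
  have dA: "deriv A l = integral (cbox a b) (g1 l)" if l: "\<bar>l\<bar> < l0" for l
  proof (rule DERIV_imp_deriv)
    show "(A has_real_derivative integral (cbox a b) (g1 l)) (at l)"
      by (rule has_field_derivative_transform_within_open[OF D1, where S = "{-l0<..<l0}"])
        (use l Aeq in \<open>auto simp: abs_less_iff\<close>)
  qed
  have "deriv (deriv A) 0 = integral (cbox a b) (g2 0)"
  proof (rule DERIV_imp_deriv)
    show "(deriv A has_real_derivative integral (cbox a b) (g2 0)) (at 0)"
      by (rule has_field_derivative_transform_within_open[OF D2, where S = "{-l0<..<l0}"])
        (use A(1) dA in \<open>auto simp: abs_less_iff\<close>)
  qed
  also have "\<dots> = integral (cbox a b) (\<lambda>q. w q * ((p1 q)\<^sup>2 / sqrt (1 + (p0 q)\<^sup>2) ^ 3 + 2 * p0 q * p2 q / sqrt (1 + (p0 q)\<^sup>2)))"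
  proof (rule integral_cong)
    fix q
    define R where "R = sqrt (1 + (p0 q)\<^sup>2)"
    have R: "0 < R" "R * R = 1 + (p0 q)\<^sup>2" by (auto simp: R_def add_pos_nonneg)
    have "((p1 q * p1 q + p0 q * (2 * p2 q)) * R - p0 q * p1 q * (p0 q * p1 q / R)) / (R * R)
        = (p1 q * p1 q * (R * R - (p0 q)\<^sup>2) + 2 * p0 q * p2 q * (R * R)) / R ^ 3"
      using R(1) by (simp add: field_simps power2_eq_square power3_eq_cube)
    also have "\<dots> = ((p1 q)\<^sup>2 + 2 * p0 q * p2 q * (R * R)) / R ^ 3"
      by (simp add: R(2) power2_eq_square)
    also have "\<dots> = (p1 q)\<^sup>2 / R ^ 3 + 2 * p0 q * p2 q / R"
      using R(1) by (simp add: field_simps power3_eq_cube)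
    finally show "g2 0 q = w q * ((p1 q)\<^sup>2 / sqrt (1 + (p0 q)\<^sup>2) ^ 3 + 2 * p0 q * p2 q / sqrt (1 + (p0 q)\<^sup>2))"
      by (simp add: g2_def p_def p'_def s_def R_def)
  qed
  finally show ?thesis .
qed

text \<open>The derivative of \<open>v * (bump v)\<^sup>2\<close> integrates to 0. This produces the
  minus sign in front of \<open>n\<close> in the limiting quadratic form.\<close>

lemma integral_bump_parts:
  "integral {-1..1} (\<lambda>v. 2 * v * bump v * bump' v) = - integral {-1..1} (\<lambda>v. (bump v)\<^sup>2)"
proof -
  have "((\<lambda>v. (bump v)\<^sup>2 + 2 * v * bump v * bump' v) has_integral (1 * (bump 1)\<^sup>2 - (-1) * (bump (-1))\<^sup>2)) {-1..1}"
  proof (rule fundamental_theorem_of_calculus)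
    fix v :: real
    have "((\<lambda>v. v * (bump v)\<^sup>2) has_real_derivative (bump v)\<^sup>2 + 2 * v * bump v * bump' v) (at v)"
      by (auto intro!: derivative_eq_intros DERIV_bump simp: power2_eq_square algebra_simps)
    then show "((\<lambda>v. v * (bump v)\<^sup>2) has_vector_derivative (bump v)\<^sup>2 + 2 * v * bump v * bump' v) (at v within {-1..1})"
      by (metis has_real_derivative_iff_has_vector_derivative has_vector_derivative_at_within)
  qed simp
  then have "integral {-1..1} (\<lambda>v. (bump v)\<^sup>2 + 2 * v * bump v * bump' v) = 0"
    by (simp add: integral_unique bump_def)
  moreover have "integral {-1..1} (\<lambda>v. (bump v)\<^sup>2 + 2 * v * bump v * bump' v) =
      integral {-1..1} (\<lambda>v. (bump v)\<^sup>2) + integral {-1..1} (\<lambda>v. 2 * v * bump v * bump' v)"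
    by (intro integral_add integrable_continuous_real continuous_intros)
  ultimately show ?thesis by simp
qed

lemma integral_bump_pos: "0 < integral {-1..1} (\<lambda>v. (bump v)\<^sup>2)"
proof -
  have "(27 / 64)\<^sup>2 \<le> (bump v)\<^sup>2" if "v \<in> {-1/2..1/2}" for v
  proof -
    have "v\<^sup>2 \<le> (1/2)\<^sup>2" using that by (intro abs_le_square_iff[THEN iffD1]) (auto simp: abs_le_iff)
    then have "3/4 \<le> max 0 (1 - v\<^sup>2)" by (simp add: power2_eq_square)
    then have "(3/4) ^ 3 \<le> bump v" unfolding bump_def by (rule power_mono) simp
    then show ?thesis by (intro power_mono) (auto simp: power3_eq_cube)
  qed
  then have "integral {-1/2..1/2 :: real} (\<lambda>v. (27 / 64)\<^sup>2 :: real) \<le> integral {-1/2..1/2} (\<lambda>v. (bump v)\<^sup>2)"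
    by (intro integral_le integrable_continuous_real continuous_intros)
  also have "\<dots> \<le> integral {-1..1} (\<lambda>v. (bump v)\<^sup>2)"
    by (intro integral_subset_le integrable_continuous_real continuous_intros) auto
  finally show ?thesis by (simp add: field_simps)
qed

lemma bump_lower: "\<bar>z\<bar> \<le> 1/2 \<Longrightarrow> 27 / 64 \<le> bump z"
proof -
  assume "\<bar>z\<bar> \<le> 1/2"
  then have "z\<^sup>2 \<le> (1/2)\<^sup>2" by (intro abs_le_square_iff[THEN iffD1]) auto
  then have "3/4 \<le> max 0 (1 - z\<^sup>2)" by (simp add: power2_eq_square)
  then have "(3/4) ^ 3 \<le> bump z" unfolding bump_def by (rule power_mono) simp
  then show ?thesis by (simp add: power3_eq_cube)
qed

lemma quadratic_ge:
  fixes m n y :: real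
  assumes n: "0 < n"
  shows "1 - m\<^sup>2 / (2 * n) \<le> 1 + m * y + n * y\<^sup>2 / 2"
proof -
  have "1 + m * y + n * y\<^sup>2 / 2 - (1 - m\<^sup>2 / (2 * n)) = n / 2 * (y + m / n)\<^sup>2"
    using n by (simp add: power2_eq_square field_simps)
  moreover have "0 \<le> n / 2 * (y + m / n)\<^sup>2" using n by simp
  ultimately show ?thesis by linarith
qed

text \<open>With the weight \<open>u = 1\<close> the form \<open>\<integral> u'\<^sup>2 / D - n u\<^sup>2 / D\<^sup>2\<close> is negative, and cutting off at \<open>|y| = M\<close>
  costs only \<open>O(1 / M)\<close>.\<close>

lemma negative_cutoff:
  fixes m n :: real
  defines "D \<equiv> \<lambda>y. 1 + m * y + n * y\<^sup>2 / 2"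
  assumes n: "0 < n" and disc: "m\<^sup>2 < 2 * n"
  obtains M where "2 \<le> M" "integral {-M..M} (\<lambda>y. (bump' (y / M) / M)\<^sup>2 / D y - n * (bump (y / M))\<^sup>2 / (D y)\<^sup>2) < 0"
proof -
  define d where "d = 1 - m\<^sup>2 / (2 * n)"
  have d: "0 < d" using n disc by (simp add: d_def field_simps)
  have Dd: "d \<le> D y" for y
    unfolding d_def D_def by (rule quadratic_ge[OF n])
  have Dpos: "0 < D y" for y using d Dd[of y] by linarith
  define D1 where "D1 = 1 + \<bar>m\<bar> + n / 2"
  have D1: "D y \<le> D1" if "\<bar>y\<bar> \<le> 1" for y
  proof -
    have "m * y \<le> \<bar>m\<bar> * \<bar>y\<bar>" by (metis abs_ge_self abs_mult)
    also have "\<dots> \<le> \<bar>m\<bar> * 1" using that by (intro mult_left_mono) auto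
    finally have 1: "m * y \<le> \<bar>m\<bar>" by simp
    have "y\<^sup>2 \<le> 1" using that by (simp add: abs_square_le_1)
    then have "n * y\<^sup>2 \<le> n * 1" using n by (intro mult_left_mono) auto
    then show ?thesis using 1 by (simp add: D_def D1_def)
  qed
  have D1pos: "0 < D1" using n by (simp add: D1_def add_pos_nonneg)
  \<comment> \<open>A lower bound for the negative term on \<open>{-1..1}\<close>: there
    \<open>y / M\<close> is at most 1/2 in absolute value, where \<open>bump\<close> is at least
    \<open>(3/4) ^ 3 = 27 / 64\<close>, and \<open>D\<close> is at most \<open>D1\<close>.\<close>
  define \<rho> where "\<rho> = n * (27 / 64)\<^sup>2 / D1\<^sup>2"
  have \<rho>: "0 < \<rho>" using n D1pos by (simp add: \<rho>_def)
  \<comment> \<open>The positive term is at most \<open>36 / (M\<^sup>2 * d)\<close> on an interval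
    of length \<open>2 * M\<close>, hence contributes at most \<open>72 / (M * d)\<close>. This
    choice makes it at most \<rho>, against a gain of \<open>2 * \<rho>\<close>.\<close>
  define M where "M = max 2 (72 / (d * \<rho>))"
  have M: "2 \<le> M" "72 / (d * \<rho>) \<le> M" by (auto simp: M_def)
  have M0: "0 < M" using M by simp
  let ?w = "\<lambda>y. (bump' (y / M) / M)\<^sup>2 / D y - n * (bump (y / M))\<^sup>2 / (D y)\<^sup>2"
  let ?b = "\<lambda>y. 36 / (M\<^sup>2 * d) - (if y \<in> {-1..1} then \<rho> else 0)"
  have cD: "continuous_on A D" for A unfolding D_def by (intro continuous_intros) auto
  have wint: "?w integrable_on {-M..M}"
    using Dpos M0 by (intro integrable_continuous_real continuous_intros cD) (auto simp: less_imp_neq[THEN not_sym])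
  have sub: "{-1..1} \<subseteq> {-M..M}" using M by auto
  have iint: "((\<lambda>y. if y \<in> {-1..1} then \<rho> else 0) has_integral 2 * \<rho>) {-M..M}"
    using has_integral_restrict[OF sub, of "\<lambda>_. \<rho>" "2 * \<rho>"] has_integral_const_real[of \<rho> "-1" 1] by simp
  have bint: "(?b has_integral (2 * M) * (36 / (M\<^sup>2 * d)) - 2 * \<rho>) {-M..M}"
    using has_integral_diff[OF has_integral_const_real[of "36 / (M\<^sup>2 * d)" "-M" M] iint] M0 by simp
  have "integral {-M..M} ?w \<le> integral {-M..M} ?b"
  proof (rule integral_le[OF wint])
    show "?b integrable_on {-M..M}" using bint by blast
    fix y assume y: "y \<in> {-M..M}"
    have yM: "\<bar>y / M\<bar> \<le> 1" using y M0 by (simp add: abs_le_iff field_simps)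
    have "(bump' (y / M))\<^sup>2 \<le> 6\<^sup>2" using bump'_le[OF yM] by (intro abs_le_square_iff[THEN iffD1]) simp
    then have "(bump' (y / M) / M)\<^sup>2 \<le> 36 / M\<^sup>2" using M0 by (simp add: power_divide divide_right_mono)
    then have "(bump' (y / M) / M)\<^sup>2 / D y \<le> (36 / M\<^sup>2) / d"
      using Dd d by (intro frac_le) auto
    moreover have "(if y \<in> {-1..1} then \<rho> else 0) \<le> n * (bump (y / M))\<^sup>2 / (D y)\<^sup>2"
    proof (cases "y \<in> {-1..1}")
      case True
      then have y1: "\<bar>y\<bar> \<le> 1" by (auto simp: abs_le_iff)
      have "\<bar>y / M\<bar> \<le> 1 / 2" using y1 M(1) by (simp add: field_simps)
      then have "(27 / 64)\<^sup>2 \<le> (bump (y / M))\<^sup>2" using bump_lower by (intro power_mono) auto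
      moreover have "(D y)\<^sup>2 \<le> D1\<^sup>2" using D1[OF y1] Dpos[of y] by (intro power_mono) auto
      ultimately have "\<rho> \<le> n * (bump (y / M))\<^sup>2 / (D y)\<^sup>2"
        unfolding \<rho>_def using n Dpos[of y] by (intro frac_le mult_left_mono) auto
      then show ?thesis using True by simp
    next
      case False
      then show ?thesis using n by auto
    qed
    ultimately show "?w y \<le> ?b y" by (simp add: field_simps)
  qed
  also have "integral {-M..M} ?b = 72 / (M * d) - 2 * \<rho>"
    using bint M0 d by (simp add: integral_unique power2_eq_square)
  also have "\<dots> < 0"
  proof -
    have "72 \<le> M * (d * \<rho>)" using M(2) d \<rho> by (simp add: divide_le_eq)
    then have "72 / (M * d) \<le> \<rho>" using M0 d by (simp add: divide_le_eq mult_ac)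
    then show ?thesis using \<rho> by linarith
  qed
  finally show ?thesis using that M(1) by blast
qed

section \<open>The perimeter of an intrinsic graph\<close>

text \<open>Lagrange's identity: the area is the length of the cross product.\<close>

lemma parallelogram_area_triple:
  "parallelogram_area (a1, a2, a3) (b1, b2, b3 :: real) =
    sqrt ((a1 * b2 - a2 * b1)\<^sup>2 + (a1 * b3 - a3 * b1)\<^sup>2 + (a2 * b3 - a3 * b2)\<^sup>2)" for a1 a2 b1 b2 :: real
proof -
  have "(norm (a1, a2, a3))\<^sup>2 * (norm (b1, b2, b3))\<^sup>2 - ((a1, a2, a3) \<bullet> (b1, b2, b3))\<^sup>2 =
      (a1 * b2 - a2 * b1)\<^sup>2 + (a1 * b3 - a3 * b1)\<^sup>2 + (a2 * b3 - a3 * b2)\<^sup>2"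
    unfolding power2_norm_eq_inner by (simp add: power2_eq_square algebra_simps)
  then show ?thesis by (simp add: parallelogram_area_def)
qed

lemma parallelogram_area_shear:
  "parallelogram_area (u + k *\<^sub>R w) (l *\<^sub>R w) = \<bar>l\<bar> * parallelogram_area u w"
proof -
  have "(norm (u + k *\<^sub>R w))\<^sup>2 * (norm (l *\<^sub>R w))\<^sup>2 - ((u + k *\<^sub>R w) \<bullet> (l *\<^sub>R w))\<^sup>2 =
      l\<^sup>2 * ((norm u)\<^sup>2 * (norm w)\<^sup>2 - (u \<bullet> w)\<^sup>2)"
    unfolding power2_norm_eq_inner
    by (simp add: inner_add_left inner_add_right inner_commute power2_eq_square algebra_simps)
  then show ?thesis by (simp add: parallelogram_area_def real_sqrt_mult)
qed

lemma nn_integral_continuous_cbox: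
  fixes a b :: "'a::euclidean_space" and f :: "'a \<Rightarrow> real"
  assumes f: "continuous_on (cbox a b) f" "\<And>q. q \<in> cbox a b \<Longrightarrow> 0 \<le> f q"
  shows "(\<integral>\<^sup>+q\<in>cbox a b. ennreal (f q) \<partial>lborel) = ennreal (integral (cbox a b) f)"
proof -
  let ?g = "\<lambda>q. if q \<in> cbox a b then f q else 0"
  have "(f has_integral integral (cbox a b) f) (cbox a b)"
    by (rule integrable_integral[OF integrable_continuous[OF f(1)]])
  then have "(?g has_integral integral (cbox a b) f) UNIV" by (simp add: has_integral_restrict_UNIV)
  moreover have "?g \<in> borel_measurable borel"
    by (intro borel_measurable_continuous_on_if f) auto
  ultimately have "integral\<^sup>N lborel ?g = ennreal (integral (cbox a b) f)"
    by (intro nn_integral_has_integral_lborel) (use f(2) in auto)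
  moreover have "(\<integral>\<^sup>+q\<in>cbox a b. ennreal (f q) \<partial>lborel) = integral\<^sup>N lborel ?g"
    by (intro nn_integral_cong) (auto simp: indicator_def)
  ultimately show ?thesis by simp
qed

lemma E1_eq: "E1 c s g = (c, s, (s * fst g - c * fst (snd g)) / 2)"
  by (cases g) (simp add: E1_def algebra_simps diff_divide_distrib)

lemma E2_eq: "E2 c s g = (- s, c, (s * fst (snd g) + c * fst g) / 2)"
  by (cases g) (simp add: E2_def algebra_simps add_divide_distrib)

context heis_chart
begin

text \<open>The squared length of the normal \<open>(B E1 + E2) \<times> (f\<^sub>\<tau> E1 + T)\<close> of the intrinsic graph.\<close>

definition normal_sq :: "real \<Rightarrow> real \<Rightarrow> heis \<Rightarrow> real" where
  "normal_sq B F g = (c + s * B - fst (snd g) * F / 2)\<^sup>2 + (s - c * B + fst g * F / 2)\<^sup>2 + F\<^sup>2"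

lemma normal_sq_pos: "0 < normal_sq B F g"
proof (cases "F = 0")
  case True
  have "(c + s * B)\<^sup>2 + (s - c * B)\<^sup>2 = (c * c + s * s) * (1 + B\<^sup>2)"
    by (simp add: power2_eq_square algebra_simps)
  then have "normal_sq B F g = 1 + B\<^sup>2" by (simp add: normal_sq_def True cs)
  then show ?thesis by (simp add: add_pos_nonneg)
next
  case False
  then have "0 < F\<^sup>2" by simp
  then show ?thesis unfolding normal_sq_def by (intro add_nonneg_pos add_nonneg_nonneg) auto
qed

lemma normal_area:
  "parallelogram_area (B *\<^sub>R E1 c s g + E2 c s g) (F *\<^sub>R E1 c s g + (0, 0, 1)) = sqrt (normal_sq B F g)"
proof -
  let ?X = "fst g" and ?Y = "fst (snd g)"
  define k1 where "k1 = (s * ?X - c * ?Y) / 2"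
  define k2 where "k2 = (s * ?Y + c * ?X) / 2"
  have "s * k1 + c * k2 = (c * c + s * s) * ?X / 2" "c * k1 - s * k2 = - ((c * c + s * s) * ?Y / 2)"
    by (simp_all add: k1_def k2_def field_simps)
  then have k: "s * k1 + c * k2 = ?X / 2" "c * k1 - s * k2 = - (?Y / 2)" by (simp_all only: cs mult_1)
  have 1: "(B * c - s) * (F * s) - (B * s + c) * (F * c) = - F"
  proof -
    have "(B * c - s) * (F * s) - (B * s + c) * (F * c) = - F * (c * c + s * s)" by (simp add: algebra_simps)
    then show ?thesis by (simp only: cs mult_1_right)
  qed
  have 2: "(B * c - s) * (1 + F * k1) - (B * k1 + k2) * (F * c) = - (s - c * B + ?X * F / 2)"
  proof -
    have "(B * c - s) * (1 + F * k1) - (B * k1 + k2) * (F * c) = B * c - s - F * (s * k1 + c * k2)"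
      by (simp add: algebra_simps)
    then show ?thesis unfolding k by (simp add: algebra_simps)
  qed
  have 3: "(B * s + c) * (1 + F * k1) - (B * k1 + k2) * (F * s) = c + s * B - ?Y * F / 2"
  proof -
    have "(B * s + c) * (1 + F * k1) - (B * k1 + k2) * (F * s) = B * s + c + F * (c * k1 - s * k2)"
      by (simp add: algebra_simps)
    then show ?thesis unfolding k by (simp add: algebra_simps)
  qed
  have u: "B *\<^sub>R E1 c s g + E2 c s g = (B * c - s, B * s + c, B * k1 + k2)"
    by (simp add: E1_eq E2_eq k1_def k2_def)
  have w: "F *\<^sub>R E1 c s g + (0, 0, 1) = (F * c, F * s, 1 + F * k1)"
    by (simp add: E1_eq k1_def)
  show ?thesis
    unfolding u w parallelogram_area_triple 1 2 3 normal_sq_def power2_minus by (simp only: add_ac)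
qed

text \<open>The gradient of any defining function is a multiple, with factor
  \<open>\<alpha> = dd \<phi> (E1 c s ?g) ?g\<close>, of a normal that depends on the graph alone.
  So \<alpha> cancels in the quotient, and the description by \<open>THE\<close> has exactly one
  solution.\<close>

lemma patch_density:
  assumes P: "patch S x0 r V f" and q: "q \<in> V"
  shows "H_perimeter_density S (\<Phi> (f q, q)) =
    sqrt (1 + (burgers f q)\<^sup>2) / sqrt (normal_sq (burgers f q) (dd f (0, 1) q) (\<Phi> (f q, q)))"
proof -
  note p = patchD[OF P]
  let ?g = "\<Phi> (f q, q)" and ?B = "burgers f q" and ?F = "dd f (0, 1) q"
  have val: "heis_W \<phi> ?g / norm (euclid_grad \<phi> ?g) = sqrt (1 + ?B\<^sup>2) / sqrt (normal_sq ?B ?F ?g)"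
    if U: "?g \<in> U" and def: "defining_function S U \<phi>" for U \<phi>
  proof -
    note \<phi> = defining_functionD[OF def]
    have \<phi>d: "\<phi> differentiable at ?g" using \<phi>(2) U unfolding c2_on_def by blast
    note l = dd_linear[OF \<phi>d]
    define \<alpha> where "\<alpha> = dd \<phi> (E1 c s ?g) ?g"
    have E: "dd \<phi> (E1 c s ?g) ?g = \<alpha>" "dd \<phi> (E2 c s ?g) ?g = - ?B * \<alpha>" "dd \<phi> (0, 0, 1) ?g = - ?F * \<alpha>"
      using patch_tangent[OF P def q U] by (simp_all add: \<alpha>_def)
    have X: "dd \<phi> (X1 ?g) ?g = \<alpha> * (c + s * ?B)" "dd \<phi> (X2 ?g) ?g = \<alpha> * (s - c * ?B)"
      unfolding X_eq_E by (simp_all only: l E real_scaleR_def) (simp_all add: algebra_simps)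
    obtain x y t where g: "?g = (x, y, t)" by (metis surj_pair)
    have b: "(1, 0, 0) = X1 ?g + (y / 2) *\<^sub>R (0, 0, 1)" "(0, 1, 0) = X2 ?g + (- x / 2) *\<^sub>R (0, 0, 1)"
      by (simp_all add: g)
    have D: "dd \<phi> (1, 0, 0) ?g = \<alpha> * (c + s * ?B - y * ?F / 2)" "dd \<phi> (0, 1, 0) ?g = \<alpha> * (s - c * ?B + x * ?F / 2)"
      unfolding b by (simp_all only: l E X real_scaleR_def) (simp_all add: algebra_simps)
    have grad: "euclid_grad \<phi> ?g = \<alpha> *\<^sub>R (c + s * ?B - y * ?F / 2, s - c * ?B + x * ?F / 2, - ?F)"
      unfolding euclid_grad_def dd_def[symmetric] D E(3) by simp
    have ngrad: "norm (euclid_grad \<phi> ?g) = \<bar>\<alpha>\<bar> * sqrt (normal_sq ?B ?F ?g)"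
      unfolding grad norm_scaleR by (simp add: norm_Pair normal_sq_def g add.assoc)
    have "(\<alpha> * (c + s * ?B))\<^sup>2 + (\<alpha> * (s - c * ?B))\<^sup>2 = \<alpha>\<^sup>2 * ((c * c + s * s) * (1 + ?B\<^sup>2))"
      by (simp add: power2_eq_square algebra_simps)
    then have W: "heis_W \<phi> ?g = \<bar>\<alpha>\<bar> * sqrt (1 + ?B\<^sup>2)"
      unfolding heis_W_def vf_deriv_def dd_def[symmetric] X by (simp add: cs real_sqrt_mult)
    have "\<alpha> \<noteq> 0"
    proof
      assume "\<alpha> = 0"
      then have "euclid_grad \<phi> ?g = 0" by (simp add: grad zero_prod_def)
      then show False using def p(5)[OF q] U unfolding defining_function_def by blast
    qed
    then show ?thesis by (simp add: W ngrad)
  qed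
  have gU: "?g \<in> tube x0 r V" using p(3)[OF q] q by (auto simp: tube_def abs_less_iff)
  show ?thesis
    unfolding H_perimeter_density_def
  proof (rule the_equality)
    show "\<exists>U \<phi>. ?g \<in> U \<and> defining_function S U \<phi> \<and>
        sqrt (1 + ?B\<^sup>2) / sqrt (normal_sq ?B ?F ?g) = heis_W \<phi> ?g / norm (euclid_grad \<phi> ?g)"
      by (intro exI conjI, rule gU, rule patch_defining[OF P], rule val[OF gU patch_defining[OF P], symmetric])
    fix \<rho> assume "\<exists>U \<phi>. ?g \<in> U \<and> defining_function S U \<phi> \<and> \<rho> = heis_W \<phi> ?g / norm (euclid_grad \<phi> ?g)"
    then obtain U \<phi> where "?g \<in> U" "defining_function S U \<phi>" "\<rho> = heis_W \<phi> ?g / norm (euclid_grad \<phi> ?g)"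
      by (elim exE conjE)
    then show "\<rho> = sqrt (1 + ?B\<^sup>2) / sqrt (normal_sq ?B ?F ?g)" using val by simp
  qed
qed

text \<open>In the coordinates (y, v) with \<tau> = \<epsilon> D(y) v the tangent vectors are a
  shear of the standard ones, and the Jacobian is \<open>\<epsilon> * D\<close> times the length of
  the normal. That length is the denominator of the density. The domain is a rectangle independent
  of \<epsilon>.\<close>

lemma perimeter_patch:
  fixes D D' :: "real \<Rightarrow> real" and \<epsilon> M :: real and F :: "real \<times> real \<Rightarrow> real"
  assumes P: "patch S x0 r V F" and \<epsilon>: "0 < \<epsilon>"
    and D: "\<And>y. 0 < D y" "\<And>y. (D has_real_derivative D' y) (at y)" "continuous_on UNIV D'"
  defines "Q \<equiv> cbox (-M, -1) (M, 1)" and "tq \<equiv> \<lambda>p :: real \<times> real. (fst p, \<epsilon> * D (fst p) * snd p)"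
  assumes Q: "\<And>p. p \<in> Q \<Longrightarrow> tq p \<in> V"
  shows "H_perimeter S ((\<lambda>p. \<Phi> (F (tq p), tq p)) ` Q) =
    ennreal (integral Q (\<lambda>p. hausdorff2_unit * (\<epsilon> * D (fst p)) * sqrt (1 + (burgers F (tq p))\<^sup>2)))"
proof -
  note p = patchD[OF P]
  have cD: "continuous_on A D" for A by (rule DERIV_continuous_on[OF has_field_derivative_at_within[OF D(2)]])
  have cD': "continuous_on A D'" for A by (rule continuous_on_subset[OF D(3)]) simp
  have ctq: "continuous_on Q tq"
    unfolding tq_def by (intro continuous_intros continuous_on_compose2[OF cD[of UNIV]]) auto
  have ctV: "continuous_on Q (\<lambda>p. k (tq p))" if "continuous_on V k" for k :: "real \<times> real \<Rightarrow> real"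
    by (rule continuous_on_compose2[OF that ctq]) (use Q in auto)
  define g where "g p = \<Phi> (F (tq p), tq p)" for p
  define B where "B p = burgers F (tq p)" for p
  define Ft where "Ft p = dd F (0, 1) (tq p)" for p
  have cF: "continuous_on Q (\<lambda>p. F (tq p))" by (rule ctV[OF c1_on_continuous[OF c2_on_c1[OF p(2)]]])
  have cB: "continuous_on Q B" unfolding B_def by (rule ctV[OF c1_on_continuous[OF c1_burgers[OF p(2)]]])
  have cFt: "continuous_on Q Ft" unfolding Ft_def by (rule ctV[OF c1_on_continuous_dd[OF c2_on_c1[OF p(2)]]])
  have cg: "continuous_on Q g"
    unfolding g_def by (intro continuous_on_compose2[OF cont_chart[of UNIV]] continuous_intros cF ctq) auto
  define u where "u p = B p *\<^sub>R E1 c s (g p) + E2 c s (g p)" for p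
  define w where "w p = Ft p *\<^sub>R E1 c s (g p) + (0, 0, 1)" for p
  have cu: "continuous_on Q u" unfolding u_def E1_eq E2_eq by (intro continuous_intros cB cg) auto
  have cw: "continuous_on Q w" unfolding w_def E1_eq by (intro continuous_intros cFt cg) auto
  define t1 where "t1 p = \<epsilon> * D' (fst p) * snd p" for p :: "real \<times> real"
  define l where "l p = \<epsilon> * D (fst p)" for p :: "real \<times> real"
  have ct1: "continuous_on Q t1"
    unfolding t1_def by (intro continuous_intros continuous_on_compose2[OF cD'[of UNIV]]) auto
  have cl: "continuous_on Q l"
    unfolding l_def by (intro continuous_intros continuous_on_compose2[OF cD[of UNIV]]) auto
  have lpos: "0 < l p" for p using \<epsilon> D(1) by (simp add: l_def)
  \<comment> \<open>The direction \<open>(1, t1 p)\<close> is \<open>(1, F)\<close> plus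
    \<open>t1 p - F\<close> times \<open>(0, 1)\<close>; these two are mapped to \<open>u p\<close>
    and \<open>w p\<close>.\<close>
  define P1 where "P1 p = u p + (t1 p - F (tq p)) *\<^sub>R w p" for p
  define P2 where "P2 p = l p *\<^sub>R w p" for p
  have der: "(g has_derivative (\<lambda>h. fst h *\<^sub>R P1 p + snd h *\<^sub>R P2 p)) (at p within Q)" if "p \<in> Q" for p
  proof -
    have Fd: "F differentiable at (tq p)" by (rule p(6)[OF Q[OF that]])
    have dDf: "((\<lambda>p. D (fst p)) has_derivative (\<lambda>h. D' (fst p) * fst h)) (at p)"
      by (rule has_derivative_compose[OF has_derivative_fst[OF has_derivative_ident], where g = D and g' = "(*) (D' (fst p))"])
        (use D(2) in \<open>simp only: has_field_derivative_def\<close>)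
    have d1: "(tq has_derivative (\<lambda>h. (fst h, \<epsilon> * (D' (fst p) * fst h) * snd p + \<epsilon> * D (fst p) * snd h))) (at p)"
      unfolding tq_def by (rule derivative_eq_intros dDf refl)+ (simp add: algebra_simps fun_eq_iff)
    have "(\<lambda>h. (fst h, \<epsilon> * (D' (fst p) * fst h) * snd p + \<epsilon> * D (fst p) * snd h)) = (\<lambda>h. fst h *\<^sub>R (1, t1 p) + snd h *\<^sub>R (0, l p))"
      by (simp add: fun_eq_iff t1_def l_def algebra_simps)
    note d1 = d1[unfolded this]
    have d2: "((\<lambda>q. (F q, q)) has_derivative (\<lambda>v. (dd F v (tq p), v))) (at (tq p))"
      by (intro has_derivative_Pair has_derivative_ddI[OF Fd] has_derivative_ident)
    have d3: "((\<lambda>q. \<Phi> (F q, q)) has_derivative (\<lambda>v. dd \<Phi> (dd F v (tq p), v) (F (tq p), tq p))) (at (tq p))"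
      by (rule has_derivative_compose[OF d2, where g = \<Phi> and g' = "\<lambda>v. dd \<Phi> v (F (tq p), tq p)"])
        (rule has_derivative_ddI[OF chart_differentiable])
    have d4: "(g has_derivative (\<lambda>h. dd \<Phi> (dd F (fst h *\<^sub>R (1, t1 p) + snd h *\<^sub>R (0, l p)) (tq p), fst h *\<^sub>R (1, t1 p) + snd h *\<^sub>R (0, l p)) (F (tq p), tq p))) (at p)"
      unfolding g_def
      by (rule has_derivative_compose[OF d1, where g = "\<lambda>q. \<Phi> (F q, q)" and g' = "\<lambda>v. dd \<Phi> (dd F v (tq p), v) (F (tq p), tq p)"])
        (rule d3)
    have dF: "dd F (a, b) (tq p) = a * B p + (b - a * F (tq p)) * Ft p" for a b
    proof -
      have "(a, b) = a *\<^sub>R (1, F (tq p)) + (b - a * F (tq p)) *\<^sub>R (0, 1 :: real)" by simp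
      then have "dd F (a, b) (tq p) = a *\<^sub>R dd F (1, F (tq p)) (tq p) + (b - a * F (tq p)) *\<^sub>R dd F (0, 1) (tq p)"
        by (simp only: dd_linear[OF Fd])
      then show ?thesis by (simp add: B_def Ft_def burgers_eq[OF Fd])
    qed
    have "dd \<Phi> (dd F (fst h *\<^sub>R (1, t1 p) + snd h *\<^sub>R (0, l p)) (tq p), fst h *\<^sub>R (1, t1 p) + snd h *\<^sub>R (0, l p)) (F (tq p), tq p)
        = fst h *\<^sub>R P1 p + snd h *\<^sub>R P2 p" for h
    proof -
      have e: "fst h *\<^sub>R (1, t1 p) + snd h *\<^sub>R (0, l p) = (fst h, fst h * t1 p + snd h * l p)" by simp
      have gp: "\<Phi> (F (tq p), tq p) = g p" by (simp add: g_def)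
      show ?thesis
        unfolding e dF dd_chart gp P1_def P2_def u_def w_def
        by (simp add: scaleR_add_left scaleR_add_right scaleR_diff_left algebra_simps)
    qed
    with d4 show ?thesis by (simp add: has_derivative_at_withinI)
  qed
  have tq_inj: "p = p'" if "tq p = tq p'" for p p'
  proof -
    have "fst p = fst p'" "\<epsilon> * D (fst p) * snd p = \<epsilon> * D (fst p') * snd p'" using that by (auto simp: tq_def)
    then show ?thesis using \<epsilon> D(1)[of "fst p"] by (simp add: prod_eq_iff)
  qed
  have area: "parallelogram_area (P1 p) (P2 p) = l p * sqrt (normal_sq (B p) (Ft p) (g p))" for p
    unfolding P1_def P2_def parallelogram_area_shear u_def w_def normal_area using lpos[of p] by simp
  interpret A: parametrized_patch Q g P1 P2
  proof
    show "convex Q" "compact Q" by (simp_all add: Q_def convex_box compact_cbox)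
    show "\<And>q. q \<in> Q \<Longrightarrow> (g has_derivative (\<lambda>h. fst h *\<^sub>R P1 q + snd h *\<^sub>R P2 q)) (at q within Q)" by (rule der)
    show "continuous_on Q P1" unfolding P1_def by (intro continuous_intros cu cw ct1 cF)
    show "continuous_on Q P2" unfolding P2_def by (intro continuous_intros cw cl)
    show "inj_on g Q"
    proof (rule inj_onI)
      fix p p' assume "g p = g p'"
      then have "\<Psi> (g p) = \<Psi> (g p')" by simp
      then show "p = p'" using tq_inj[of p p'] by (simp add: g_def)
    qed
    show "0 < parallelogram_area (P1 p) (P2 p)" for p
      unfolding area using lpos normal_sq_pos by simp
  qed
  define k where "k p = sqrt (1 + (B p)\<^sup>2) / sqrt (normal_sq (B p) (Ft p) (g p))" for p
  have nz: "sqrt (normal_sq (B p) (Ft p) (g p)) \<noteq> 0" for p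
    using normal_sq_pos[of "B p" "Ft p" "g p"] by simp
  have ck: "continuous_on Q k"
    unfolding k_def normal_sq_def by (intro continuous_intros cB cFt cg) (use nz in \<open>auto simp: normal_sq_def\<close>)
  have kJ: "k p * A.J p = l p * sqrt (1 + (B p)\<^sup>2)" for p
    unfolding A.J_def area k_def using nz[of p] by simp
  have "H_perimeter S (g ` Q) = (\<integral>\<^sup>+p\<in>Q. ennreal (hausdorff2_unit * (k p * A.J p)) \<partial>lborel)"
    unfolding H_perimeter_def
  proof (rule A.area_formula[OF ck])
    show "0 \<le> k p" for p by (simp add: k_def normal_sq_pos less_imp_le)
    show "H_perimeter_density S (g p) = k p" if "p \<in> Q" for p
      unfolding g_def k_def B_def Ft_def by (rule patch_density[OF P Q[OF that]])
  qed
  also have "\<dots> = (\<integral>\<^sup>+p\<in>Q. ennreal (hausdorff2_unit * l p * sqrt (1 + (B p)\<^sup>2)) \<partial>lborel)"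
    unfolding kJ by (simp add: mult.assoc)
  also have "\<dots> = ennreal (integral Q (\<lambda>p. hausdorff2_unit * l p * sqrt (1 + (B p)\<^sup>2)))"
    unfolding Q_def
  proof (rule nn_integral_continuous_cbox)
    show "continuous_on (cbox (- M, - 1) (M, 1)) (\<lambda>p. hausdorff2_unit * l p * sqrt (1 + (B p)\<^sup>2))"
      by (intro continuous_intros cl[unfolded Q_def] cB[unfolded Q_def])
    show "0 \<le> hausdorff2_unit * l p * sqrt (1 + (B p)\<^sup>2)" for p
      using hausdorff2_unit_pos lpos[of p] by simp
  qed
  finally show ?thesis by (simp only: g_def[abs_def] B_def l_def)
qed

end

section \<open>Instability\<close>

context ruled_strip
begin

text \<open>The variation moves the intrinsic graph of \<open>f\<close> to that of \<open>f + l a\<close>, where \<open>a = u(y) \<zeta>(v) / D(y)\<close>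
  in the coordinates \<open>(y, v)\<close> with \<open>\<tau> = \<epsilon> D(y) v\<close>. As \<open>\<epsilon>\<close> tends to 0, the second variation divided by \<open>\<epsilon>\<close>
  tends to a positive multiple of \<open>\<integral> u'\<^sup>2 / D - n u\<^sup>2 / D\<^sup>2\<close>.\<close>

lemma unstable:
  assumes P0: "patch S 0 r0 V0 f0" and V0: "(0, 0) \<in> V0" and m0: "dd f0 (0, 1) (0, 0) \<noteq> 0"
  shows "\<not> H_stable S"
proof
  assume stable: "H_stable S"
  define m where "m = dd f0 (0, 1) (0, 0)"
  define n where "n = dd (burgers f0) (0, 1) (0, 0)"
  have n: "0 < n" and disc: "m\<^sup>2 < 2 * n"
    using discriminant[OF P0 V0 m_def n_def] m0 by (simp_all add: m_def)
  define D where "D y = 1 + m * y + n * y\<^sup>2 / 2" for y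
  define D' where "D' y = m + n * y" for y
  define d where "d = 1 - m\<^sup>2 / (2 * n)"
  have d: "0 < d" using n disc by (simp add: d_def field_simps)
  have Dd: "d \<le> D y" for y
    unfolding d_def D_def by (rule quadratic_ge[OF n])
  have Dpos: "0 < D y" for y using d Dd[of y] by linarith
  have Dn: "D y \<noteq> 0" for y using Dpos[of y] by simp
  have DD: "(D has_real_derivative D' y) (at y)" for y
    unfolding D_def D'_def by (auto intro!: derivative_eq_intros)
  have cD: "continuous_on X (\<lambda>x. D (h x))" if "continuous_on X h" for X and h :: "'z::topological_space \<Rightarrow> real"
    unfolding D_def by (intro continuous_intros that) auto
  have cD': "continuous_on X (\<lambda>x. D' (h x))" if "continuous_on X h" for X and h :: "'z::topological_space \<Rightarrow> real"
    unfolding D'_def by (intro continuous_intros that)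
  obtain M where M: "2 \<le> M"
    and neg: "integral {-M..M} (\<lambda>y. (bump' (y / M) / M)\<^sup>2 / D y - n * (bump (y / M))\<^sup>2 / (D y)\<^sup>2) < 0"
    unfolding D_def by (rule negative_cutoff[OF n disc])
  have M0: "0 < M" "0 < M + 1" using M by auto
  \<comment> \<open>One unit longer than the support, so that the closed rectangle lies over the
    open strip.\<close>
  define N where "N = M + 1"
  obtain r e f where re: "0 < r" "0 < e" and P: "patch S 0 r ({-N<..<N} \<times> {-e<..<e}) f"
    using tube_exists[of N] M0(2) unfolding N_def by blast
  define V where "V = {-N<..<N} \<times> {-e<..<e}"
  note P = P[folded V_def]
  note p = patchD[OF P]
  have oV: "(0, 0) \<in> V" using re M0 by (auto simp: V_def N_def)
  have coef: "dd f (0, 1) (y, 0) = D' y / D y" "dd (burgers f) (0, 1) (y, 0) = n / D y" if y: "\<bar>y\<bar> < N" for y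
  proof -
    have "dd f (0, 1) (y, 0) * D y = D' y" "dd (burgers f) (0, 1) (y, 0) * D y = n"
      unfolding D_def D'_def
      using coefficients[OF P[unfolded V_def] _ re(2) y, of m n] M0 patch_jet_unique[OF P0 P V0 oV]
      by (simp_all add: m_def n_def N_def)
    then show "dd f (0, 1) (y, 0) = D' y / D y" "dd (burgers f) (0, 1) (y, 0) = n / D y"
      using Dn[of y] by (simp_all add: field_simps)
  qed
  have fc1: "c1_on V f" and Bc1: "c1_on V (burgers f)" by (rule c2_on_c1[OF p(2)], rule c1_burgers[OF p(2)])
  have zero: "f (y, 0) = 0" "burgers f (y, 0) = 0" if "y \<in> {-N<..<N}" for y
    using patch_zero_section[OF P, of y] that re by (auto simp: V_def)
  obtain ft where ft: "continuous_on V ft" "\<And>y \<tau>. y \<in> {-N<..<N} \<Longrightarrow> \<bar>\<tau>\<bar> < e \<Longrightarrow> f (y, \<tau>) = \<tau> * ft (y, \<tau>)"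
      "\<And>y. y \<in> {-N<..<N} \<Longrightarrow> ft (y, 0) = dd f (0, 1) (y, 0)"
    using hadamard[OF fc1[unfolded V_def] re(2) zero(1)] unfolding V_def by metis
  obtain Bt where Bt: "continuous_on V Bt" "\<And>y \<tau>. y \<in> {-N<..<N} \<Longrightarrow> \<bar>\<tau>\<bar> < e \<Longrightarrow> burgers f (y, \<tau>) = \<tau> * Bt (y, \<tau>)"
      "\<And>y. y \<in> {-N<..<N} \<Longrightarrow> Bt (y, 0) = dd (burgers f) (0, 1) (y, 0)"
    using hadamard[OF Bc1[unfolded V_def] re(2) zero(2)] unfolding V_def by metis
  define Q where "Q = cbox (-M, -1) (M, 1 :: real)"
  have Qmem: "p \<in> Q \<longleftrightarrow> \<bar>fst p\<bar> \<le> M \<and> \<bar>snd p\<bar> \<le> 1" for p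
    by (cases p) (auto simp: Q_def abs_le_iff)
  define Dm where "Dm = 1 + \<bar>m\<bar> * M + n * M\<^sup>2 / 2"
  have Dm: "D y \<le> Dm" if "\<bar>y\<bar> \<le> M" for y
  proof -
    have "m * y \<le> \<bar>m\<bar> * \<bar>y\<bar>" by (metis abs_ge_self abs_mult)
    also have "\<dots> \<le> \<bar>m\<bar> * M" using that by (intro mult_left_mono) auto
    finally have 1: "m * y \<le> \<bar>m\<bar> * M" .
    have "y\<^sup>2 \<le> M\<^sup>2" using that M0 by (intro abs_le_square_iff[THEN iffD1]) auto
    then have "n * y\<^sup>2 \<le> n * M\<^sup>2" using n by (intro mult_left_mono) auto
    then show ?thesis using 1 by (simp add: D_def Dm_def)
  qed
  have Dm0: "0 < Dm" using Dm[of 0] Dpos[of 0] M0 by simp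
  \<comment> \<open>Keeps \<tau> = \<epsilon> D v within \<open>e / 2\<close> for all points of the
    rectangle.\<close>
  define \<epsilon>1 where "\<epsilon>1 = e / (2 * Dm)"
  have \<epsilon>1: "0 < \<epsilon>1" using re Dm0 by (simp add: \<epsilon>1_def)
  define tq where "tq \<epsilon> p = (fst p, \<epsilon> * D (fst p) * snd p)" for \<epsilon> :: real and p :: "real \<times> real"
  have small: "\<bar>\<epsilon> * D (fst p) * snd p\<bar> < e" if p: "p \<in> Q" "0 \<le> \<epsilon>" "\<epsilon> \<le> \<epsilon>1" for \<epsilon> p
  proof -
    have "\<bar>\<epsilon> * D (fst p) * snd p\<bar> = \<epsilon> * D (fst p) * \<bar>snd p\<bar>"
      using p Dpos[of "fst p"] by (simp add: abs_mult)
    also have "\<dots> \<le> \<epsilon>1 * Dm * 1"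
      using p Dm[of "fst p"] Dpos[of "fst p"] Dm0 \<epsilon>1 by (intro mult_mono) (auto simp: Qmem)
    also have "\<dots> = e / 2" using Dm0 by (simp add: \<epsilon>1_def)
    finally show ?thesis using re by simp
  qed
  have fstN: "fst p \<in> {-N<..<N}" if "p \<in> Q" for p
    using that by (auto simp: Qmem N_def abs_le_iff)
  have tqV: "tq \<epsilon> p \<in> V" if "p \<in> Q" "0 \<le> \<epsilon>" "\<epsilon> \<le> \<epsilon>1" for \<epsilon> p
    using fstN[OF that(1)] small[OF that] by (auto simp: tq_def V_def abs_less_iff)
  \<comment> \<open>\<open>b\<close> is the coefficient of \<open>l\<close> in the Burgers
    expression of the deformed graph, and \<open>I\<close> the integrand of the second variation
    divided by \<open>hausdorff2_unit * \<epsilon>\<close>. With the quotients \<open>ft\<close> and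
    \<open>Bt\<close> in place of \<open>f / \<tau>\<close> and \<open>B / \<tau>\<close>, both make
    sense and are continuous at \<epsilon> = 0.\<close>
  define b where "b \<epsilon> p = (bump' (fst p / M) / M / D (fst p) - bump (fst p / M) * D' (fst p) / (D (fst p))\<^sup>2) * bump (snd p)
      - bump (fst p / M) * bump' (snd p) * snd p * D' (fst p) / (D (fst p))\<^sup>2
      + (D (fst p) * snd p * ft (tq \<epsilon> p)) * bump (fst p / M) * bump' (snd p) / (D (fst p))\<^sup>2
      + bump (fst p / M) / D (fst p) * bump (snd p) * dd f (0, 1) (tq \<epsilon> p)" for \<epsilon> and p :: "real \<times> real"
  define I where "I \<epsilon> p = D (fst p) * ((b \<epsilon> p)\<^sup>2 / sqrt (1 + (burgers f (tq \<epsilon> p))\<^sup>2) ^ 3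
      + 2 * snd p * Bt (tq \<epsilon> p) * (bump (fst p / M))\<^sup>2 * bump (snd p) * bump' (snd p) / (D (fst p))\<^sup>2
        / sqrt (1 + (burgers f (tq \<epsilon> p))\<^sup>2))" for \<epsilon> and p :: "real \<times> real"
  have Rn: "sqrt (1 + z\<^sup>2) \<noteq> 0" for z :: real
  proof -
    have "0 < 1 + z\<^sup>2" by (simp add: add_pos_nonneg)
    then show ?thesis by simp
  qed
  have contI: "continuous_on ({0..\<epsilon>1} \<times> Q) (\<lambda>(\<epsilon>, p). I \<epsilon> p)"
  proof -
    let ?X = "{0..\<epsilon>1} \<times> Q"
    have ct: "continuous_on ?X (\<lambda>z. tq (fst z) (snd z))"
      unfolding tq_def by (intro continuous_intros cD)
    have cV: "continuous_on ?X (\<lambda>z. k (tq (fst z) (snd z)))" if "continuous_on V k" for k :: "real \<times> real \<Rightarrow> real"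
      by (rule continuous_on_compose2[OF that ct]) (use tqV in auto)
    note c = cV[OF ft(1)] cV[OF Bt(1)] cV[OF c1_on_continuous[OF Bc1]] cV[OF c1_on_continuous_dd[OF fc1]]
    have "continuous_on ?X (\<lambda>z. b (fst z) (snd z))"
      unfolding b_def by (intro continuous_intros cD cD' c) (use M0 Dn in auto)
    then have "continuous_on ?X (\<lambda>z. I (fst z) (snd z))"
      unfolding I_def by (intro continuous_intros cD c) (use M0 Dn Rn in auto)
    then show ?thesis by (simp add: case_prod_beta)
  qed
  have J: "continuous_on {0..\<epsilon>1} (\<lambda>\<epsilon>. integral Q (I \<epsilon>))"
    using contI unfolding Q_def by (rule integral_continuous_on_param)
  have J0: "integral Q (I 0) < 0"
  proof -
    let ?u = "\<lambda>y. (bump' (y / M) / M)\<^sup>2 / D y" and ?w = "\<lambda>y. n * (bump (y / M))\<^sup>2 / (D y)\<^sup>2"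
    let ?k = "\<lambda>p. ?u (fst p) * (bump (snd p))\<^sup>2 + ?w (fst p) * (2 * snd p * bump (snd p) * bump' (snd p))"
    let ?Z = "integral {-1..1} (\<lambda>v. (bump v)\<^sup>2)"
    have "I 0 p = ?k p" if "p \<in> Q" for p
    proof -
      let ?y = "fst p"
      have t: "tq 0 p = (?y, 0)" by (simp add: tq_def)
      have yN: "\<bar>?y\<bar> < N" using that by (auto simp: Qmem N_def)
      \<comment> \<open>On the axis \<open>ft\<close> and the \<tau>-derivative of \<open>f\<close>
        both equal \<open>D' / D\<close>, and the four terms with \<open>D'\<close> cancel in pairs:
        one pair because of the factor 1 / D in the test function, the other because
        \<open>v\<close> is scaled by \<open>D\<close>.\<close>
      have b0: "b 0 p = bump' (?y / M) / M / D ?y * bump (snd p)"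
        unfolding b_def t ft(3)[OF fstN[OF that]] coef(1)[OF yN] using Dn[of ?y]
        by (simp add: field_simps power2_eq_square)
      have alg: "\<Delta> * ((x / \<Delta> * z)\<^sup>2 + 2 * v * (n / \<Delta>) * U * z * z' / \<Delta>\<^sup>2) = x\<^sup>2 / \<Delta> * z\<^sup>2 + n * U / \<Delta>\<^sup>2 * (2 * v * z * z')"
        if "\<Delta> \<noteq> 0" for \<Delta> x z v U z' :: real
        using that by (simp add: field_simps power2_eq_square)
      have "I 0 p = D ?y * ((b 0 p)\<^sup>2 + 2 * snd p * (n / D ?y) * (bump (?y / M))\<^sup>2 * bump (snd p) * bump' (snd p) / (D ?y)\<^sup>2)"
        unfolding I_def t Bt(3)[OF fstN[OF that]] coef(2)[OF yN] zero(2)[OF fstN[OF that]] by simp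
      from trans[OF this[unfolded b0] alg[OF Dn[of ?y], of "bump' (?y / M) / M" "bump (snd p)" "snd p" "(bump (?y / M))\<^sup>2" "bump' (snd p)"]] show ?thesis .
    qed
    then have "integral Q (I 0) = integral Q ?k" by (rule integral_cong)
    also have "\<dots> = integral (cbox (-M) M) (\<lambda>y. integral (cbox (-1) 1) (\<lambda>v. ?k (y, v)))"
      unfolding Q_def
      by (rule integral_prod_continuous) (intro continuous_intros cD, use M0 Dn in auto)
    also have "\<dots> = integral (cbox (-M) M) (\<lambda>y. ?Z * (?u y - ?w y))"
    proof (rule integral_cong)
      fix y
      have "integral {-1..1} (\<lambda>v. ?u y * (bump v)\<^sup>2 + ?w y * (2 * v * bump v * bump' v)) =
          integral {-1..1} (\<lambda>v. ?u y * (bump v)\<^sup>2) + integral {-1..1} (\<lambda>v. ?w y * (2 * v * bump v * bump' v))"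
        by (intro integral_add integrable_continuous_real continuous_intros)
      also have "\<dots> = ?u y * ?Z + ?w y * integral {-1..1} (\<lambda>v. 2 * v * bump v * bump' v)"
        by (simp only: integral_mult_right)
      also have "\<dots> = ?Z * (?u y - ?w y)"
        unfolding integral_bump_parts by (simp add: algebra_simps)
      finally show "integral (cbox (-1) 1) (\<lambda>v. ?k (y, v)) = ?Z * (?u y - ?w y)" by simp
    qed
    also have "\<dots> = ?Z * integral {-M..M} (\<lambda>y. ?u y - ?w y)"
      by (simp only: integral_mult_right cbox_interval)
    also have "\<dots> < 0" using integral_bump_pos neg by (rule mult_pos_neg)
    finally show ?thesis .
  qed
  \<comment> \<open>The parameter integral is continuous and negative at 0, so it is still negative
    at some positive \<epsilon>, where there is an actual test function.\<close>
  obtain \<delta> where \<delta>: "0 < \<delta>" "\<forall>\<epsilon>\<in>{0..\<epsilon>1}. dist \<epsilon> 0 < \<delta> \<longrightarrow> dist (integral Q (I \<epsilon>)) (integral Q (I 0)) < - integral Q (I 0)"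
    using J[unfolded continuous_on_iff, rule_format, of 0 "- integral Q (I 0)"] J0 \<epsilon>1 by auto
  define \<epsilon> where "\<epsilon> = min (\<delta> / 2) \<epsilon>1"
  have \<epsilon>: "0 < \<epsilon>" "\<epsilon> \<le> \<epsilon>1" "\<epsilon> < \<delta>" using \<delta>(1) \<epsilon>1 by (auto simp: \<epsilon>_def)
  have Jneg: "integral Q (I \<epsilon>) < 0"
    using \<delta>(2)[rule_format, of \<epsilon>] \<epsilon> by (simp add: dist_real_def abs_less_iff)
  define a where "a q = bump (fst q / M) / D (fst q) * bump (snd q / (\<epsilon> * D (fst q)))" for q
  have eD: "\<epsilon> * D y \<noteq> 0" for y using \<epsilon> Dn by simp
  have c2D: "c2_on UNIV (\<lambda>q :: real \<times> real. D (fst q))"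
    unfolding D_def power2_eq_square by (intro c2_intros) auto
  have ac2: "c2_on UNIV a"
    unfolding a_def
    by (intro c2_on_mult c2_on_divide c2_on_compose[OF _ c2_bump] c2_on_const c2_on_fst c2_on_snd c2_on_id c2D)
      (use M0 Dn eD in auto)
  have da: "dd a (1, 0) q = (bump' (fst q / M) / M / D (fst q) - bump (fst q / M) * D' (fst q) / (D (fst q))\<^sup>2) * bump (snd q / (\<epsilon> * D (fst q)))
        - bump (fst q / M) / D (fst q) * bump' (snd q / (\<epsilon> * D (fst q))) * (snd q * D' (fst q) / (\<epsilon> * (D (fst q))\<^sup>2))"
    "dd a (0, 1) q = bump (fst q / M) / D (fst q) * bump' (snd q / (\<epsilon> * D (fst q))) / (\<epsilon> * D (fst q))" for q
  proof -
    obtain y \<tau> where q: "q = (y, \<tau>)" by (metis surj_pair)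
    have ad: "a differentiable at q" using ac2 unfolding c2_on_def by blast
    have dir: "((\<lambda>h. a (q + h *\<^sub>R v)) has_real_derivative dd a v q) (at 0)" for v
    proof -
      have "((\<lambda>h. q + h *\<^sub>R v) has_derivative (\<lambda>h. h *\<^sub>R v)) (at 0)" by (auto intro!: derivative_eq_intros)
      then have "((\<lambda>h. a (q + h *\<^sub>R v)) has_derivative (\<lambda>h. dd a (h *\<^sub>R v) q)) (at 0)"
        by (rule has_derivative_compose[where g = a and g' = "\<lambda>v. dd a v q"]) (simp add: has_derivative_ddI[OF ad])
      moreover have "(\<lambda>h. dd a (h *\<^sub>R v) q) = (*) (dd a v q)"
        by (rule ext) (simp only: dd_linear(2)[OF ad] real_scaleR_def mult.commute)
      ultimately show ?thesis by (simp only: has_field_derivative_def)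
    qed
    have Dc: "((\<lambda>h. D (y + h)) has_real_derivative D' y) (at 0)"
      unfolding D_def D'_def by (auto intro!: derivative_eq_intros)
    have b1: "((\<lambda>h. bump ((y + h) / M)) has_real_derivative bump' (y / M) * (1 / M)) (at 0)"
    proof -
      have "((\<lambda>h. (y + h) / M) has_real_derivative 1 / M) (at 0)" using M0 by (auto intro!: derivative_eq_intros)
      from DERIV_chain2[where f = bump, OF DERIV_bump this] show ?thesis by simp
    qed
    have b2: "((\<lambda>h. bump (\<tau> / (\<epsilon> * D (y + h)))) has_real_derivative bump' (\<tau> / (\<epsilon> * D y)) * (- (\<tau> * D' y / (\<epsilon> * (D y)\<^sup>2)))) (at 0)"
    proof -
      have "((\<lambda>h. \<epsilon> * D (y + h)) has_real_derivative \<epsilon> * D' y) (at 0)" by (rule DERIV_cmult[OF Dc])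
      from DERIV_divide[OF DERIV_const[of \<tau>] this]
      have "((\<lambda>h. \<tau> / (\<epsilon> * D (y + h))) has_real_derivative - (\<tau> * D' y / (\<epsilon> * (D y)\<^sup>2))) (at 0)"
        using \<epsilon> Dn[of y] by (simp add: power2_eq_square field_simps)
      from DERIV_chain2[where f = bump, OF DERIV_bump this] show ?thesis by simp
    qed
    have "((\<lambda>h. bump ((y + h) / M) / D (y + h)) has_real_derivative (bump' (y / M) * (1 / M) * D y - bump (y / M) * D' y) / (D y * D y)) (at 0)"
      using DERIV_divide[OF b1 Dc] Dn[of y] by simp
    from DERIV_mult[OF this b2]
    have "((\<lambda>h. a (q + h *\<^sub>R (1, 0))) has_real_derivative
        (bump' (y / M) * (1 / M) * D y - bump (y / M) * D' y) / (D y * D y) * bump (\<tau> / (\<epsilon> * D y)) +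
        bump' (\<tau> / (\<epsilon> * D y)) * (- (\<tau> * D' y / (\<epsilon> * (D y)\<^sup>2))) * (bump (y / M) / D y)) (at 0)"
      by (simp add: a_def q)
    from DERIV_unique[OF dir this] show "dd a (1, 0) q = (bump' (fst q / M) / M / D (fst q) - bump (fst q / M) * D' (fst q) / (D (fst q))\<^sup>2) * bump (snd q / (\<epsilon> * D (fst q)))
        - bump (fst q / M) / D (fst q) * bump' (snd q / (\<epsilon> * D (fst q))) * (snd q * D' (fst q) / (\<epsilon> * (D (fst q))\<^sup>2))"
      using Dn[of y] M0 by (simp add: q power2_eq_square diff_divide_distrib mult_ac)
    have "((\<lambda>h. (\<tau> + h) / (\<epsilon> * D y)) has_real_derivative 1 / (\<epsilon> * D y)) (at 0)"
      using eD[of y] by (auto intro!: derivative_eq_intros)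
    from DERIV_cmult[OF DERIV_chain2[where f = bump, OF DERIV_bump this], of "bump (y / M) / D y"]
    have "((\<lambda>h. a (q + h *\<^sub>R (0, 1))) has_real_derivative bump (y / M) / D y * (bump' (\<tau> / (\<epsilon> * D y)) * (1 / (\<epsilon> * D y)))) (at 0)"
      by (simp add: a_def q)
    from DERIV_unique[OF dir this] show "dd a (0, 1) q = bump (fst q / M) / D (fst q) * bump' (snd q / (\<epsilon> * D (fst q))) / (\<epsilon> * D (fst q))"
      by (simp add: q)
  qed
  define t where "t = tq \<epsilon>"
  have tV: "t p \<in> V" if "p \<in> Q" for p using tqV[OF that] \<epsilon> by (simp add: t_def)
  have ct: "continuous_on Q t" unfolding t_def tq_def by (intro continuous_intros cD)
  have cQ: "compact Q" by (simp add: Q_def compact_cbox)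
  have supp: "q \<in> t ` Q" if "a q \<noteq> 0" for q
  proof -
    have "bump (fst q / M) \<noteq> 0" "bump (snd q / (\<epsilon> * D (fst q))) \<noteq> 0" using that by (auto simp: a_def)
    then have "\<bar>fst q / M\<bar> < 1" "\<bar>snd q / (\<epsilon> * D (fst q))\<bar> < 1" by (auto dest: bump_nonzero)
    then have "(fst q, snd q / (\<epsilon> * D (fst q))) \<in> Q" using M0 by (simp add: Qmem abs_divide)
    moreover have "t (fst q, snd q / (\<epsilon> * D (fst q))) = q" using eD by (simp add: t_def tq_def)
    ultimately show ?thesis by (metis imageI)
  qed
  have a_le: "\<bar>a q\<bar> \<le> 1 / d" for q
  proof -
    have "\<bar>a q\<bar> = bump (fst q / M) * bump (snd q / (\<epsilon> * D (fst q))) / D (fst q)"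
      using bump_le Dpos[of "fst q"] by (simp add: a_def abs_mult)
    also have "\<dots> \<le> (1 * 1) / d"
      using bump_le Dd[of "fst q"] d by (intro frac_le mult_mono) auto
    finally show ?thesis by simp
  qed
  have "(0, 0) \<in> Q" using M0 by (simp add: Qmem)
  then have "Q \<noteq> {}" by blast
  then obtain q1 where q1: "q1 \<in> t ` Q" "\<And>q. q \<in> t ` Q \<Longrightarrow> \<bar>f q\<bar> \<le> \<bar>f q1\<bar>"
    using continuous_attains_sup[of "t ` Q" "\<lambda>q. \<bar>f q\<bar>"] compact_continuous_image[OF ct cQ]
      continuous_on_rabs[OF continuous_on_subset[OF c1_on_continuous[OF fc1], of "t ` Q"]] tV by blast
  define \<rho> where "\<rho> = \<bar>f q1\<bar>"
  have \<rho>: "\<rho> < r" using p(3)[of q1] q1(1) tV by (auto simp: \<rho>_def)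
  \<comment> \<open>On the support \<open>\<bar>f\<bar>\<close> is at most
    \<open>\<rho> < r\<close>, and \<open>\<bar>a\<bar>\<close> is at most \<open>1 / d\<close>
    everywhere; so for smaller \<open>l\<close> the deformed graph stays inside the tube.\<close>
  define l0 where "l0 = (r - \<rho>) * d"
  have l0: "0 < l0" using \<rho> d by (simp add: l0_def)
  define F where "F l q = f q + l * a q" for l q
  have Fr: "\<bar>F l q - 0\<bar> < r" if l: "\<bar>l\<bar> < l0" and q: "q \<in> V" for l q
  proof (cases "a q = 0")
    case True
    then show ?thesis using p(3)[OF q] by (simp add: F_def)
  next
    case False
    have "\<bar>l * a q\<bar> \<le> \<bar>l\<bar> * (1 / d)" unfolding abs_mult by (intro mult_left_mono a_le) simp
    also have "\<dots> < l0 * (1 / d)" using l d by (intro mult_strict_right_mono) auto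
    also have "\<dots> = r - \<rho>" using d by (simp add: l0_def)
    finally have "\<bar>l * a q\<bar> < r - \<rho>" .
    moreover have "\<bar>f q\<bar> \<le> \<rho>" using q1(2)[OF supp[OF False]] by (simp add: \<rho>_def)
    ultimately show ?thesis by (simp add: F_def)
  qed
  \<comment> \<open>The cutoff may jump at the sides of the tube. This is harmless: on
    \<open>S\<close> it vanishes outside the compact set \<open>K\<close>, which lies inside the
    tube.\<close>
  define A where "A g = (if g \<in> tube 0 r V then a (snd (\<Psi> g)) else 0)" for g
  define X where "X = variation_field (\<lambda>g. c * A g) (\<lambda>g. s * A g) (\<lambda>g. 0)"
  have X: "X g = A g *\<^sub>R E1 c s g" for g
    by (simp add: X_def variation_field_def E1_def scaleR_add_right mult.commute del: X1.simps X2.simps TT.simps)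
  have graph_tube: "\<Phi> (x, q) \<in> tube 0 r V \<longleftrightarrow> q \<in> V \<and> \<bar>x\<bar> < r" for x q
    by (auto simp: tube_def abs_less_iff)
  have Aq: "A (\<Phi> (f q, q)) = a q" if "q \<in> V" for q
    using p(3)[OF that] that by (simp add: A_def graph_tube)
  have move: "deform X l (\<Phi> (f q, q)) = \<Phi> (F l q, q)" if "q \<in> V" for l q
    unfolding deform_def X Aq[OF that] F_def chart_shift by simp
  have PF: "patch (deform X l ` S) 0 r V (F l)" if l: "\<bar>l\<bar> < l0" for l
    unfolding patch_def
  proof (intro conjI ballI allI impI)
    show "open V" by (rule p(1))
    show "c2_on V (F l)"
      unfolding F_def by (intro c2_on_add c2_on_mult c2_on_const p(1,2) c2_on_subset[OF ac2]) auto
    fix q assume q: "q \<in> V"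
    show "\<bar>F l q - 0\<bar> < r" by (rule Fr[OF l q])
    fix x :: real assume x: "\<bar>x - 0\<bar> < r"
    show "\<Phi> (x, q) \<in> deform X l ` S \<longleftrightarrow> x = F l q"
    proof
      assume "x = F l q"
      then have "\<Phi> (x, q) = deform X l (\<Phi> (f q, q))" using move[OF q] by simp
      then show "\<Phi> (x, q) \<in> deform X l ` S" using p(5)[OF q] by blast
    next
      assume "\<Phi> (x, q) \<in> deform X l ` S"
      then obtain g where g: "g \<in> S" "\<Phi> (x, q) = deform X l g" by blast
      \<comment> \<open>Points of the surface outside the tube do not move, so none of them can
        arrive at a point of the tube.\<close>
      have "g \<in> tube 0 r V"
      proof (rule ccontr)
        assume "g \<notin> tube 0 r V"
        then have "\<Phi> (x, q) = g" using g(2) by (simp add: deform_def X A_def)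
        then show False using \<open>g \<notin> tube 0 r V\<close> q x graph_tube[of x q] by simp
      qed
      then have gV: "snd (\<Psi> g) \<in> V" "\<bar>fst (\<Psi> g) - 0\<bar> < r" by (auto simp: tube_def abs_less_iff)
      have "\<Phi> (fst (\<Psi> g), snd (\<Psi> g)) = g" by simp
      then have "fst (\<Psi> g) = f (snd (\<Psi> g))" using p(4)[OF gV] g(1) by metis
      then have "g = \<Phi> (f (snd (\<Psi> g)), snd (\<Psi> g))" by (metis chart_unchart prod.collapse)
      then have "\<Phi> (x, q) = \<Phi> (F l (snd (\<Psi> g)), snd (\<Psi> g))" using move[OF gV(1), of l] g(2) by simp
      then have "\<Psi> (\<Phi> (x, q)) = \<Psi> (\<Phi> (F l (snd (\<Psi> g)), snd (\<Psi> g)))" by simp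
      then show "x = F l q" by (simp only: unchart_chart) simp
    qed
  qed
  define K where "K = (\<lambda>p. \<Phi> (f (t p), t p)) ` Q"
  have KS: "K \<subseteq> S" unfolding K_def using p(5) tV by blast
  have Kc: "compact K"
    unfolding K_def
  proof (rule compact_continuous_image[OF _ cQ])
    have "continuous_on Q (\<lambda>p. f (t p))"
      by (rule continuous_on_compose2[OF c1_on_continuous[OF fc1] ct]) (use tV in auto)
    then show "continuous_on Q (\<lambda>p. \<Phi> (f (t p), t p))"
      by (intro continuous_on_compose2[OF cont_chart[of UNIV]] continuous_intros ct) auto
  qed
  have A0: "A g = 0" if g: "g \<in> S" "g \<notin> K" for g
  proof (rule ccontr)
    assume nz: "A g \<noteq> 0"
    then have gt: "g \<in> tube 0 r V" and anz: "a (snd (\<Psi> g)) \<noteq> 0" by (auto simp: A_def split: if_splits)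
    then have gV: "snd (\<Psi> g) \<in> V" "\<bar>fst (\<Psi> g) - 0\<bar> < r" by (auto simp: tube_def abs_less_iff)
    have "\<Phi> (fst (\<Psi> g), snd (\<Psi> g)) = g" by simp
    then have "fst (\<Psi> g) = f (snd (\<Psi> g))" using p(4)[OF gV] g(1) by metis
    then have geq: "g = \<Phi> (f (snd (\<Psi> g)), snd (\<Psi> g))" by (metis chart_unchart prod.collapse)
    obtain z where z: "z \<in> Q" "snd (\<Psi> g) = t z" using supp[OF anz] by blast
    have "g = \<Phi> (f (t z), t z)" using geq unfolding z(2) .
    then have "g \<in> K" unfolding K_def using z(1) by (rule image_eqI)
    then show False using g by blast
  qed
  have C2A: "C2_on_surface S (\<lambda>g. k * A g)" for k
    unfolding C2_on_surface_def C2_on_eq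
  proof
    fix g assume g: "g \<in> S"
    show "\<exists>U w. open U \<and> g \<in> U \<and> c2_on U w \<and> (\<forall>h\<in>S \<inter> U. k * A h = w h)"
    proof (cases "g \<in> K")
      case True
      have oT: "open (tube 0 r V)" by (rule open_tube[OF p(1)])
      have "c2_on (tube 0 r V) (\<lambda>h. k * a (snd (\<Psi> h)))"
        by (intro c2_on_mult c2_on_const oT c2_on_compose[OF oT ac2] c2_on_snd c2_unchart) auto
      moreover have "g \<in> tube 0 r V"
      proof -
        obtain z where z: "z \<in> Q" "g = \<Phi> (f (t z), t z)" using True unfolding K_def by blast
        show ?thesis using p(3)[OF tV[OF z(1)]] tV[OF z(1)] by (simp add: z(2) graph_tube)
      qed
      ultimately show ?thesis
        using oT by (intro exI[of _ "tube 0 r V"] exI[of _ "\<lambda>h. k * a (snd (\<Psi> h))"]) (simp add: A_def)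
    next
      case False
      have oK: "open (- K)" by (rule open_Compl[OF compact_imp_closed[OF Kc]])
      show ?thesis
        using False A0 by (intro exI[of _ "- K"] exI[of _ "\<lambda>h. 0"]) (simp add: oK c2_on_const)
    qed
  qed
  have "0 \<le> second_variation S K X"
  proof -
    have "C2_on_surface S (\<lambda>g. 0)" using C2A[of 0] by simp
    moreover have "\<forall>g\<in>S - K. c * A g = 0 \<and> s * A g = 0 \<and> (0 :: real) = 0" using A0 by simp
    ultimately show ?thesis
      using stable C2A Kc KS unfolding H_stable_def X_def by blast
  qed
  moreover have "second_variation S K X < 0"
  proof -
    let ?per = "\<lambda>l. enn2real (H_perimeter (deform X l ` S) (deform X l ` K))"
    define w where "w p = hausdorff2_unit * (\<epsilon> * D (fst p))" for p :: "real \<times> real"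
    define p0 where "p0 p = burgers f (t p)" for p
    define p1 where "p1 p = dd a (1, 0) (t p) + f (t p) * dd a (0, 1) (t p) + a (t p) * dd f (0, 1) (t p)" for p
    define p2 where "p2 p = a (t p) * dd a (0, 1) (t p)" for p
    have cV: "continuous_on Q (\<lambda>p. k (t p))" if "continuous_on V k" for k :: "real \<times> real \<Rightarrow> real"
      by (rule continuous_on_compose2[OF that ct]) (use tV in auto)
    have ac1: "c1_on V a" by (rule c1_on_subset[OF c2_on_c1[OF ac2]]) simp
    note cc = cV[OF c1_on_continuous_dd[OF ac1]] cV[OF c1_on_continuous[OF ac1]] cV[OF c1_on_continuous[OF fc1]]
      cV[OF c1_on_continuous_dd[OF fc1]] cV[OF c1_on_continuous[OF Bc1]]
    \<comment> \<open>\<open>burgers\<close> is quadratic in its argument, so the expansion in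
      \<open>l\<close> ends with the term \<open>a * dd a (0, 1)\<close>.\<close>
    have burg: "burgers (F l) (t p) = p0 p + l * p1 p + l\<^sup>2 * p2 p" if "p \<in> Q" for l p
    proof -
      have fd: "f differentiable at (t p)" and ad: "a differentiable at (t p)"
        using p(6)[OF tV[OF that]] ac2 unfolding c2_on_def by blast+
      have "(F l has_derivative (\<lambda>v. dd f v (t p) + l * dd a v (t p))) (at (t p))"
        unfolding F_def[abs_def]
        by (intro has_derivative_add has_derivative_mult_right has_derivative_ddI fd ad)
      then have "dd (F l) v (t p) = dd f v (t p) + l * dd a v (t p)" for v by (rule dd_eqI)
      then show ?thesis
        by (simp add: burgers_def F_def p0_def p1_def p2_def power2_eq_square algebra_simps)
    qed
    have per: "?per l = integral (cbox (-M, -1) (M, 1)) (\<lambda>p. w p * sqrt (1 + (p0 p + l * p1 p + l\<^sup>2 * p2 p)\<^sup>2))"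
      if l: "\<bar>l\<bar> < l0" for l
    proof -
      have "deform X l ` K = (\<lambda>p. \<Phi> (F l (t p), t p)) ` Q"
        unfolding K_def image_image using move tV by (intro image_cong refl) blast
      moreover have "H_perimeter (deform X l ` S) ((\<lambda>p. \<Phi> (F l (t p), t p)) ` Q) =
          ennreal (integral Q (\<lambda>p. hausdorff2_unit * (\<epsilon> * D (fst p)) * sqrt (1 + (burgers (F l) (t p))\<^sup>2)))"
        unfolding t_def tq_def[abs_def] Q_def
      proof (rule perimeter_patch[OF PF[OF l] \<epsilon>(1) Dpos DD])
        show "continuous_on UNIV D'" unfolding D'_def by (intro continuous_intros)
        show "(fst p, \<epsilon> * D (fst p) * snd p) \<in> V" if "p \<in> cbox (- M, - 1) (M, 1)" for p
          using tV[of p] that by (simp add: Q_def t_def tq_def)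
      qed
      moreover have "integral Q (\<lambda>p. hausdorff2_unit * (\<epsilon> * D (fst p)) * sqrt (1 + (burgers (F l) (t p))\<^sup>2)) =
          integral Q (\<lambda>p. w p * sqrt (1 + (p0 p + l * p1 p + l\<^sup>2 * p2 p)\<^sup>2))"
        by (rule integral_cong) (simp add: burg w_def)
      moreover have "0 \<le> integral Q (\<lambda>p. w p * sqrt (1 + (p0 p + l * p1 p + l\<^sup>2 * p2 p)\<^sup>2))"
      proof (rule integral_nonneg)
        show "(\<lambda>p. w p * sqrt (1 + (p0 p + l * p1 p + l\<^sup>2 * p2 p)\<^sup>2)) integrable_on Q"
          unfolding Q_def
          by (rule integrable_continuous, fold Q_def, unfold w_def p0_def p1_def p2_def)
            (intro continuous_intros cD cc)
        show "0 \<le> w p * sqrt (1 + (p0 p + l * p1 p + l\<^sup>2 * p2 p)\<^sup>2)" for p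
          using hausdorff2_unit_pos \<epsilon> Dpos[of "fst p"] by (simp add: w_def)
      qed
      ultimately show ?thesis by (simp add: Q_def)
    qed
    have "second_variation S K X = integral (cbox (-M, -1) (M, 1))
        (\<lambda>p. w p * ((p1 p)\<^sup>2 / sqrt (1 + (p0 p)\<^sup>2) ^ 3 + 2 * p0 p * p2 p / sqrt (1 + (p0 p)\<^sup>2)))"
      unfolding second_variation_def
    proof (rule second_deriv_area_integral[OF _ _ _ _ l0 per], fold Q_def)
      show "continuous_on Q w" unfolding w_def by (intro continuous_intros cD)
      show "continuous_on Q p0" unfolding p0_def by (rule cc)
      show "continuous_on Q p1" unfolding p1_def by (intro continuous_intros cc)
      show "continuous_on Q p2" unfolding p2_def by (intro continuous_intros cc)
    qed
    also have "\<dots> = integral Q (\<lambda>p. (hausdorff2_unit * \<epsilon>) * I \<epsilon> p)"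
      unfolding Q_def[symmetric]
    proof (rule integral_cong)
      fix p assume pQ: "p \<in> Q"
      obtain y v where pv: "p = (y, v)" by (metis surj_pair)
      have tp: "t p = (y, \<epsilon> * D y * v)" by (simp add: t_def tq_def pv)
      have yN: "y \<in> {-N<..<N}" using fstN[OF pQ] by (simp add: pv)
      have sm: "\<bar>\<epsilon> * D y * v\<bar> < e" using small[OF pQ, of \<epsilon>] \<epsilon> by (simp add: pv)
      have fe: "f (t p) = \<epsilon> * D y * v * ft (t p)" unfolding tp by (rule ft(2)[OF yN sm])
      have Be: "p0 p = \<epsilon> * D y * v * Bt (t p)" unfolding p0_def tp by (rule Bt(2)[OF yN sm])
      have v: "\<epsilon> * D y * v / (\<epsilon> * D y) = v" using eD[of y] by simp
      have a: "a (t p) = bump (y / M) / D y * bump v" unfolding a_def tp by (simp add: v)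
      have a2: "dd a (0, 1) (t p) = bump (y / M) / D y * bump' v / (\<epsilon> * D y)" unfolding da tp by (simp add: v)
      have a1: "dd a (1, 0) (t p) = (bump' (y / M) / M / D y - bump (y / M) * D' y / (D y)\<^sup>2) * bump v
          - bump (y / M) * bump' v * v * D' y / (D y)\<^sup>2"
      proof -
        have "\<epsilon> * D y * v * D' y / (\<epsilon> * (D y)\<^sup>2) = v * D' y / D y" using \<epsilon>(1) Dn[of y] by (simp add: power2_eq_square)
        then show ?thesis unfolding da tp using Dn[of y] by (simp add: v power2_eq_square)
      qed
      have b1: "p1 p = b \<epsilon> p"
      proof -
        have "f (t p) * dd a (0, 1) (t p) = (D y * v * ft (t p)) * bump (y / M) * bump' v / (D y)\<^sup>2"
          unfolding fe a2 using \<epsilon>(1) Dn[of y] by (simp add: power2_eq_square)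
        then show ?thesis
          unfolding p1_def b_def a a1 t_def[symmetric] by (simp add: pv)
      qed
      \<comment> \<open>The factor \<open>\<epsilon> * D y\<close> contained in \<open>p0\<close>
        cancels the denominator of \<open>dd a (0, 1)\<close>.\<close>
      have b2: "2 * p0 p * p2 p = 2 * v * Bt (t p) * (bump (y / M))\<^sup>2 * bump v * bump' v / (D y)\<^sup>2"
        unfolding Be p2_def a a2 using \<epsilon>(1) Dn[of y] by (simp add: power2_eq_square)
      show "w p * ((p1 p)\<^sup>2 / sqrt (1 + (p0 p)\<^sup>2) ^ 3 + 2 * p0 p * p2 p / sqrt (1 + (p0 p)\<^sup>2)) = (hausdorff2_unit * \<epsilon>) * I \<epsilon> p"
        unfolding b1 b2 unfolding I_def w_def p0_def t_def[symmetric] by (simp add: pv mult.assoc)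
    qed
    also have "\<dots> = (hausdorff2_unit * \<epsilon>) * integral Q (I \<epsilon>)" by (rule integral_mult_right)
    also have "\<dots> < 0" using hausdorff2_unit_pos \<epsilon>(1) Jneg by (intro mult_pos_neg) auto
    finally show ?thesis .
  qed
  ultimately show False by linarith
qed

end

section \<open>From stability to vertical lines and the vertical plane\<close>

lemma stable_vertical:
  assumes cl: "closed S" and surf: "C2_surface S" and char: "char_locus S = {}" and H: "H_minimal S"
    and stable: "H_stable S" and g: "g \<in> S"
  obtains c s where "c * c + s * s = 1" "\<And>y. g + y *\<^sub>R E2 c s g \<in> S"
    "\<And>U \<phi>. defining_function S U \<phi> \<Longrightarrow> g \<in> U \<Longrightarrow> dd \<phi> (0, 0, 1) g = 0"
proof -
  obtain U \<phi> where U: "g \<in> U" and def: "defining_function S U \<phi>"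
    using surf g unfolding C2_surface_def by blast
  have \<phi>d: "\<phi> differentiable at g" using defining_functionD(2)[OF def] U unfolding c2_on_def by blast
  define \<alpha> where "\<alpha> = dd \<phi> (X1 g) g"
  define \<beta> where "\<beta> = dd \<phi> (X2 g) g"
  define w where "w = sqrt (\<alpha>\<^sup>2 + \<beta>\<^sup>2)"
  have "\<alpha> \<noteq> 0 \<or> \<beta> \<noteq> 0" using noncharacteristic[OF char def g U] by (simp add: \<alpha>_def \<beta>_def)
  then have "0 < \<alpha>\<^sup>2 + \<beta>\<^sup>2" by (simp add: sum_power2_gt_zero_iff)
  then have w: "0 < w" "w * w = \<alpha>\<^sup>2 + \<beta>\<^sup>2" by (simp_all add: w_def)
  \<comment> \<open>The unit horizontal normal: with this rotation \<open>E1\<close> points along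
    the horizontal gradient of \<phi>, and \<open>E2\<close> is tangent.\<close>
  define c where "c = \<alpha> / w"
  define s where "s = \<beta> / w"
  have "c * c + s * s = (\<alpha>\<^sup>2 + \<beta>\<^sup>2) / (w * w)"
    by (simp add: c_def s_def add_divide_distrib power2_eq_square)
  then have cs: "c * c + s * s = 1" using w(1) by (simp flip: w(2))
  have "dd \<phi> (E2 c s g) g = - s * \<alpha> + c * \<beta>"
    unfolding E2_def \<alpha>_def \<beta>_def by (simp only: dd_linear[OF \<phi>d] real_scaleR_def)
  then have t: "dd \<phi> (E2 c s g) g = 0" by (simp add: c_def s_def)
  have lineS: "g + y *\<^sub>R E2 c s g \<in> S" for y
    by (rule line_in_surface[OF cs cl surf char H def g U t])
  interpret heis_chart g c s by unfold_locales (rule cs)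
  interpret ruled_strip g c s S
  proof
    show "\<Phi> (0, (y, 0)) \<in> S" for y using lineS[of y] by (simp add: chart_line flip: zero_prod_def)
  qed (rule surf char H)+
  obtain r d f where rd: "0 < r" "0 < d" and P: "patch S 0 r (ball (0, 0) d) f"
    by (rule patch_at_line[of 0])
  have o: "(0, 0) \<in> ball (0, 0) d" using rd by simp
  have m: "dd f (0, 1) (0, 0) = 0" using unstable[OF P o] stable by blast
  have f0: "f (0, 0) = 0" by (rule patch_zero_section(1)[OF P o])
  have "dd \<phi>' (0, 0, 1) g = 0" if "defining_function S U' \<phi>'" "g \<in> U'" for U' \<phi>'
    using patch_tangent(2)[OF P that(1) o] that(2) by (simp add: m f0 chart_0)
  then show ?thesis using that[OF cs lineS] by blast
qed

text \<open>The parameters of points in \<open>S\<close> form a closed set because \<open>S\<close>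
  is closed. They form an open one because \<open>stable_vertical\<close> applies at every point of
  a patch, not only at its centre: the \<tau>-derivative of \<open>f\<close> vanishes identically
  there, and \<open>f\<close> is constant on a vertical segment.\<close>

lemma stable_vertical_line:
  assumes cl: "closed S" and surf: "C2_surface S" and char: "char_locus S = {}" and H: "H_minimal S"
    and stable: "H_stable S" and g: "g \<in> S"
  shows "g + \<tau> *\<^sub>R (0, 0, 1) \<in> S"
proof -
  let ?T = "(0, 0, 1) :: heis"
  define C where "C = {\<tau>. g + \<tau> *\<^sub>R ?T \<in> S}"
  have "closed C"
    using closed_vimage[OF cl, of "\<lambda>\<tau>. g + \<tau> *\<^sub>R ?T"] by (simp add: C_def vimage_def continuous_intros)
  moreover have "open C"
    unfolding open_contains_ball
  proof
    fix \<tau>0 assume "\<tau>0 \<in> C"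
    then have hS: "g + \<tau>0 *\<^sub>R ?T \<in> S" by (simp add: C_def)
    define h where "h = g + \<tau>0 *\<^sub>R ?T"
    obtain c s where cs: "c * c + s * s = 1" and line: "\<And>y. h + y *\<^sub>R E2 c s h \<in> S"
      by (rule stable_vertical[OF cl surf char H stable hS[folded h_def]]) (rule that; assumption)
    interpret heis_chart h c s by unfold_locales (rule cs)
    interpret ruled_strip h c s S
    proof
      show "\<Phi> (0, (y, 0)) \<in> S" for y using line[of y] by (simp add: chart_line flip: zero_prod_def)
    qed (rule surf char H)+
    obtain r d f where rd: "0 < r" "0 < d" and P: "patch S 0 r (ball (0, 0) d) f"
      by (rule patch_at_line[of 0])
    note p = patchD[OF P]
    have o: "(0, 0) \<in> ball (0, 0) d" using rd by simp
    have f0: "f (0, 0) = 0" by (rule patch_zero_section(1)[OF P o])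
    have ft: "dd f (0, 1) q = 0" if q: "q \<in> ball (0, 0) d" for q
    proof -
      let ?g = "\<Phi> (f q, q)"
      have "?g \<in> tube 0 r (ball (0, 0) d)" using p(3)[OF q] q by (auto simp: tube_def abs_less_iff)
      then have "dd (patch_fun f) (0, 0, 1) ?g = 0"
        using stable_vertical[OF cl surf char H stable p(5)[OF q]] patch_defining[OF P] by metis
      moreover have "dd (patch_fun f) (dd \<Phi> (0, 0, 1) (f q, q)) ?g = 0 - dd f (0, 1) q"
        using dd_patch_fun[of f "(f q, q)" "(0, 0, 1)"] p(6)[OF q] by simp
      ultimately show ?thesis by (simp add: dd_chart_frame)
    qed
    have "\<tau> \<in> C" if "\<tau> \<in> ball \<tau>0 d" for \<tau>
    proof -
      define z where "z = \<tau> - \<tau>0"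
      have zd: "\<bar>z\<bar> < d" using that by (simp add: z_def dist_real_def abs_minus_commute)
      have inb: "(0, k) \<in> ball (0, 0) d" if "\<bar>k\<bar> < d" for k :: real
        using that by (simp add: dist_Pair_Pair dist_real_def)
      have der: "((\<lambda>k. f (0, k)) has_real_derivative 0) (at k within {-d<..<d})" if "k \<in> {-d<..<d}" for k
      proof -
        have k: "(0, k) \<in> ball (0, 0) d" using that by (intro inb) (auto simp: abs_less_iff)
        have fd: "f differentiable at (0, k)" by (rule p(6)[OF k])
        have "((\<lambda>k. (0 :: real, k)) has_derivative (\<lambda>h. (0, h))) (at k)" by (auto intro!: derivative_eq_intros)
        then have "((\<lambda>k. f (0, k)) has_derivative (\<lambda>h. dd f (0, h) (0, k))) (at k)"
          by (rule has_derivative_compose[where g = f and g' = "\<lambda>v. dd f v (0, k)"]) (rule has_derivative_ddI[OF fd])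
        moreover have "(\<lambda>h. dd f (0, h) (0, k)) = (*) 0"
        proof
          fix h
          show "dd f (0, h) (0, k) = 0 * h"
            using dd_linear(2)[OF fd, of h "(0, 1)"] by (simp add: ft[OF k])
        qed
        ultimately show ?thesis
          by (simp only: has_field_derivative_def has_derivative_at_withinI)
      qed
      have "\<exists>k. \<forall>x\<in>{-d<..<d}. f (0, x) = k"
        by (rule has_field_derivative_zero_constant[OF _ der]) auto
      moreover have "z \<in> {-d<..<d}" "0 \<in> {-d<..<d}" using zd rd by (auto simp: abs_less_iff)
      ultimately have "f (0, z) = f (0, 0)" by metis
      then have "\<Phi> (0, (0, z)) \<in> S" using p(5)[OF inb[OF zd]] f0 by simp
      then have "h + z *\<^sub>R ?T \<in> S" by (simp add: chart_line)
      then show ?thesis by (simp add: C_def h_def z_def algebra_simps)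
    qed
    then show "\<exists>e>0. ball \<tau>0 e \<subseteq> C" using rd by blast
  qed
  moreover have "0 \<in> C" using g by (simp add: C_def zero_prod_def[symmetric])
  ultimately have "C = UNIV" using clopen[of C] by blast
  then show ?thesis by (auto simp: C_def)
qed

theorem theorem1p8:
  fixes S :: "heis set"
  assumes "entire_graph S"
    and "char_locus S = {}"
    and "H_minimal S"
    and "H_stable S"
  shows "\<exists>a b \<gamma> :: real. (a, b) \<noteq> (0, 0) \<and> S = {(x, y, t). a * x + b * y = \<gamma>}"
proof -
  obtain n where "line_graph S n" by (rule entire_graph_line_graph[OF assms(1)])
  then interpret line_graph S n .
  note A = closed_S surface assms(2,3,4)
  obtain g where g: "g \<in> S" using hit by blast
  obtain c s where cs: "c * c + s * s = 1" and line: "\<And>y. g + y *\<^sub>R E2 c s g \<in> S"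
    by (rule stable_vertical[OF A g]) (rule that; assumption)
  interpret heis_chart g c s by unfold_locales (rule cs)
  define \<gamma> where "\<gamma> = c * fst g + s * fst (snd g)"
  define plane where "plane = {h :: heis. c * fst h + s * fst (snd h) = \<gamma>}"
  \<comment> \<open>The plane is the slice x = 0 of the chart: each of its points is reached by
    going along the ruling line through \<open>g\<close> and then vertically, and both moves stay in
    \<open>S\<close>.\<close>
  have plane_S: "h \<in> S" if "h \<in> plane" for h
  proof -
    have "fst (\<Psi> h) = 0" using that by (simp add: plane_def \<gamma>_def unchart_def algebra_simps)
    then have "h = \<Phi> (0, snd (\<Psi> h))" by (metis chart_unchart prod.collapse)
    also have "\<dots> = g + fst (snd (\<Psi> h)) *\<^sub>R E2 c s g + snd (snd (\<Psi> h)) *\<^sub>R (0, 0, 1)"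
      using chart_line[of "fst (snd (\<Psi> h))" "snd (snd (\<Psi> h))"] by simp
    also have "\<dots> \<in> S" by (rule stable_vertical_line[OF A line])
    finally show ?thesis .
  qed
  define \<nu> where "\<nu> = c * fst n + s * fst (snd n)"
  have along: "c * fst (h + t *\<^sub>R n) + s * fst (snd (h + t *\<^sub>R n)) = c * fst h + s * fst (snd h) + t * \<nu>" for h t
    by (simp add: \<nu>_def algebra_simps)
  \<comment> \<open>A graph direction parallel to the plane would give a whole line of that
    direction inside \<open>S\<close>, while each such line meets \<open>S\<close> once.\<close>
  have "\<nu> \<noteq> 0"
  proof
    assume "\<nu> = 0"
    then have "g + 0 *\<^sub>R n \<in> plane" "g + 1 *\<^sub>R n \<in> plane" unfolding plane_def \<gamma>_def mem_Collect_eq along by simp_all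
    then have "(0 :: real) = 1" using plane_S hit_unique by blast
    then show False by simp
  qed
  \<comment> \<open>Since the graph direction crosses the plane, the line through \<open>h\<close>
    meets it in a point of \<open>S\<close>, and uniqueness identifies that point with
    \<open>h\<close>.\<close>
  have S_plane: "h \<in> plane" if h: "h \<in> S" for h
  proof -
    define k where "k = (\<gamma> - (c * fst h + s * fst (snd h))) / \<nu>"
    have "h + k *\<^sub>R n \<in> plane" unfolding plane_def mem_Collect_eq along using \<open>\<nu> \<noteq> 0\<close> by (simp add: k_def)
    then have "h + k *\<^sub>R n \<in> S" by (rule plane_S)
    moreover have "h + 0 *\<^sub>R n \<in> S" using h by simp
    ultimately have "k = 0" by (rule hit_unique)
    then show ?thesis using \<open>h + k *\<^sub>R n \<in> plane\<close> by simp
  qed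
  have "S = plane" by (rule antisym; rule subsetI; erule S_plane plane_S)
  also have "plane = {(x, y, t). c * x + s * y = \<gamma>}" by (auto simp: plane_def)
  finally have "S = {(x, y, t). c * x + s * y = \<gamma>}" .
  moreover have "(c, s) \<noteq> (0, 0)" using cs by auto
  ultimately show ?thesis by blast
qed

end
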